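(* Let $K$ be a field, $S=K[x_1,\dots,x_m,y_1,\dots,y_n]$ the standard bigraded polynomial ring, $Q=(y_1,\dots,y_n)$, and let $R=S/fS$ be a hypersurface ring, where $f\in S$ is a bihomogeneous form of degree $(a,b)$. Let $c(f)$ be the ideal of $K[x_1,\dots,x_m]$ generated by all the coefficients of $f$, and let $P_0=(x_1,\dots,x_m)$ be the graded maximal ideal of $K[x_1,\dots,x_m]$. Then: (a) if $m\le 1$, then $H^n_Q(R)$ is an Artinian $S$-module; (b) let $m\ge 2$; if $H^n_Q(R)$ is an Artinian $S$-module, then $c(f)$ is a $P_0$-primary ideal which does not form a system of parameters for $K[x_1,\dots,x_m]$.
   Context: The bigrading on $S$ is given by $\deg x_i=(1,0)$ and $\deg y_j=(0,1)$; $m=0$ is allowed (then $S=K[y_1,\dots,y_n]$). The coefficients of $f$ are those of $f$ viewed as a polynomial in $y_1,\dots,y_n$ over $K[x_1,\dots,x_m]$. $H^i_Q$ denotes the $i$-th local cohomology functor with support in $Q$.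
   Formalization: The form f is taken nonzero, and part (b) assumes a ≥ 1: for a = 0 the ideal c(f) is all of K[x_1,…,x_m], hence not P_0-primary, while H^n_Q(R) = 0 is Artinian, so (b) fails there. *)

theory Defs
  imports
    "HOL-Algebra.Module"
    "HOL-Algebra.QuotRing"
    "HOL-Algebra.Ideal_Product"
    "HOL-Library.Poly_Mapping"
    "HOL-Library.Extended_Nat"
begin

section \<open>Modules\<close>

text \<open>
  Modules are those of \<^theory>\<open>HOL-Algebra.Module\<close>. Their records inherit the fields
  \<open>mult\<close> and \<open>one\<close> from rings; these play no role and are left unspecified below.
\<close>

definition mod_hom ::
  "('a, 'r) ring_scheme \<Rightarrow> ('a, 'b, 'm) module_scheme \<Rightarrow> ('a, 'c, 'n) module_scheme \<Rightarrow> ('b \<Rightarrow> 'c) set"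
  where "mod_hom R M N =
    {h \<in> carrier M \<rightarrow> carrier N.
       (\<forall>x\<in>carrier M. \<forall>y\<in>carrier M. h (x \<oplus>\<^bsub>M\<^esub> y) = h x \<oplus>\<^bsub>N\<^esub> h y) \<and>
       (\<forall>r\<in>carrier R. \<forall>x\<in>carrier M. h (r \<odot>\<^bsub>M\<^esub> x) = r \<odot>\<^bsub>N\<^esub> h x)}"

definition quotient_module ::
  "('a, 'r) ring_scheme \<Rightarrow> ('a, 'b, 'm) module_scheme \<Rightarrow> 'b set \<Rightarrow> ('a, 'b set) module"
  where "quotient_module R M N =
    \<lparr>carrier = a_rcosets\<^bsub>M\<^esub> N, monoid.mult = undefined, one = undefined,
     zero = N, add = set_add M, smult = (\<lambda>r C. \<Union>x\<in>C. N +>\<^bsub>M\<^esub> (r \<odot>\<^bsub>M\<^esub> x))\<rparr>"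

text \<open>The residue class ring \<open>R/I\<close> as an \<open>R\<close>-module, by restriction of scalars.\<close>

definition quot_ring_module :: "('a, 'r) ring_scheme \<Rightarrow> 'a set \<Rightarrow> ('a, 'a set) module"
  where "quot_ring_module R I =
    ring.extend (R Quot I) \<lparr>smult = (\<lambda>r C. (I +>\<^bsub>R\<^esub> r) \<otimes>\<^bsub>R Quot I\<^esub> C)\<rparr>"

definition artinian_module :: "('a, 'r) ring_scheme \<Rightarrow> ('a, 'b, 'm) module_scheme \<Rightarrow> bool"
  where "artinian_module R M \<longleftrightarrow>
    Module.module R M \<and>
    (\<forall>N :: nat \<Rightarrow> 'b set. (\<forall>i. submodule (N i) R M) \<and> (\<forall>i. N (Suc i) \<subseteq> N i) \<longrightarrow>
       (\<exists>k. \<forall>i\<ge>k. N i = N k))"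

text \<open>
  A definition cannot quantify over types, so the extension property is required for test
  modules \<open>M\<close>, \<open>N\<close> whose carriers lie in the type of the ring. These include the ring itself and
  all its ideals, so by Baer's criterion the extension property then holds for all modules.
\<close>

definition injective_module :: "('a, 'r) ring_scheme \<Rightarrow> ('a, 'b, 'm) module_scheme \<Rightarrow> bool"
  where "injective_module R E \<longleftrightarrow>
    Module.module R E \<and>
    (\<forall>(M :: ('a, 'a) module) (N :: ('a, 'a) module) \<iota> \<phi>.
       Module.module R M \<and> Module.module R N \<and>
       \<iota> \<in> mod_hom R M N \<and> inj_on \<iota> (carrier M) \<and> \<phi> \<in> mod_hom R M E \<longrightarrow>
       (\<exists>\<psi>\<in>mod_hom R N E. \<forall>x\<in>carrier M. \<psi> (\<iota> x) = \<phi> x))"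

section \<open>Local cohomology\<close>

text \<open>Exactness of \<open>0 \<rightarrow> M \<rightarrow> E 0 \<rightarrow> E 1 \<rightarrow> \<dots>\<close> with maps \<open>\<epsilon>\<close>, \<open>d 0\<close>, \<open>d 1\<close>, \<open>\<dots>\<close>\<close>

definition injective_resolution ::
  "('a, 'r) ring_scheme \<Rightarrow> ('a, 'b, 'm) module_scheme \<Rightarrow> (nat \<Rightarrow> ('a, 'e, 'n) module_scheme) \<Rightarrow>
   (nat \<Rightarrow> 'e \<Rightarrow> 'e) \<Rightarrow> ('b \<Rightarrow> 'e) \<Rightarrow> bool"
  where "injective_resolution R M E d \<epsilon> \<longleftrightarrow>
    Module.module R M \<and>
    (\<forall>i. injective_module R (E i)) \<and>
    (\<forall>i. d i \<in> mod_hom R (E i) (E (Suc i))) \<and>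
    \<epsilon> \<in> mod_hom R M (E 0) \<and>
    inj_on \<epsilon> (carrier M) \<and>
    \<epsilon> ` carrier M = a_kernel (E 0) (E 1) (d 0) \<and>
    (\<forall>i. d i ` carrier (E i) = a_kernel (E (Suc i)) (E (Suc (Suc i))) (d (Suc i)))"

text \<open>The section functor \<open>\<Gamma>\<^sub>I\<close> with support in \<open>I\<close>; on maps it is restriction.\<close>

definition torsion_submodule ::
  "('a, 'r) ring_scheme \<Rightarrow> 'a set \<Rightarrow> ('a, 'b, 'm) module_scheme \<Rightarrow> ('a, 'b, 'm) module_scheme"
  where "torsion_submodule R I M =
    M\<lparr>carrier := {x \<in> carrier M. \<exists>k::nat. \<forall>r \<in> I [^]\<^bsub>ideals_set R\<^esub> k. r \<odot>\<^bsub>M\<^esub> x = \<zero>\<^bsub>M\<^esub>}\<rparr>"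

definition cohomology_module ::
  "('a, 'r) ring_scheme \<Rightarrow> (nat \<Rightarrow> ('a, 'e, 'n) module_scheme) \<Rightarrow> (nat \<Rightarrow> 'e \<Rightarrow> 'e) \<Rightarrow>
   nat \<Rightarrow> ('a, 'e set) module"
  where "cohomology_module R C d i =
    quotient_module R
      ((C i)\<lparr>carrier := a_kernel (C i) (C (Suc i)) (d i)\<rparr>)
      (case i of 0 \<Rightarrow> {\<zero>\<^bsub>C 0\<^esub>} | Suc j \<Rightarrow> d j ` carrier (C j))"

text \<open>
  \<open>H\<^sup>i\<^sub>I(M)\<close> is the \<open>i\<close>-th right derived functor of \<open>\<Gamma>\<^sub>I\<close>. It is computed from an injective
  resolution \<open>(E, d)\<close> of \<open>M\<close>, on which it depends only up to isomorphism; statements about it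
  are quantified over all injective resolutions of \<open>M\<close>.
\<close>

definition local_cohomology ::
  "('a, 'r) ring_scheme \<Rightarrow> 'a set \<Rightarrow> (nat \<Rightarrow> ('a, 'e, 'n) module_scheme) \<Rightarrow> (nat \<Rightarrow> 'e \<Rightarrow> 'e) \<Rightarrow>
   nat \<Rightarrow> ('a, 'e set) module"
  where "local_cohomology R I E d i = cohomology_module R (\<lambda>j. torsion_submodule R I (E j)) d i"

section \<open>Primary ideals and systems of parameters\<close>

definition radical_ideal :: "('a, 'r) ring_scheme \<Rightarrow> 'a set \<Rightarrow> 'a set"
  where "radical_ideal R I = {r \<in> carrier R. \<exists>k::nat. r [^]\<^bsub>R\<^esub> k \<in> I}"

definition primary_ideal :: "('a, 'r) ring_scheme \<Rightarrow> 'a set \<Rightarrow> bool"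
  where "primary_ideal R I \<longleftrightarrow>
    ideal I R \<and> I \<noteq> carrier R \<and>
    (\<forall>r\<in>carrier R. \<forall>s\<in>carrier R. r \<otimes>\<^bsub>R\<^esub> s \<in> I \<longrightarrow> r \<in> I \<or> s \<in> radical_ideal R I)"

definition primary_to :: "('a, 'r) ring_scheme \<Rightarrow> 'a set \<Rightarrow> 'a set \<Rightarrow> bool"
  where "primary_to R P I \<longleftrightarrow> primary_ideal R I \<and> radical_ideal R I = P"

definition krull_dim :: "('a, 'r) ring_scheme \<Rightarrow> enat"
  where "krull_dim R =
    Sup {enat k | k. \<exists>p :: nat \<Rightarrow> 'a set.
           (\<forall>i\<le>k. primeideal (p i) R) \<and> (\<forall>i<k. p i \<subset> p (Suc i))}"

text \<open>Here \<open>P\<close> is the (graded) maximal ideal of the (graded) local ring \<open>R\<close>.\<close>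

definition system_of_parameters :: "('a, 'r) ring_scheme \<Rightarrow> 'a set \<Rightarrow> 'a list \<Rightarrow> bool"
  where "system_of_parameters R P xs \<longleftrightarrow>
    enat (length xs) = krull_dim R \<and> set xs \<subseteq> P \<and> radical_ideal R (Idl\<^bsub>R\<^esub> (set xs)) = P"

definition forms_system_of_parameters :: "('a, 'r) ring_scheme \<Rightarrow> 'a set \<Rightarrow> 'a set \<Rightarrow> bool"
  where "forms_system_of_parameters R P I \<longleftrightarrow>
    (\<exists>xs. system_of_parameters R P xs \<and> I = Idl\<^bsub>R\<^esub> (set xs))"

section \<open>Polynomial rings\<close>

type_synonym ('i, 'k) mpoly = "('i \<Rightarrow>\<^sub>0 nat) \<Rightarrow>\<^sub>0 'k"

definition mpoly_ring :: "'i set \<Rightarrow> ('i, 'k::comm_ring_1) mpoly ring"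
  where "mpoly_ring V =
    \<lparr>carrier = {p. \<forall>\<alpha>\<in>Poly_Mapping.keys p. Poly_Mapping.keys \<alpha> \<subseteq> V},
     monoid.mult = (*), one = 1, zero = 0, add = (+)\<rparr>"

definition mvar :: "'i \<Rightarrow> ('i, 'k::comm_ring_1) mpoly"
  where "mvar i = Poly_Mapping.single (Poly_Mapping.single i 1) 1"

text \<open>
  The variables \<open>x\<^sub>1, \<dots>, x\<^sub>m\<close> are \<open>Inl 0, \<dots>, Inl (m - 1)\<close> and \<open>y\<^sub>1, \<dots>, y\<^sub>n\<close> are
  \<open>Inr 0, \<dots>, Inr (n - 1)\<close>; thus \<open>K[x\<^sub>1, \<dots>, x\<^sub>m]\<close> is a subring of \<open>S\<close>.
\<close>

type_synonym 'k bipoly = "(nat + nat, 'k) mpoly"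

definition x_ring :: "nat \<Rightarrow> 'k::field bipoly ring"
  where "x_ring m = mpoly_ring (Inl ` {..<m})"

definition xy_ring :: "nat \<Rightarrow> nat \<Rightarrow> 'k::field bipoly ring"
  where "xy_ring m n = mpoly_ring (Inl ` {..<m} \<union> Inr ` {..<n})"

definition x_ideal :: "nat \<Rightarrow> 'k::field bipoly set"
  where "x_ideal m = Idl\<^bsub>x_ring m\<^esub> ((\<lambda>i. mvar (Inl i)) ` {..<m})"

definition y_ideal :: "nat \<Rightarrow> nat \<Rightarrow> 'k::field bipoly set"
  where "y_ideal m n = Idl\<^bsub>xy_ring m n\<^esub> ((\<lambda>j. mvar (Inr j)) ` {..<n})"

definition bihomogeneous :: "nat \<Rightarrow> nat \<Rightarrow> nat \<Rightarrow> nat \<Rightarrow> 'k::field bipoly \<Rightarrow> bool"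
  where "bihomogeneous m n a b f \<longleftrightarrow>
    f \<in> carrier (xy_ring m n) \<and>
    (\<forall>\<alpha>\<in>Poly_Mapping.keys f.
       (\<Sum>i<m. Poly_Mapping.lookup \<alpha> (Inl i)) = a \<and> (\<Sum>j<n. Poly_Mapping.lookup \<alpha> (Inr j)) = b)"

text \<open>
  The coefficient in \<open>K[x\<^sub>1, \<dots>, x\<^sub>m]\<close> of the monomial \<open>y\<^sup>\<beta>\<close> in \<open>f\<close>: the coefficient of \<open>x\<^sup>\<alpha>\<close> in it
  is the coefficient of \<open>x\<^sup>\<alpha>y\<^sup>\<beta>\<close> in \<open>f\<close>. The exponent \<open>\<beta>\<close> should involve only \<open>y\<close>-variables.
\<close>

lift_definition y_coeff :: "'k::field bipoly \<Rightarrow> (nat + nat \<Rightarrow>\<^sub>0 nat) \<Rightarrow> 'k bipoly"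
  is "\<lambda>f \<beta> \<alpha>. if Poly_Mapping.keys \<alpha> \<subseteq> range Inl then f (\<alpha> + \<beta>) else 0"
proof -
  fix f :: "(nat + nat \<Rightarrow>\<^sub>0 nat) \<Rightarrow> 'k" and \<beta> :: "nat + nat \<Rightarrow>\<^sub>0 nat"
  assume "finite {\<alpha>. f \<alpha> \<noteq> 0}"
  then have "finite ((\<lambda>\<alpha>. \<alpha> + \<beta>) -` {\<alpha>. f \<alpha> \<noteq> 0})"
    by (rule finite_vimageI) (simp add: inj_on_def)
  then show "finite {\<alpha>. (if Poly_Mapping.keys \<alpha> \<subseteq> range Inl then f (\<alpha> + \<beta>) else 0) \<noteq> 0}"
    by (rule rev_finite_subset) auto
qed

definition content_ideal :: "nat \<Rightarrow> 'k::field bipoly \<Rightarrow> 'k bipoly set"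
  where "content_ideal m f =
    Idl\<^bsub>x_ring m\<^esub> {y_coeff f \<beta> | \<beta>. Poly_Mapping.keys \<beta> \<subseteq> range Inr}"

definition hypersurface_module :: "nat \<Rightarrow> nat \<Rightarrow> 'k::field bipoly \<Rightarrow> ('k bipoly, 'k bipoly set) module"
  where "hypersurface_module m n f = quot_ring_module (xy_ring m n) (PIdl\<^bsub>xy_ring m n\<^esub> f)"

end

theory Submission
  imports "HOL-Computational_Algebra.Polynomial" Defs
begin

text \<open>
  Write \<open>H\<close> for the local cohomology module in question. Everything rests on its description by
  generalised fractions: the elements of \<open>H\<close> are symbols \<open>r / (y\<^sub>1 \<cdots> y\<^sub>n)\<^sup>T\<close> with \<open>r\<close> in the polynomial
  ring, linear in \<open>r\<close> and unchanged when numerator and denominator are multiplied by \<open>y\<^sub>1 \<cdots> y\<^sub>n\<close>, and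
  such a symbol vanishes exactly if some \<open>(y\<^sub>1 \<cdots> y\<^sub>n)\<^sup>t r\<close> lies in the ideal generated by \<open>f\<close> and the
  powers \<open>y\<^sub>j\<^sup>T\<^sup>+\<^sup>t\<close>. In other words, \<open>H\<close> is the cokernel of \<open>f\<close> on \<open>K[x] \<otimes> K[y\<^sup>-\<^sup>1]\<close>, where \<open>K[y\<^sup>-\<^sup>1]\<close> is the
  module of inverse polynomials. This is \<open>local_cohomology_presentation\<close>. It is derived from an
  arbitrary injective resolution by dimension shifting: \<open>y\<^sub>1\<^sup>T, \<dots>, y\<^sub>n\<^sup>T\<close> is a regular sequence, so
  \<open>y\<^sub>k\<^sup>T\<close> acts surjectively on the elements of an injective module that are killed by the earlier
  powers (\<open>divisible\<close>), and dividing by one power after another identifies the \<open>n\<close>-th cohomology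
  of the subcomplex killed by all powers with \<open>M / (y\<^sub>1\<^sup>T, \<dots>, y\<^sub>n\<^sup>T) M\<close>, where \<open>M\<close> is the hypersurface ring
  (\<open>boundary_iff_seq_multiples\<close>).

  If \<open>m \<le> 1\<close>, then \<open>f = x\<^sup>a g\<close> with \<open>g\<close> in \<open>K[y]\<close>. As \<open>g\<close> acts surjectively on inverse polynomials, \<open>x\<^sup>a\<close>
  kills \<open>H\<close> (\<open>x_power_kills\<close>). Hence \<open>H\<close> is spanned over \<open>K\<close> by inverse monomials on which every
  variable lowers an exponent or gives zero. The leading exponents of a submodule of such a module
  form a down-closed set which determines the submodule within a chain, and by Dickson's lemma
  a descending chain of down-closed sets is stationary (\<open>artinian_if_spanned\<close>).

  If \<open>m \<ge> 2\<close> and \<open>a \<ge> 1\<close>, then \<open>H\<close> is never Artinian (\<open>not_artinian\<close>), so that part (b) holds because its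
  premise fails. Indeed the classes of numerators of \<open>x\<close>-degree at least \<open>k\<close> form a descending chain
  of submodules. The part of \<open>H\<close> in \<open>x\<close>-degree \<open>k\<close> is the cokernel of \<open>f\<close> from \<open>K[x]\<^sub>k\<^sub>-\<^sub>a \<otimes> K[y\<^sup>-\<^sup>1]\<close> to
  \<open>K[x]\<^sub>k \<otimes> K[y\<^sup>-\<^sup>1]\<close>, and since \<open>K[x]\<^sub>k\<close> has the larger dimension there is a nonzero \<open>K[y]\<close>-linear
  functional on \<open>K[x]\<^sub>k \<otimes> K[y]\<close> that kills all multiples of \<open>f\<close>. Such a functional, found explicitly
  by solving a linear recurrence, detects an element of the \<open>k\<close>-th submodule outside the next one.
\<close>

section \<open>Homomorphisms and quotients of modules\<close>

lemma mod_homD: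
  assumes "h \<in> mod_hom R M N"
  shows "x \<in> carrier M \<Longrightarrow> h x \<in> carrier N"
    and "x \<in> carrier M \<Longrightarrow> y \<in> carrier M \<Longrightarrow> h (x \<oplus>\<^bsub>M\<^esub> y) = h x \<oplus>\<^bsub>N\<^esub> h y"
    and "r \<in> carrier R \<Longrightarrow> x \<in> carrier M \<Longrightarrow> h (r \<odot>\<^bsub>M\<^esub> x) = r \<odot>\<^bsub>N\<^esub> h x"
  using assms unfolding mod_hom_def by auto

lemma mod_hom_zero_minus:
  assumes h: "h \<in> mod_hom R M N" and M: "Module.module R M" and N: "Module.module R N"
  shows "h \<zero>\<^bsub>M\<^esub> = \<zero>\<^bsub>N\<^esub>"
    and "x \<in> carrier M \<Longrightarrow> y \<in> carrier M \<Longrightarrow> h (x \<ominus>\<^bsub>M\<^esub> y) = h x \<ominus>\<^bsub>N\<^esub> h y"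
proof -
  interpret M: Module.module R M by (rule M)
  interpret N: Module.module R N by (rule N)
  note hD = mod_homD[OF h]
  show zero: "h \<zero>\<^bsub>M\<^esub> = \<zero>\<^bsub>N\<^esub>"
    using hD(3)[of "\<zero>\<^bsub>R\<^esub>" "\<zero>\<^bsub>M\<^esub>"] hD(1)[of "\<zero>\<^bsub>M\<^esub>"] by simp
  assume x: "x \<in> carrier M" and y: "y \<in> carrier M"
  have "h (x \<ominus>\<^bsub>M\<^esub> y) \<oplus>\<^bsub>N\<^esub> h y = h x"
    using hD(2)[of "x \<ominus>\<^bsub>M\<^esub> y" y] x y by (simp add: a_minus_def M.a_assoc M.l_neg)
  then show "h (x \<ominus>\<^bsub>M\<^esub> y) = h x \<ominus>\<^bsub>N\<^esub> h y"
    using x y hD(1) by (metis M.minus_closed N.minus_eq N.add.inv_solve_right)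
qed

lemma (in Module.module) subset_module:
  assumes "submodule H R M" shows "Module.module R (M\<lparr>carrier := H\<rparr>)"
  using assms module_axioms by (rule submodule.submodule_is_module)

lemma mem_kernel_iff: "x \<in> a_kernel G H h \<longleftrightarrow> x \<in> carrier G \<and> h x = \<zero>\<^bsub>H\<^esub>"
  by (auto simp: a_kernel_def kernel_def)

lemma (in Module.module)
  assumes H: "submodule H R M"
  shows quotient_add: "x \<in> carrier M \<Longrightarrow> y \<in> carrier M \<Longrightarrow>
      (H +>\<^bsub>M\<^esub> x) \<oplus>\<^bsub>quotient_module R M H\<^esub> (H +>\<^bsub>M\<^esub> y) = H +>\<^bsub>M\<^esub> (x \<oplus>\<^bsub>M\<^esub> y)" (is "_ \<Longrightarrow> _ \<Longrightarrow> ?A")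
    and quotient_smult: "r \<in> carrier R \<Longrightarrow> x \<in> carrier M \<Longrightarrow>
      r \<odot>\<^bsub>quotient_module R M H\<^esub> (H +>\<^bsub>M\<^esub> x) = H +>\<^bsub>M\<^esub> (r \<odot>\<^bsub>M\<^esub> x)" (is "_ \<Longrightarrow> _ \<Longrightarrow> ?B")
    and quotient_zero: "\<zero>\<^bsub>quotient_module R M H\<^esub> = H"
    and quotient_carrier: "carrier (quotient_module R M H) = (\<lambda>x. H +>\<^bsub>M\<^esub> x) ` carrier M"
    and coset_eq_iff: "x \<in> carrier M \<Longrightarrow> y \<in> carrier M \<Longrightarrow>
      H +>\<^bsub>M\<^esub> x = H +>\<^bsub>M\<^esub> y \<longleftrightarrow> x \<ominus>\<^bsub>M\<^esub> y \<in> H" (is "_ \<Longrightarrow> _ \<Longrightarrow> ?C")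
    and quotient_module_is_module: "Module.module R (quotient_module R M H)"
proof -
  have sub: "subgroup H (add_monoid M)" using H by (rule submodule.axioms(1))
  have Hc: "H \<subseteq> carrier M" using submoduleE(1)[OF H] .
  interpret H: abelian_subgroup H M
    by (rule abelian_subgroupI3) (simp_all add: additive_subgroupI sub M.abelian_group_axioms)
  let ?Q = "quotient_module R M H"
  show carr: "carrier ?Q = (\<lambda>x. H +>\<^bsub>M\<^esub> x) ` carrier M"
    by (auto simp: quotient_module_def A_RCOSETS_def')
  show zero: "\<zero>\<^bsub>?Q\<^esub> = H" by (simp add: quotient_module_def)
  have add: "(H +>\<^bsub>M\<^esub> x) \<oplus>\<^bsub>?Q\<^esub> (H +>\<^bsub>M\<^esub> y) = H +>\<^bsub>M\<^esub> (x \<oplus>\<^bsub>M\<^esub> y)"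
    if "x \<in> carrier M" "y \<in> carrier M" for x y
    using H.a_rcos_sum[OF that] by (simp add: quotient_module_def)
  have eqI: "H +>\<^bsub>M\<^esub> x = H +>\<^bsub>M\<^esub> y" if "x \<in> carrier M" "y \<in> carrier M" "x \<ominus>\<^bsub>M\<^esub> y \<in> H" for x y
    using that by (metis M.a_repr_independence M.minus_eq H.a_rcos_module_imp H.a_rcos_module sub M.abelian_group_axioms)
  have smult: "r \<odot>\<^bsub>?Q\<^esub> (H +>\<^bsub>M\<^esub> x) = H +>\<^bsub>M\<^esub> (r \<odot>\<^bsub>M\<^esub> x)"
    if r: "r \<in> carrier R" and x: "x \<in> carrier M" for r x
  proof -
    have "H +>\<^bsub>M\<^esub> (r \<odot>\<^bsub>M\<^esub> x') = H +>\<^bsub>M\<^esub> (r \<odot>\<^bsub>M\<^esub> x)" if x': "x' \<in> H +>\<^bsub>M\<^esub> x" for x'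
    proof -
      obtain h where h: "h \<in> H" "x' = h \<oplus>\<^bsub>M\<^esub> x" using x' by (auto simp: a_r_coset_def r_coset_def)
      have hc: "h \<in> carrier M" using h Hc by auto
      have "r \<odot>\<^bsub>M\<^esub> x' \<ominus>\<^bsub>M\<^esub> r \<odot>\<^bsub>M\<^esub> x = r \<odot>\<^bsub>M\<^esub> h"
        using h hc r x by (simp add: smult_r_distr a_minus_def M.a_assoc M.r_neg)
      moreover have "r \<odot>\<^bsub>M\<^esub> h \<in> H" using submoduleE(4)[OF H] r h by blast
      ultimately show ?thesis using eqI[of "r \<odot>\<^bsub>M\<^esub> x'" "r \<odot>\<^bsub>M\<^esub> x"] r x hc h by auto
    qed
    moreover have "x \<in> H +>\<^bsub>M\<^esub> x" using x by (rule H.a_rcos_self)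
    ultimately have "(\<Union>x'\<in>H +>\<^bsub>M\<^esub> x. H +>\<^bsub>M\<^esub> (r \<odot>\<^bsub>M\<^esub> x')) = H +>\<^bsub>M\<^esub> (r \<odot>\<^bsub>M\<^esub> x)" by blast
    then show ?thesis by (simp add: quotient_module_def)
  qed
  show "x \<in> carrier M \<Longrightarrow> y \<in> carrier M \<Longrightarrow> ?A" by (rule add)
  show "r \<in> carrier R \<Longrightarrow> x \<in> carrier M \<Longrightarrow> ?B" by (rule smult)
  show "x \<in> carrier M \<Longrightarrow> y \<in> carrier M \<Longrightarrow> ?C"
    by (metis eqI H.a_rcos_self H.a_rcos_module M.minus_eq)
  have zero': "\<zero>\<^bsub>?Q\<^esub> = H +>\<^bsub>M\<^esub> \<zero>\<^bsub>M\<^esub>" using Hc by (simp add: zero)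
  have ab: "abelian_group ?Q"
  proof (rule abelian_groupI)
    fix X assume "X \<in> carrier ?Q"
    then obtain x where x: "x \<in> carrier M" "X = H +>\<^bsub>M\<^esub> x" by (auto simp: carr)
    then have "(H +>\<^bsub>M\<^esub> (\<ominus>\<^bsub>M\<^esub> x)) \<oplus>\<^bsub>?Q\<^esub> X = \<zero>\<^bsub>?Q\<^esub>" by (simp add: add zero' M.l_neg)
    then show "\<exists>Y\<in>carrier ?Q. Y \<oplus>\<^bsub>?Q\<^esub> X = \<zero>\<^bsub>?Q\<^esub>" using x by (auto simp: carr)
  qed (auto simp: carr add zero' M.a_ac)
  show "Module.module R ?Q"
  proof (rule moduleI[OF R.is_cring ab])
  qed (auto simp: carr add smult smult_l_distr smult_r_distr smult_assoc1)
qed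

section \<open>Divisibility in injective modules\<close>

text \<open>
  A regular sequence in the weak sense: the quotient by the whole sequence may vanish.
\<close>

definition weakly_regular :: "('a, 'r) ring_scheme \<Rightarrow> (nat \<Rightarrow> 'a) \<Rightarrow> nat \<Rightarrow> bool"
  where "weakly_regular R a n \<longleftrightarrow> (\<forall>j<n. a j \<in> carrier R) \<and>
    (\<forall>k<n. \<forall>s\<in>carrier R. s \<otimes>\<^bsub>R\<^esub> a k \<in> Idl\<^bsub>R\<^esub> (a ` {..<k}) \<longrightarrow> s \<in> Idl\<^bsub>R\<^esub> (a ` {..<k}))"

lemma (in Module.module) annihilator_ideal:
  assumes "e \<in> carrier M"
  shows "ideal {r \<in> carrier R. r \<odot>\<^bsub>M\<^esub> e = \<zero>\<^bsub>M\<^esub>} R"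
proof (rule idealI)
  show "ring R" by (rule R.ring_axioms)
  show "subgroup {r \<in> carrier R. r \<odot>\<^bsub>M\<^esub> e = \<zero>\<^bsub>M\<^esub>} (add_monoid R)"
    by (rule R.add.subgroupI) (use assms in \<open>auto simp: smult_l_distr smult_l_minus a_inv_def[symmetric]\<close>)
next
  fix r x assume r: "r \<in> {r \<in> carrier R. r \<odot>\<^bsub>M\<^esub> e = \<zero>\<^bsub>M\<^esub>}" and x: "x \<in> carrier R"
  then show "x \<otimes> r \<in> {r \<in> carrier R. r \<odot>\<^bsub>M\<^esub> e = \<zero>\<^bsub>M\<^esub>}" using assms by (simp add: smult_assoc1)
  then show "r \<otimes> x \<in> {r \<in> carrier R. r \<odot>\<^bsub>M\<^esub> e = \<zero>\<^bsub>M\<^esub>}" using r x R.m_comm[of r x] by simp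
qed

text \<open>Restricting the carrier realises an ideal as a test module for injectivity.\<close>

lemma (in cring) ideal_module:
  assumes J: "ideal J R"
  shows "Module.module R \<lparr>carrier = J, monoid.mult = undefined, one = undefined, zero = \<zero>, add = (\<oplus>), smult = (\<otimes>)\<rparr>"
    (is "Module.module R ?J")
proof -
  interpret J: ideal J R by (rule J)
  have "abelian_group ?J"
  proof (rule abelian_groupI)
    fix x assume x: "x \<in> carrier ?J"
    show "\<exists>y\<in>carrier ?J. y \<oplus>\<^bsub>?J\<^esub> x = \<zero>\<^bsub>?J\<^esub>"
      using x J.Icarr by (intro bexI[of _ "\<ominus> x"]) (auto simp: l_neg)
  qed (auto simp: J.Icarr a_ac J.a_closed)
  then show ?thesis
    by (rule moduleI[OF is_cring]) (auto simp: J.Icarr J.I_l_closed l_distr r_distr m_assoc)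
qed

text \<open>
  One direction of Baer's criterion: a linear map from an ideal to an injective module extends to
  the whole ring and is therefore multiplication by an element, the image of \<open>\<one>\<close>.
\<close>

lemma injective_module_extend:
  assumes E: "injective_module R E" and J: "ideal J R" and phi: "\<phi> \<in> J \<rightarrow> carrier E"
    and add: "\<And>x y. x \<in> J \<Longrightarrow> y \<in> J \<Longrightarrow> \<phi> (x \<oplus>\<^bsub>R\<^esub> y) = \<phi> x \<oplus>\<^bsub>E\<^esub> \<phi> y"
    and smult: "\<And>r x. r \<in> carrier R \<Longrightarrow> x \<in> J \<Longrightarrow> \<phi> (r \<otimes>\<^bsub>R\<^esub> x) = r \<odot>\<^bsub>E\<^esub> \<phi> x"
  shows "\<exists>e\<in>carrier E. \<forall>x\<in>J. x \<odot>\<^bsub>E\<^esub> e = \<phi> x"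
proof -
  let ?m = "\<lambda>J. \<lparr>carrier = J, monoid.mult = undefined, one = undefined, zero = \<zero>\<^bsub>R\<^esub>, add = add R, smult = mult R\<rparr>
    :: ('a, 'a) module"
  have "Module.module R E" using E by (simp add: injective_module_def)
  then interpret E: Module.module R E .
  interpret J: ideal J R by (rule J)
  have "\<exists>\<psi>\<in>mod_hom R (?m (carrier R)) E. \<forall>x\<in>carrier (?m J). \<psi> (id x) = \<phi> x"
  proof (rule E[unfolded injective_module_def, THEN conjunct2, rule_format], intro conjI)
    show "Module.module R (?m J)" by (rule E.R.ideal_module[OF J])
    show "Module.module R (?m (carrier R))" by (rule E.R.ideal_module[OF E.R.oneideal])
    show "\<phi> \<in> mod_hom R (?m J) E" using phi by (auto simp: mod_hom_def add smult)
  qed (auto simp: mod_hom_def J.Icarr)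
  then obtain \<psi> where psi: "\<psi> \<in> mod_hom R (?m (carrier R)) E" "\<And>x. x \<in> J \<Longrightarrow> \<psi> x = \<phi> x" by auto
  note psiD = mod_homD[OF psi(1), simplified]
  have "x \<odot>\<^bsub>E\<^esub> \<psi> \<one>\<^bsub>R\<^esub> = \<phi> x" if "x \<in> J" for x
    using psiD(3)[of x "\<one>\<^bsub>R\<^esub>"] psi(2)[OF that] J.Icarr[OF that] by simp
  then show ?thesis using psiD(1) by blast
qed

locale resolved_module =
  fixes R :: "('a, 'r) ring_scheme" (structure) and M :: "('a, 'b, 'm) module_scheme"
    and E :: "nat \<Rightarrow> ('a, 'e, 'n) module_scheme" and d :: "nat \<Rightarrow> 'e \<Rightarrow> 'e" and \<epsilon> :: "'b \<Rightarrow> 'e"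
  assumes resolution: "injective_resolution R M E d \<epsilon>"
begin

lemma E_module: "Module.module R (E i)"
  using resolution by (auto simp: injective_resolution_def injective_module_def)

sublocale E: Module.module R "E i" for i by (rule E_module)

sublocale M: Module.module R M
  using resolution by (auto simp: injective_resolution_def)

lemma d_hom: "d i \<in> mod_hom R (E i) (E (Suc i))"
  using resolution by (auto simp: injective_resolution_def)

lemma eps_hom: "\<epsilon> \<in> mod_hom R M (E 0)"
  using resolution by (auto simp: injective_resolution_def)

lemmas d_simps = mod_homD[OF d_hom] mod_hom_zero_minus[OF d_hom E_module E_module]
lemmas eps_simps = mod_homD[OF eps_hom] mod_hom_zero_minus[OF eps_hom M.module_axioms E_module]

lemma d_exact:
  "e \<in> carrier (E (Suc i)) \<Longrightarrow> d (Suc i) e = \<zero>\<^bsub>E (Suc (Suc i))\<^esub> \<Longrightarrow> \<exists>u\<in>carrier (E i). d i u = e"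
  "u \<in> carrier (E i) \<Longrightarrow> d (Suc i) (d i u) = \<zero>\<^bsub>E (Suc (Suc i))\<^esub>"
proof -
  have *: "d i ` carrier (E i) = a_kernel (E (Suc i)) (E (Suc (Suc i))) (d (Suc i))"
    using resolution by (auto simp: injective_resolution_def)
  show "e \<in> carrier (E (Suc i)) \<Longrightarrow> d (Suc i) e = \<zero>\<^bsub>E (Suc (Suc i))\<^esub> \<Longrightarrow> \<exists>u\<in>carrier (E i). d i u = e"
    using * mem_kernel_iff[of e] by (metis imageE)
  show "u \<in> carrier (E i) \<Longrightarrow> d (Suc i) (d i u) = \<zero>\<^bsub>E (Suc (Suc i))\<^esub>"
    using * mem_kernel_iff by (metis imageI)
qed

lemma eps_exact:
  "e \<in> carrier (E 0) \<Longrightarrow> d 0 e = \<zero>\<^bsub>E (Suc 0)\<^esub> \<Longrightarrow> \<exists>r\<in>carrier M. \<epsilon> r = e"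
  "r \<in> carrier M \<Longrightarrow> d 0 (\<epsilon> r) = \<zero>\<^bsub>E (Suc 0)\<^esub>"
  "r \<in> carrier M \<Longrightarrow> \<epsilon> r = \<zero>\<^bsub>E 0\<^esub> \<longleftrightarrow> r = \<zero>\<^bsub>M\<^esub>"
proof -
  have *: "\<epsilon> ` carrier M = a_kernel (E 0) (E (Suc 0)) (d 0)" and inj: "inj_on \<epsilon> (carrier M)"
    using resolution by (auto simp: injective_resolution_def)
  show "e \<in> carrier (E 0) \<Longrightarrow> d 0 e = \<zero>\<^bsub>E (Suc 0)\<^esub> \<Longrightarrow> \<exists>r\<in>carrier M. \<epsilon> r = e"
    using * mem_kernel_iff[of e] by (metis imageE)
  show "r \<in> carrier M \<Longrightarrow> d 0 (\<epsilon> r) = \<zero>\<^bsub>E (Suc 0)\<^esub>"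
    using * mem_kernel_iff by (metis imageI)
  show "r \<in> carrier M \<Longrightarrow> \<epsilon> r = \<zero>\<^bsub>E 0\<^esub> \<longleftrightarrow> r = \<zero>\<^bsub>M\<^esub>"
    using inj eps_simps(4) M.zero_closed by (metis inj_on_def)
qed

text \<open>
  The elements of \<open>E\<^sup>i\<close> killed by \<open>a\<^sub>0, \<dots>, a\<^sub>k\<^sub>-\<^sub>1\<close>, a copy of \<open>Hom(R/(a\<^sub>0, \<dots>, a\<^sub>k\<^sub>-\<^sub>1), E\<^sup>i)\<close>. The differential
  preserves them, and the cohomology of this subcomplex is \<open>Ext(R/(a\<^sub>0, \<dots>, a\<^sub>k\<^sub>-\<^sub>1), M)\<close>.
\<close>

definition killed :: "(nat \<Rightarrow> 'a) \<Rightarrow> nat \<Rightarrow> nat \<Rightarrow> 'e set"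
  where "killed a k i = {e \<in> carrier (E i). \<forall>j<k. a j \<odot>\<^bsub>E i\<^esub> e = \<zero>\<^bsub>E i\<^esub>}"

lemma killed_Suc: "e \<in> killed a (Suc k) i \<longleftrightarrow> e \<in> killed a k i \<and> a k \<odot>\<^bsub>E i\<^esub> e = \<zero>\<^bsub>E i\<^esub>"
  by (auto simp: killed_def less_Suc_eq)

lemma killed_carrier: "e \<in> killed a k i \<Longrightarrow> e \<in> carrier (E i)"
  by (simp add: killed_def)

lemma killed_submodule:
  assumes a: "\<And>j. j < k \<Longrightarrow> a j \<in> carrier R"
  shows "submodule (killed a k i) R (E i)"
proof (rule E.submoduleI)
  fix r x assume "r \<in> carrier R" "x \<in> killed a k i"
  moreover then have "a j \<odot>\<^bsub>E i\<^esub> (r \<odot>\<^bsub>E i\<^esub> x) = r \<odot>\<^bsub>E i\<^esub> (a j \<odot>\<^bsub>E i\<^esub> x)" if "j < k" for j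
    using a[OF that] by (simp add: killed_def E.smult_assoc1[symmetric] E.R.m_comm)
  ultimately show "r \<odot>\<^bsub>E i\<^esub> x \<in> killed a k i" by (simp add: killed_def)
qed (use a in \<open>auto simp: killed_def E.smult_r_distr E.smult_r_minus\<close>)

lemma killed_d:
  assumes "\<And>j. j < k \<Longrightarrow> a j \<in> carrier R" "e \<in> killed a k i"
  shows "d i e \<in> killed a k (Suc i)"
  using assms by (auto simp: killed_def d_simps(1) d_simps(3)[symmetric] d_simps(4))

text \<open>
  On the ideal \<open>(a\<^sub>0, \<dots>, a\<^sub>k)\<close> the rule \<open>s\<^sub>0 a\<^sub>0 + \<cdots> + s\<^sub>k a\<^sub>k \<mapsto> s\<^sub>k e\<close> is well defined: by regularity \<open>s\<^sub>k\<close> is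
  determined modulo \<open>(a\<^sub>0, \<dots>, a\<^sub>k\<^sub>-\<^sub>1)\<close>, which kills \<open>e\<close>. Extended to the ring it is multiplication by an
  element that \<open>a\<^sub>k\<close> sends to \<open>e\<close> and that the earlier members of the sequence kill.
\<close>

lemma divisible:
  assumes reg: "weakly_regular R a n" and k: "k < n" and e: "e \<in> killed a k i"
  shows "\<exists>e'\<in>killed a k i. a k \<odot>\<^bsub>E i\<^esub> e' = e"
proof -
  have a: "a j \<in> carrier R" if "j < n" for j using reg that by (auto simp: weakly_regular_def)
  have ak: "a k \<in> carrier R" and asub: "a ` {..<k} \<subseteq> carrier R" using a k by auto
  have ec: "e \<in> carrier (E i)" using e by (rule killed_carrier)
  define I where "I = Idl (a ` {..<k})"
  interpret I: ideal I R unfolding I_def by (rule E.R.genideal_ideal[OF asub])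
  have Isub: "I \<subseteq> {r \<in> carrier R. r \<odot>\<^bsub>E i\<^esub> e = \<zero>\<^bsub>E i\<^esub>}"
    unfolding I_def using e a k
    by (intro E.R.genideal_minimal E.annihilator_ideal[OF ec]) (auto simp: killed_def)
  have regD: "s \<in> I" if "s \<in> carrier R" "s \<otimes> a k \<in> I" for s
    using reg k that unfolding weakly_regular_def I_def by blast
  define J where "J = {x \<in> carrier R. \<exists>s\<in>carrier R. x \<ominus> s \<otimes> a k \<in> I}"
  \<comment> \<open>Any choice of the last coefficient will do; the fact \<open>phi_eq\<close> shows that the value does not depend on it.\<close>
  define sc where "sc x = (SOME s. s \<in> carrier R \<and> x \<ominus> s \<otimes> a k \<in> I)" for x
  define \<phi> where "\<phi> x = sc x \<odot>\<^bsub>E i\<^esub> e" for x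
  have sc: "sc x \<in> carrier R \<and> x \<ominus> sc x \<otimes> a k \<in> I" if "x \<in> J" for x
  proof -
    have "\<exists>s. s \<in> carrier R \<and> x \<ominus> s \<otimes> a k \<in> I" using that unfolding J_def by blast
    then show ?thesis unfolding sc_def by (rule someI_ex)
  qed
  have phi_eq: "\<phi> x = s \<odot>\<^bsub>E i\<^esub> e" if x: "x \<in> carrier R" and s: "s \<in> carrier R" "x \<ominus> s \<otimes> a k \<in> I" for x s
  proof -
    have "x \<in> J" using x s by (auto simp: J_def)
    note t = sc[OF this]
    have "(x \<ominus> s \<otimes> a k) \<oplus> \<ominus> (x \<ominus> sc x \<otimes> a k) \<in> I"
      using s t by (intro I.a_closed I.a_inv_closed) auto
    also have "(x \<ominus> s \<otimes> a k) \<oplus> \<ominus> (x \<ominus> sc x \<otimes> a k) = (sc x \<ominus> s) \<otimes> a k"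
      using x s t ak by algebra
    finally have "(sc x \<ominus> s) \<in> I" using t s by (metis regD E.R.minus_closed)
    then have "(sc x \<ominus> s) \<odot>\<^bsub>E i\<^esub> e = \<zero>\<^bsub>E i\<^esub>" using Isub by auto
    moreover have "sc x = (sc x \<ominus> s) \<oplus> s" using t s by algebra
    ultimately show ?thesis unfolding \<phi>_def using t s ec
      by (metis E.smult_l_distr E.R.minus_closed E.M.l_zero E.smult_closed)
  qed
  have J: "ideal J R"
  proof (rule idealI)
    show "ring R" by (rule E.R.ring_axioms)
    show "subgroup J (add_monoid R)"
    proof (rule E.R.add.subgroupI)
      have "\<zero> \<ominus> \<zero> \<otimes> a k = \<zero>" using ak by algebra
      then have "\<zero> \<in> J" unfolding J_def by (auto intro!: bexI[of _ \<zero>])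
      then show "J \<noteq> {}" by blast
    next
      fix x assume x: "x \<in> J"
      have "\<ominus> (x \<ominus> sc x \<otimes> a k) \<in> I" using sc[OF x] by auto
      moreover have "\<ominus> (x \<ominus> sc x \<otimes> a k) = (\<ominus> x) \<ominus> (\<ominus> sc x) \<otimes> a k"
        using x sc[OF x] ak unfolding J_def by (elim CollectE conjE) algebra
      ultimately show "\<ominus> x \<in> J"
        using x sc[OF x] unfolding J_def by auto
    next
      fix x y assume x: "x \<in> J" and y: "y \<in> J"
      have c: "x \<in> carrier R" "y \<in> carrier R" using x y by (auto simp: J_def)
      have "(x \<ominus> sc x \<otimes> a k) \<oplus> (y \<ominus> sc y \<otimes> a k) \<in> I" using sc[OF x] sc[OF y] by auto
      also have "(x \<ominus> sc x \<otimes> a k) \<oplus> (y \<ominus> sc y \<otimes> a k) = (x \<oplus> y) \<ominus> (sc x \<oplus> sc y) \<otimes> a k"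
        using c sc[OF x] sc[OF y] ak by algebra
      finally show "x \<oplus> y \<in> J"
        using c sc[OF x] sc[OF y] unfolding J_def by auto
    qed (auto simp: J_def)
    fix x r assume x: "x \<in> J" and r: "r \<in> carrier R"
    have c: "x \<in> carrier R" using x by (auto simp: J_def)
    have "r \<otimes> (x \<ominus> sc x \<otimes> a k) \<in> I" using sc[OF x] r I.I_l_closed by auto
    also have "r \<otimes> (x \<ominus> sc x \<otimes> a k) = (r \<otimes> x) \<ominus> (r \<otimes> sc x) \<otimes> a k"
      using c sc[OF x] ak r by algebra
    finally show rx: "r \<otimes> x \<in> J" using c sc[OF x] r unfolding J_def by auto
    then show "x \<otimes> r \<in> J" using c r by (simp add: E.R.m_comm)
  qed
  interpret J: ideal J R by (rule J)
  have "\<exists>e'\<in>carrier (E i). \<forall>x\<in>J. x \<odot>\<^bsub>E i\<^esub> e' = \<phi> x"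
  proof (rule injective_module_extend)
    show "injective_module R (E i)" using resolution by (auto simp: injective_resolution_def)
    show "ideal J R" by (rule J)
    show "\<phi> \<in> J \<rightarrow> carrier (E i)" using sc ec by (auto simp: \<phi>_def)
  next
    fix x y assume x: "x \<in> J" and y: "y \<in> J"
    have c: "x \<in> carrier R" "y \<in> carrier R" using x y by (simp_all add: J.Icarr)
    have "(x \<ominus> sc x \<otimes> a k) \<oplus> (y \<ominus> sc y \<otimes> a k) \<in> I" using sc[OF x] sc[OF y] by auto
    also have "(x \<ominus> sc x \<otimes> a k) \<oplus> (y \<ominus> sc y \<otimes> a k) = (x \<oplus> y) \<ominus> (sc x \<oplus> sc y) \<otimes> a k"
      using c sc[OF x] sc[OF y] ak by algebra
    finally have "\<phi> (x \<oplus> y) = (sc x \<oplus> sc y) \<odot>\<^bsub>E i\<^esub> e"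
      using c sc[OF x] sc[OF y] by (intro phi_eq) auto
    then show "\<phi> (x \<oplus> y) = \<phi> x \<oplus>\<^bsub>E i\<^esub> \<phi> y"
      using sc[OF x] sc[OF y] ec by (simp add: \<phi>_def E.smult_l_distr)
  next
    fix r x assume r: "r \<in> carrier R" and x: "x \<in> J"
    have c: "x \<in> carrier R" using x by (rule J.Icarr)
    have "r \<otimes> (x \<ominus> sc x \<otimes> a k) \<in> I" using sc[OF x] r I.I_l_closed by auto
    also have "r \<otimes> (x \<ominus> sc x \<otimes> a k) = (r \<otimes> x) \<ominus> (r \<otimes> sc x) \<otimes> a k"
      using c sc[OF x] ak r by algebra
    finally have "\<phi> (r \<otimes> x) = (r \<otimes> sc x) \<odot>\<^bsub>E i\<^esub> e"
      using c sc[OF x] r by (intro phi_eq) auto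
    then show "\<phi> (r \<otimes> x) = r \<odot>\<^bsub>E i\<^esub> \<phi> x"
      using sc[OF x] r ec by (simp add: \<phi>_def E.smult_assoc1)
  qed
  then obtain e' where e': "e' \<in> carrier (E i)" "\<And>x. x \<in> J \<Longrightarrow> x \<odot>\<^bsub>E i\<^esub> e' = \<phi> x" by auto
  have 1: "a k \<ominus> \<one> \<otimes> a k = \<zero>" using ak by algebra
  have "a k \<in> J" unfolding J_def using ak 1 by (auto intro!: bexI[of _ \<one>])
  moreover have "\<phi> (a k) = e" using phi_eq[of "a k" \<one>] ak 1 ec by simp
  ultimately have "a k \<odot>\<^bsub>E i\<^esub> e' = e" using e'(2) by auto
  moreover have "a j \<odot>\<^bsub>E i\<^esub> e' = \<zero>\<^bsub>E i\<^esub>" if j: "j < k" for j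
  proof -
    have aj: "a j \<in> I" "a j \<in> carrier R"
      unfolding I_def using E.R.genideal_self[OF asub] j a k by auto
    have 0: "a j \<ominus> \<zero> \<otimes> a k = a j" using aj ak by algebra
    have "a j \<in> J" unfolding J_def using aj 0 by (auto intro!: bexI[of _ \<zero>])
    moreover have "\<phi> (a j) = \<zero>\<^bsub>E i\<^esub>" using phi_eq[of "a j" \<zero>] aj 0 ec by simp
    ultimately show ?thesis using e'(2) by auto
  qed
  ultimately show ?thesis using e'(1) by (auto simp: killed_def)
qed

end

section \<open>Cohomology of the subcomplex killed by a regular sequence\<close>

primrec prod_below :: "('a, 'r) ring_scheme \<Rightarrow> (nat \<Rightarrow> 'a) \<Rightarrow> nat \<Rightarrow> 'a" where
  "prod_below R b 0 = \<one>\<^bsub>R\<^esub>"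
| "prod_below R b (Suc k) = b k \<otimes>\<^bsub>R\<^esub> prod_below R b k"

primrec seq_multiples :: "('a, 'b, 'm) module_scheme \<Rightarrow> (nat \<Rightarrow> 'a) \<Rightarrow> nat \<Rightarrow> 'b set" where
  "seq_multiples M a 0 = {\<zero>\<^bsub>M\<^esub>}"
| "seq_multiples M a (Suc k) =
    {a k \<odot>\<^bsub>M\<^esub> c \<oplus>\<^bsub>M\<^esub> r | c r. c \<in> carrier M \<and> r \<in> seq_multiples M a k}"

lemma (in cring) prod_below_closed:
  "(\<And>j. j < k \<Longrightarrow> b j \<in> carrier R) \<Longrightarrow> prod_below R b k \<in> carrier R"
  by (induction k) auto

lemma (in Module.module) seq_multiples_closed:
  "(\<And>j. j < k \<Longrightarrow> a j \<in> carrier R) \<Longrightarrow> seq_multiples M a k \<subseteq> carrier M"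
  by (induction k) auto

context resolved_module
begin

lemma weakly_regular_carrier: "weakly_regular R a n \<Longrightarrow> j < n \<Longrightarrow> a j \<in> carrier R"
  by (simp add: weakly_regular_def)

lemma killed_minus:
  assumes "\<And>j. j < k \<Longrightarrow> a j \<in> carrier R" "x \<in> killed a k i" "y \<in> killed a k i"
  shows "x \<ominus>\<^bsub>E i\<^esub> y \<in> killed a k i"
  using E.submoduleE(5,3)[OF killed_submodule] assms by (metis a_minus_def)

lemma killed_add:
  assumes "\<And>j. j < k \<Longrightarrow> a j \<in> carrier R" "x \<in> killed a k i" "y \<in> killed a k i"
  shows "x \<oplus>\<^bsub>E i\<^esub> y \<in> killed a k i"
  using E.submoduleE(5)[OF killed_submodule] assms by metis

lemma killed_smult:
  assumes "\<And>j. j < k \<Longrightarrow> a j \<in> carrier R" "r \<in> carrier R" "x \<in> killed a k i"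
  shows "r \<odot>\<^bsub>E i\<^esub> x \<in> killed a k i"
  using E.submoduleE(4)[OF killed_submodule] assms by metis

text \<open>
  Vanishing above the length of the sequence: this is \<open>Ext\<^sup>i\<^sup>+\<^sup>1(R/(a\<^sub>0, \<dots>, a\<^sub>k\<^sub>-\<^sub>1), M) = 0\<close> for \<open>k \<le> i\<close>. Multiplication
  by \<open>a\<^sub>k\<close> is surjective on the subcomplex killed by the first \<open>k\<close> members, with kernel the subcomplex
  killed by one more, and the induction step is a diagram chase in this short exact sequence.
\<close>

lemma killed_exact:
  assumes "weakly_regular R a n" "k \<le> n" "k \<le> i"
    and "w \<in> killed a k (Suc i)" "d (Suc i) w = \<zero>\<^bsub>E (Suc (Suc i))\<^esub>"
  shows "\<exists>u\<in>killed a k i. d i u = w"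
  using assms(2-)
proof (induction k arbitrary: i w)
  case 0
  then show ?case using d_exact(1)[of w i] by (auto simp: killed_def)
next
  case (Suc k)
  have a: "\<And>j. j < Suc k \<Longrightarrow> a j \<in> carrier R"
    using weakly_regular_carrier[OF assms(1)] Suc.prems(1) by auto
  obtain i' where i: "i = Suc i'" "k \<le> i'" using Suc.prems(2) by (cases i) auto
  have w: "w \<in> killed a k (Suc i)" "a k \<odot>\<^bsub>E (Suc i)\<^esub> w = \<zero>\<^bsub>E (Suc i)\<^esub>"
    using Suc.prems(3) by (auto simp: killed_Suc)
  obtain u where u: "u \<in> killed a k i" "d i u = w"
    using Suc.IH[of i w] Suc.prems w by auto
  note uc = killed_carrier[OF u(1)]
  have "d i (a k \<odot>\<^bsub>E i\<^esub> u) = \<zero>\<^bsub>E (Suc i)\<^esub>" using d_simps(3)[of "a k" u i] a uc u w by auto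
  then obtain v where v: "v \<in> killed a k i'" "d i' v = a k \<odot>\<^bsub>E i\<^esub> u"
    using Suc.IH[of i' "a k \<odot>\<^bsub>E i\<^esub> u"] Suc.prems(1) i killed_smult[of k a "a k" u i] a u by auto
  obtain v' where v': "v' \<in> killed a k i'" "a k \<odot>\<^bsub>E i'\<^esub> v' = v"
    using divisible[OF assms(1) _ v(1)] Suc.prems(1) by auto
  note v'c = killed_carrier[OF v'(1)]
  have dv': "d i' v' \<in> killed a k i" using killed_d[OF _ v'(1)] a i by auto
  note dv'c = killed_carrier[OF dv']
  \<comment> \<open>Correcting \<open>u\<close> by the boundary \<open>d v'\<close> makes it killed by \<open>a\<^sub>k\<close> as well.\<close>
  have "a k \<odot>\<^bsub>E i\<^esub> d i' v' = a k \<odot>\<^bsub>E i\<^esub> u"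
    using d_simps(3)[of "a k" v' i'] a v'c v v' i by simp
  then have "a k \<odot>\<^bsub>E i\<^esub> (u \<ominus>\<^bsub>E i\<^esub> d i' v') = \<zero>\<^bsub>E i\<^esub>"
    using a uc dv'c by (simp add: a_minus_def E.smult_r_distr E.smult_r_minus E.r_neg)
  then have "u \<ominus>\<^bsub>E i\<^esub> d i' v' \<in> killed a (Suc k) i"
    using killed_minus[of k a u i "d i' v'"] a u dv' by (auto simp: killed_Suc)
  moreover have "d i (d i' v') = \<zero>\<^bsub>E (Suc i)\<^esub>" using d_exact(2)[OF v'c] i by simp
  then have "d i (u \<ominus>\<^bsub>E i\<^esub> d i' v') = w"
    using d_simps(5)[OF uc dv'c] u d_simps(1)[OF uc] by (simp add: a_minus_def)
  ultimately show ?case by blast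
qed

text \<open>
  The iterated connecting homomorphism from \<open>M\<close> to the \<open>k\<close>-th cohomology of the subcomplex, as a
  relation between \<open>r\<close> and a cocycle \<open>w\<close>: embed \<open>r\<close> in \<open>E\<^sup>0\<close>, and in turn divide by \<open>a\<^sub>j\<close> and apply the
  differential. A relation avoids choosing the quotients.
\<close>

primrec represents :: "(nat \<Rightarrow> 'a) \<Rightarrow> nat \<Rightarrow> 'b \<Rightarrow> 'e \<Rightarrow> bool" where
  "represents a 0 = (\<lambda>r w. r \<in> carrier M \<and> w = \<epsilon> r)"
| "represents a (Suc k) = (\<lambda>r w. \<exists>u\<in>killed a k k. represents a k r (a k \<odot>\<^bsub>E k\<^esub> u) \<and> w = d k u)"

lemma represents_carrier: "represents a k r w \<Longrightarrow> r \<in> carrier M"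
  by (induction k arbitrary: w) auto

text \<open>
  In degree \<open>0\<close> there is no incoming differential, so only \<open>0\<close> is a boundary.
\<close>

definition boundaries :: "(nat \<Rightarrow> 'a) \<Rightarrow> nat \<Rightarrow> 'e set"
  where "boundaries a k = (case k of 0 \<Rightarrow> {\<zero>\<^bsub>E 0\<^esub>} | Suc j \<Rightarrow> d j ` killed a k j)"

context
  fixes a :: "nat \<Rightarrow> 'a" and n :: nat
  assumes regular: "weakly_regular R a n"
begin

lemma a_closed: "j < n \<Longrightarrow> a j \<in> carrier R"
  using weakly_regular_carrier[OF regular] .

lemma represents_closed:
  assumes "k \<le> n" "represents a k r w"
  shows "r \<in> carrier M" "w \<in> killed a k k" "d k w = \<zero>\<^bsub>E (Suc k)\<^esub>"
proof -
  have "r \<in> carrier M \<and> w \<in> killed a k k \<and> d k w = \<zero>\<^bsub>E (Suc k)\<^esub>"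
    using assms
  proof (induction k arbitrary: w)
    case 0
    then show ?case by (auto simp: killed_def eps_simps eps_exact)
  next
    case (Suc k)
    then obtain u where u: "u \<in> killed a k k" "represents a k r (a k \<odot>\<^bsub>E k\<^esub> u)" "w = d k u" by auto
    note uc = killed_carrier[OF u(1)]
    have a: "\<And>j. j < Suc k \<Longrightarrow> a j \<in> carrier R" using Suc.prems a_closed by auto
    have IH: "r \<in> carrier M" "d k (a k \<odot>\<^bsub>E k\<^esub> u) = \<zero>\<^bsub>E (Suc k)\<^esub>" using Suc u by auto
    have "d k u \<in> killed a (Suc k) (Suc k)"
      using killed_d[OF _ u(1)] IH(2) a uc by (auto simp: killed_Suc d_simps)
    then show ?case using IH(1) u(3) d_exact(2)[OF uc] by simp
  qed
  then show "r \<in> carrier M" "w \<in> killed a k k" "d k w = \<zero>\<^bsub>E (Suc k)\<^esub>" by auto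
qed

lemma represents_add:
  assumes "k \<le> n" "represents a k r w" "represents a k r' w'"
  shows "represents a k (r \<oplus>\<^bsub>M\<^esub> r') (w \<oplus>\<^bsub>E k\<^esub> w')"
  using assms
proof (induction k arbitrary: w w')
  case 0
  then show ?case by (auto simp: eps_simps)
next
  case (Suc k)
  then obtain u u' where u: "u \<in> killed a k k" "represents a k r (a k \<odot>\<^bsub>E k\<^esub> u)" "w = d k u"
    and u': "u' \<in> killed a k k" "represents a k r' (a k \<odot>\<^bsub>E k\<^esub> u')" "w' = d k u'" by auto
  have a: "\<And>j. j < Suc k \<Longrightarrow> a j \<in> carrier R" using Suc.prems a_closed by auto
  have "represents a k (r \<oplus>\<^bsub>M\<^esub> r') (a k \<odot>\<^bsub>E k\<^esub> (u \<oplus>\<^bsub>E k\<^esub> u'))"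
    using Suc.IH[OF _ u(2) u'(2)] Suc.prems(1) a killed_carrier[OF u(1)] killed_carrier[OF u'(1)]
    by (simp add: E.smult_r_distr)
  moreover have "w \<oplus>\<^bsub>E (Suc k)\<^esub> w' = d k (u \<oplus>\<^bsub>E k\<^esub> u')"
    using u u' killed_carrier by (simp add: d_simps)
  moreover have "u \<oplus>\<^bsub>E k\<^esub> u' \<in> killed a k k" using killed_add a u u' by auto
  ultimately show ?case by auto
qed

lemma represents_smult:
  assumes "k \<le> n" "s \<in> carrier R" "represents a k r w"
  shows "represents a k (s \<odot>\<^bsub>M\<^esub> r) (s \<odot>\<^bsub>E k\<^esub> w)"
  using assms
proof (induction k arbitrary: w)
  case 0
  then show ?case by (auto simp: eps_simps)
next
  case (Suc k)
  then obtain u where u: "u \<in> killed a k k" "represents a k r (a k \<odot>\<^bsub>E k\<^esub> u)" "w = d k u" by auto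
  note uc = killed_carrier[OF u(1)]
  have a: "\<And>j. j < Suc k \<Longrightarrow> a j \<in> carrier R" using Suc.prems a_closed by auto
  have "s \<odot>\<^bsub>E k\<^esub> (a k \<odot>\<^bsub>E k\<^esub> u) = a k \<odot>\<^bsub>E k\<^esub> (s \<odot>\<^bsub>E k\<^esub> u)"
    using a Suc.prems uc E.R.m_comm[of s "a k"] by (simp add: E.smult_assoc1[symmetric])
  then have "represents a k (s \<odot>\<^bsub>M\<^esub> r) (a k \<odot>\<^bsub>E k\<^esub> (s \<odot>\<^bsub>E k\<^esub> u))"
    using Suc.IH[OF _ _ u(2)] Suc.prems by simp
  moreover have "s \<odot>\<^bsub>E (Suc k)\<^esub> w = d k (s \<odot>\<^bsub>E k\<^esub> u)" using u uc Suc.prems by (simp add: d_simps)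
  moreover have "s \<odot>\<^bsub>E k\<^esub> u \<in> killed a k k" using killed_smult a u Suc.prems by auto
  ultimately show ?case by auto
qed

lemma represents_minus:
  assumes "k \<le> n" "represents a k r w" "represents a k r' w'"
  shows "represents a k (r \<ominus>\<^bsub>M\<^esub> r') (w \<ominus>\<^bsub>E k\<^esub> w')"
proof -
  have c: "r' \<in> carrier M" "w' \<in> carrier (E k)" using represents_closed[OF assms(1,3)] killed_carrier by auto
  have "represents a k ((\<ominus> \<one>) \<odot>\<^bsub>M\<^esub> r') ((\<ominus> \<one>) \<odot>\<^bsub>E k\<^esub> w')" using assms by (intro represents_smult) auto
  then have "represents a k (\<ominus>\<^bsub>M\<^esub> r') (\<ominus>\<^bsub>E k\<^esub> w')"
    using c by (simp add: M.smult_l_minus E.smult_l_minus)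
  then show ?thesis unfolding a_minus_def using assms by (intro represents_add)
qed

lemma represents_total:
  assumes "k \<le> n" "r \<in> carrier M"
  shows "\<exists>w. represents a k r w"
  using assms
proof (induction k)
  case (Suc k)
  then obtain w where w: "represents a k r w" by auto
  then have "w \<in> killed a k k" using represents_closed Suc.prems by auto
  then obtain u where "u \<in> killed a k k" "a k \<odot>\<^bsub>E k\<^esub> u = w"
    using divisible[OF regular] Suc.prems(1) by (metis Suc_le_lessD)
  then show ?case using w by auto
qed auto

text \<open>
  The connecting homomorphism is onto because the next cohomology of the larger subcomplex vanishes.
\<close>

lemma represents_surj:
  assumes "k \<le> n" "w \<in> killed a k k" "d k w = \<zero>\<^bsub>E (Suc k)\<^esub>"
  shows "\<exists>r. represents a k r w"
  using assms
proof (induction k arbitrary: w)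
  case 0
  then show ?case using eps_exact(1) by (auto simp: killed_def)
next
  case (Suc k)
  have a: "\<And>j. j < Suc k \<Longrightarrow> a j \<in> carrier R" using Suc.prems a_closed by auto
  have w: "w \<in> killed a k (Suc k)" "a k \<odot>\<^bsub>E (Suc k)\<^esub> w = \<zero>\<^bsub>E (Suc k)\<^esub>"
    using Suc.prems by (auto simp: killed_Suc)
  obtain u where u: "u \<in> killed a k k" "d k u = w"
    using killed_exact[OF regular _ _ w(1)] Suc.prems by auto
  have "d k (a k \<odot>\<^bsub>E k\<^esub> u) = \<zero>\<^bsub>E (Suc k)\<^esub>"
    using u w a killed_carrier[OF u(1)] by (simp add: d_simps)
  then obtain r where "represents a k r (a k \<odot>\<^bsub>E k\<^esub> u)"
    using Suc.IH killed_smult[OF _ _ u(1), of "a k"] a Suc.prems(1) by auto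
  then show ?case using u by auto
qed

text \<open>
  The \<open>k\<close>-th cohomology of the subcomplex is \<open>M / (a\<^sub>0, \<dots>, a\<^sub>k\<^sub>-\<^sub>1) M\<close>: by the long exact sequence it is the cokernel
  of \<open>a\<^sub>k\<^sub>-\<^sub>1\<close> on the previous one. Both directions modify the last quotient \<open>u\<close> by a cocycle and
  apply the induction hypothesis to the difference of the represented elements.
\<close>

lemma boundary_iff_seq_multiples:
  assumes "k \<le> n" "represents a k r w"
  shows "w \<in> boundaries a k \<longleftrightarrow> r \<in> seq_multiples M a k"
  using assms
proof (induction k arbitrary: r w)
  case 0
  then show ?case using eps_exact(3) by (auto simp: boundaries_def)
next
  case (Suc k)
  then obtain u where u: "u \<in> killed a k k" "represents a k r (a k \<odot>\<^bsub>E k\<^esub> u)" "w = d k u" by auto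
  note uc = killed_carrier[OF u(1)]
  have k: "k \<le> n" using Suc.prems by simp
  have r: "r \<in> carrier M" using represents_closed[OF k u(2)] by auto
  have a: "\<And>j. j < Suc k \<Longrightarrow> a j \<in> carrier R" using Suc.prems a_closed by auto
  then have ak: "a k \<in> carrier R" by simp
  have zb: "\<zero>\<^bsub>E k\<^esub> \<in> boundaries a k"
  proof (cases k)
    case (Suc j)
    then have "\<zero>\<^bsub>E j\<^esub> \<in> killed a k j" using a by (auto simp: killed_def)
    then show ?thesis using Suc d_simps(4)[of j] by (auto simp: boundaries_def intro!: rev_image_eqI)
  qed (simp add: boundaries_def)
  have span: "seq_multiples M a k \<subseteq> carrier M" using M.seq_multiples_closed a by simp
  show ?case
  proof
    assume "w \<in> boundaries a (Suc k)"
    then obtain v where v: "v \<in> killed a k k" "a k \<odot>\<^bsub>E k\<^esub> v = \<zero>\<^bsub>E k\<^esub>" "w = d k v"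
      by (auto simp: boundaries_def killed_Suc)
    note vc = killed_carrier[OF v(1)]
    have "d k (u \<ominus>\<^bsub>E k\<^esub> v) = \<zero>\<^bsub>E (Suc k)\<^esub>"
      using u v d_simps(1)[OF uc] d_simps(5)[OF uc vc] by (simp add: a_minus_def E.r_neg)
    then obtain r' where r': "represents a k r' (u \<ominus>\<^bsub>E k\<^esub> v)"
      using represents_surj[OF k] killed_minus[OF _ u(1) v(1)] a by auto
    then have r'c: "r' \<in> carrier M" using represents_closed[OF k] by auto
    have "represents a k (a k \<odot>\<^bsub>M\<^esub> r') (a k \<odot>\<^bsub>E k\<^esub> (u \<ominus>\<^bsub>E k\<^esub> v))" by (rule represents_smult[OF k ak r'])
    moreover have "a k \<odot>\<^bsub>E k\<^esub> (u \<ominus>\<^bsub>E k\<^esub> v) = a k \<odot>\<^bsub>E k\<^esub> u"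
      using ak uc vc v(2) by (simp add: a_minus_def E.smult_r_distr E.smult_r_minus)
    ultimately have "represents a k (r \<ominus>\<^bsub>M\<^esub> a k \<odot>\<^bsub>M\<^esub> r') (a k \<odot>\<^bsub>E k\<^esub> u \<ominus>\<^bsub>E k\<^esub> a k \<odot>\<^bsub>E k\<^esub> u)"
      using represents_minus[OF k u(2)] by simp
    moreover have "a k \<odot>\<^bsub>E k\<^esub> u \<ominus>\<^bsub>E k\<^esub> a k \<odot>\<^bsub>E k\<^esub> u = \<zero>\<^bsub>E k\<^esub>"
      using ak uc by (simp add: a_minus_def E.r_neg)
    ultimately have "r \<ominus>\<^bsub>M\<^esub> a k \<odot>\<^bsub>M\<^esub> r' \<in> seq_multiples M a k" using Suc.IH[OF k] zb by auto
    moreover have "r = a k \<odot>\<^bsub>M\<^esub> r' \<oplus>\<^bsub>M\<^esub> (r \<ominus>\<^bsub>M\<^esub> a k \<odot>\<^bsub>M\<^esub> r')"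
      using r r'c ak by (simp add: a_minus_def M.a_ac M.r_neg2 M.r_neg1 M.r_neg)
    ultimately show "r \<in> seq_multiples M a (Suc k)" using r'c by auto
  next
    assume "r \<in> seq_multiples M a (Suc k)"
    then obtain r' r'' where r': "r' \<in> carrier M" "r'' \<in> seq_multiples M a k"
      "r = a k \<odot>\<^bsub>M\<^esub> r' \<oplus>\<^bsub>M\<^esub> r''" by auto
    then have r''c: "r'' \<in> carrier M" using span by auto
    obtain w' where w': "represents a k r' w'" using represents_total[OF k r'(1)] by auto
    have w'k: "w' \<in> killed a k k" and dw': "d k w' = \<zero>\<^bsub>E (Suc k)\<^esub>" using represents_closed[OF k w'] by auto
    note w'c = killed_carrier[OF w'k]
    have "represents a k (r \<ominus>\<^bsub>M\<^esub> a k \<odot>\<^bsub>M\<^esub> r') (a k \<odot>\<^bsub>E k\<^esub> u \<ominus>\<^bsub>E k\<^esub> a k \<odot>\<^bsub>E k\<^esub> w')"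
      by (intro represents_minus[OF k u(2)] represents_smult[OF k ak w'])
    moreover have "r \<ominus>\<^bsub>M\<^esub> a k \<odot>\<^bsub>M\<^esub> r' = r''"
      using r' r''c ak by (simp add: a_minus_def M.a_ac M.r_neg2 M.r_neg1 M.r_neg)
    ultimately have "a k \<odot>\<^bsub>E k\<^esub> u \<ominus>\<^bsub>E k\<^esub> a k \<odot>\<^bsub>E k\<^esub> w' \<in> boundaries a k"
      using Suc.IH[OF k] r'(2) by auto
    then have b: "a k \<odot>\<^bsub>E k\<^esub> (u \<ominus>\<^bsub>E k\<^esub> w') \<in> boundaries a k"
      using ak uc w'c by (simp add: a_minus_def E.smult_r_distr E.smult_r_minus)
    have uw: "u \<ominus>\<^bsub>E k\<^esub> w' \<in> killed a k k" using killed_minus[OF _ u(1) w'k] a by auto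
    note uwc = killed_carrier[OF uw]
    have duw: "d k (u \<ominus>\<^bsub>E k\<^esub> w') = w"
      using u dw' d_simps(1)[OF uc] d_simps(5)[OF uc w'c] by (simp add: a_minus_def)
    have "\<exists>v\<in>killed a (Suc k) k. d k v = w"
    proof (cases k)
      case 0
      then show ?thesis using b uw duw by (auto simp: boundaries_def killed_Suc)
    next
      case k': (Suc j)
      obtain v where v: "v \<in> killed a k j" "d j v = a k \<odot>\<^bsub>E k\<^esub> (u \<ominus>\<^bsub>E k\<^esub> w')"
        using b k' by (auto simp: boundaries_def)
      obtain v' where v': "v' \<in> killed a k j" "a k \<odot>\<^bsub>E j\<^esub> v' = v"
        using divisible[OF regular _ v(1)] Suc.prems(1) by auto
      note v'c = killed_carrier[OF v'(1)]
      have dv': "d j v' \<in> killed a k k" using killed_d[OF _ v'(1)] a k' by auto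
      note dv'c = killed_carrier[OF dv']
      have "a k \<odot>\<^bsub>E k\<^esub> d j v' = a k \<odot>\<^bsub>E k\<^esub> (u \<ominus>\<^bsub>E k\<^esub> w')"
        using d_simps(3)[OF ak v'c] v v' k' by simp
      then have "a k \<odot>\<^bsub>E k\<^esub> (u \<ominus>\<^bsub>E k\<^esub> w' \<ominus>\<^bsub>E k\<^esub> d j v') = \<zero>\<^bsub>E k\<^esub>"
        using ak uwc dv'c unfolding a_minus_def[of "E k" "u \<ominus>\<^bsub>E k\<^esub> w'"]
        by (simp add: E.smult_r_distr E.smult_r_minus E.r_neg)
      then have "u \<ominus>\<^bsub>E k\<^esub> w' \<ominus>\<^bsub>E k\<^esub> d j v' \<in> killed a (Suc k) k"
        using killed_minus[OF _ uw dv'] a by (auto simp: killed_Suc)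
      moreover have "d k (d j v') = \<zero>\<^bsub>E (Suc k)\<^esub>" using d_exact(2)[OF v'c] k' by simp
      then have "d k (u \<ominus>\<^bsub>E k\<^esub> w' \<ominus>\<^bsub>E k\<^esub> d j v') = w"
        using d_simps(5)[OF uwc dv'c] duw d_simps(1)[OF uwc] by (simp add: a_minus_def)
      ultimately show ?thesis by blast
    qed
    then show "w \<in> boundaries a (Suc k)" by (auto simp: boundaries_def)
  qed
qed

end

text \<open>
  Enlarging the sequence from \<open>a\<close> to \<open>a b\<close> keeps the cocycle and multiplies the element of \<open>M\<close> by the
  product of the \<open>b\<^sub>j\<close>; the same quotients \<open>u\<close> serve for both sequences. For powers of the variables this
  is the transition map between fractions with different denominators.
\<close>

lemma represents_scale:
  assumes a: "\<And>j. j < k \<Longrightarrow> a j \<in> carrier R" and b: "\<And>j. j < k \<Longrightarrow> b j \<in> carrier R"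
    and reg: "weakly_regular R (\<lambda>j. a j \<otimes> b j) n" and "k \<le> n" and "represents a k r w"
  shows "represents (\<lambda>j. a j \<otimes> b j) k (prod_below R b k \<odot>\<^bsub>M\<^esub> r) w"
  using assms(1,2,4,5)
proof (induction k arbitrary: w)
  case 0
  then show ?case by auto
next
  case (Suc k)
  from Suc.prems obtain u
    where u: "u \<in> killed a k k" "represents a k r (a k \<odot>\<^bsub>E k\<^esub> u)" "w = d k u" by auto
  note uc = killed_carrier[OF u(1)]
  have r: "r \<in> carrier M" using represents_carrier Suc.prems(4) .
  have ak: "a k \<in> carrier R" and bk: "b k \<in> carrier R" and p: "prod_below R b k \<in> carrier R"
    using Suc.prems by (auto intro!: cring.prod_below_closed[OF E.R.is_cring])
  have "represents (\<lambda>j. a j \<otimes> b j) k (prod_below R b k \<odot>\<^bsub>M\<^esub> r) (a k \<odot>\<^bsub>E k\<^esub> u)"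
    using Suc.IH[OF _ _ _ u(2)] Suc.prems by auto
  then have "represents (\<lambda>j. a j \<otimes> b j) k (b k \<odot>\<^bsub>M\<^esub> (prod_below R b k \<odot>\<^bsub>M\<^esub> r)) (b k \<odot>\<^bsub>E k\<^esub> (a k \<odot>\<^bsub>E k\<^esub> u))"
    using Suc.prems bk by (intro represents_smult[OF reg]) auto
  moreover have "b k \<odot>\<^bsub>E k\<^esub> (a k \<odot>\<^bsub>E k\<^esub> u) = (a k \<otimes> b k) \<odot>\<^bsub>E k\<^esub> u"
    using ak bk uc E.R.m_comm[of "a k" "b k"] by (simp add: E.smult_assoc1)
  moreover have "u \<in> killed (\<lambda>j. a j \<otimes> b j) k k"
  proof -
    have "(a j \<otimes> b j) \<odot>\<^bsub>E k\<^esub> u = \<zero>\<^bsub>E k\<^esub>" if j: "j < k" for j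
    proof -
      have "a j \<in> carrier R" "b j \<in> carrier R" using Suc.prems j by auto
      then have "(a j \<otimes> b j) \<odot>\<^bsub>E k\<^esub> u = b j \<odot>\<^bsub>E k\<^esub> (a j \<odot>\<^bsub>E k\<^esub> u)"
        using uc E.R.m_comm[of "a j" "b j"] by (simp add: E.smult_assoc1)
      then show ?thesis using u(1) j \<open>b j \<in> carrier R\<close> by (simp add: killed_def)
    qed
    then show ?thesis using uc by (simp add: killed_def)
  qed
  ultimately show ?case using u(3) r bk p by (auto simp: M.smult_assoc1)
qed

end

section \<open>Monomials and powers of the y variables\<close>

abbreviation lookup :: "('i \<Rightarrow>\<^sub>0 'c) \<Rightarrow> 'i \<Rightarrow> 'c::zero" where "lookup \<equiv> Poly_Mapping.lookup"
abbreviation keys :: "('i \<Rightarrow>\<^sub>0 'c::zero) \<Rightarrow> 'i set" where "keys \<equiv> Poly_Mapping.keys"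
abbreviation single :: "'i \<Rightarrow> 'c \<Rightarrow> 'i \<Rightarrow>\<^sub>0 'c::zero" where "single \<equiv> Poly_Mapping.single"

lemma mem_mpoly_ring_iff: "p \<in> carrier (mpoly_ring V) \<longleftrightarrow> (\<forall>\<alpha>\<in>keys p. keys \<alpha> \<subseteq> V)"
  by (simp add: mpoly_ring_def)

lemma mpoly_ring_ops [simp]:
  "add (mpoly_ring V) = (+)" "mult (mpoly_ring V) = (*)"
  "zero (mpoly_ring V) = 0" "one (mpoly_ring V) = 1"
  by (simp_all add: mpoly_ring_def)

lemma keys_add_exponents:
  fixes \<alpha> \<beta> :: "'i \<Rightarrow>\<^sub>0 nat" shows "keys (\<alpha> + \<beta>) = keys \<alpha> \<union> keys \<beta>"
  by (auto simp: in_keys_iff lookup_add)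

lemma mpoly_ring_closed:
  assumes "p \<in> carrier (mpoly_ring V)" "q \<in> carrier (mpoly_ring V)"
  shows "p + q \<in> carrier (mpoly_ring V)" "p * q \<in> carrier (mpoly_ring V)"
    "- p \<in> carrier (mpoly_ring V)" "p - q \<in> carrier (mpoly_ring V)"
proof -
  show "p + q \<in> carrier (mpoly_ring V)"
    using assms keys_add[of p q] by (fastforce simp: mem_mpoly_ring_iff)
  show "p - q \<in> carrier (mpoly_ring V)"
    using assms keys_diff[of p q] by (fastforce simp: mem_mpoly_ring_iff)
  show "- p \<in> carrier (mpoly_ring V)" using assms by (simp add: mem_mpoly_ring_iff)
  show "p * q \<in> carrier (mpoly_ring V)"
    using assms keys_mult[of p q] by (fastforce simp: mem_mpoly_ring_iff keys_add_exponents)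
qed

lemma single_mem_mpoly_ring: "keys \<alpha> \<subseteq> V \<Longrightarrow> single \<alpha> c \<in> carrier (mpoly_ring V)"
  by (simp add: mem_mpoly_ring_iff)

lemma one_zero_mem_mpoly_ring [simp]: "0 \<in> carrier (mpoly_ring V)" "1 \<in> carrier (mpoly_ring V)"
  by (simp_all add: mem_mpoly_ring_iff)

lemma mpoly_ring_cring: "cring (mpoly_ring V :: ('i, 'k::comm_ring_1) mpoly ring)"
proof (rule cringI)
  show "abelian_group (mpoly_ring V :: ('i, 'k) mpoly ring)"
  proof (rule abelian_groupI)
    fix p :: "('i, 'k) mpoly" assume p: "p \<in> carrier (mpoly_ring V)"
    then show "\<exists>q\<in>carrier (mpoly_ring V). q \<oplus>\<^bsub>mpoly_ring V\<^esub> p = \<zero>\<^bsub>mpoly_ring V\<^esub>"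
      by (intro bexI[of _ "- p"]) (auto intro: mpoly_ring_closed)
  qed (auto simp: algebra_simps intro: mpoly_ring_closed)
  show "Group.comm_monoid (mpoly_ring V :: ('i, 'k) mpoly ring)"
    by (rule comm_monoidI) (auto simp: algebra_simps intro: mpoly_ring_closed)
qed (auto simp: algebra_simps)

lemma mpoly_ring_minus:
  assumes "p \<in> carrier (mpoly_ring V)" "q \<in> carrier (mpoly_ring V)"
  shows "\<ominus>\<^bsub>mpoly_ring V\<^esub> p = - p" "q \<ominus>\<^bsub>mpoly_ring V\<^esub> p = q - p"
proof -
  interpret cring "mpoly_ring V" by (rule mpoly_ring_cring)
  show *: "\<ominus>\<^bsub>mpoly_ring V\<^esub> p = - p"
    using minus_equality[of "- p" p] assms mpoly_ring_closed[of p V p] by simp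
  show "q \<ominus>\<^bsub>mpoly_ring V\<^esub> p = q - p" by (simp add: a_minus_def *)
qed

lemma sum_monomials:
  fixes p :: "'i \<Rightarrow>\<^sub>0 'k::comm_monoid_add"
  shows "p = (\<Sum>\<alpha>\<in>keys p. single \<alpha> (lookup p \<alpha>))"
  by (rule poly_mapping_eqI)
    (auto simp: lookup_sum lookup_single when_def sum.If_cases in_keys_iff)

lemma mpoly_induct [consumes 1, case_names zero monomial add]:
  fixes p :: "'i \<Rightarrow>\<^sub>0 'k::comm_monoid_add"
  assumes "keys p \<subseteq> A"
    and "P 0" and "\<And>\<alpha> c. \<alpha> \<in> A \<Longrightarrow> P (single \<alpha> c)"
    and "\<And>p q. keys p \<subseteq> A \<Longrightarrow> keys q \<subseteq> A \<Longrightarrow> P p \<Longrightarrow> P q \<Longrightarrow> P (p + q)"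
  shows "P p"
proof -
  have "P (\<Sum>\<alpha>\<in>B. single \<alpha> (lookup p \<alpha>)) \<and>
      keys (\<Sum>\<alpha>\<in>B. single \<alpha> (lookup p \<alpha>)) \<subseteq> A"
    if "finite B" "B \<subseteq> A" for B
    using that
  proof (induction rule: finite_induct)
    case (insert \<alpha> B)
    have "keys (single \<alpha> (lookup p \<alpha>)) \<subseteq> A"
      using insert by simp
    then show ?case using insert assms(3,4)
      by (auto dest!: subsetD[OF keys_add])
  qed (simp add: assms(2))
  from this[of "keys p"] show ?thesis
    using assms(1) sum_monomials[of p] by simp
qed

lemma single_in_ideal:
  assumes "ideal J (mpoly_ring V)" "single \<alpha> 1 \<in> J" "keys \<beta> \<subseteq> V"
  shows "single (\<alpha> + \<beta>) c \<in> J"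
proof -
  have "single \<beta> c \<otimes>\<^bsub>mpoly_ring V\<^esub> single \<alpha> 1 \<in> J"
    using assms by (intro ideal.I_l_closed[OF assms(1)] single_mem_mpoly_ring)
  then show ?thesis by (simp add: mult_single add.commute)
qed

lemma monomial_ideal:
  fixes A :: "('i \<Rightarrow>\<^sub>0 nat) set"
  assumes up: "\<And>\<alpha> \<beta>. \<alpha> \<in> A \<Longrightarrow> \<alpha> + \<beta> \<in> A"
  shows "ideal {p \<in> carrier (mpoly_ring V). keys p \<subseteq> A} (mpoly_ring V :: ('i, 'k::comm_ring_1) mpoly ring)"
    (is "ideal ?I _")
proof -
  interpret cring "mpoly_ring V :: ('i, 'k) mpoly ring" by (rule mpoly_ring_cring)
  show ?thesis
  proof (rule idealI)
    show "ring (mpoly_ring V :: ('i, 'k) mpoly ring)" by (rule ring_axioms)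
    show "subgroup ?I (add_monoid (mpoly_ring V))"
    proof (rule add.subgroupI)
      have "0 \<in> ?I" by simp
      then show "?I \<noteq> {}" by blast
      show "\<ominus>\<^bsub>mpoly_ring V\<^esub> p \<in> ?I" if "p \<in> ?I" for p
        using that by (auto simp: mpoly_ring_minus intro: mpoly_ring_closed)
      show "p \<oplus>\<^bsub>mpoly_ring V\<^esub> q \<in> ?I" if "p \<in> ?I" "q \<in> ?I" for p q
        using that keys_add[of p q] by (auto intro: mpoly_ring_closed)
    qed auto
    fix p q :: "('i, 'k) mpoly" assume p: "p \<in> ?I" and q: "q \<in> carrier (mpoly_ring V)"
    have "keys (p * q) \<subseteq> A" using p keys_mult[of p q] up by fastforce
    then show "p \<otimes>\<^bsub>mpoly_ring V\<^esub> q \<in> ?I" "q \<otimes>\<^bsub>mpoly_ring V\<^esub> p \<in> ?I"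
      using p q by (auto simp: mult.commute[of q p] intro: mpoly_ring_closed)
  qed
qed

lemma lookup_single_times:
  fixes p :: "('i, 'k::comm_ring_1) mpoly"
  shows "lookup (single \<alpha> c * p) (\<alpha> + \<beta>) = c * lookup p \<beta>"
proof -
  have "keys p \<subseteq> UNIV" by simp
  then show ?thesis
  proof (induction rule: mpoly_induct)
    case (add p q)
    then show ?case by (simp add: distrib_left lookup_add)
  qed (auto simp: mult_single lookup_single when_def)
qed

lemma keys_monomial_times:
  fixes p :: "('i, 'k::comm_ring_1) mpoly"
  shows "keys (single \<alpha> 1 * p) = (+) \<alpha> ` keys p"
proof
  show "keys (single \<alpha> 1 * p) \<subseteq> (+) \<alpha> ` keys p"
    using keys_mult[of "single \<alpha> 1" p] by auto
  show "(+) \<alpha> ` keys p \<subseteq> keys (single \<alpha> 1 * p)"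
    by (auto simp: in_keys_iff lookup_single_times)
qed

definition y_power :: "nat \<Rightarrow> nat \<Rightarrow> 'k::field bipoly"
  where "y_power T j = single (single (Inr j) T) 1"

definition y_exponent :: "nat \<Rightarrow> nat \<Rightarrow> (nat + nat \<Rightarrow>\<^sub>0 nat)"
  where "y_exponent n s = (\<Sum>j<n. single (Inr j) s)"

definition y_monomial :: "nat \<Rightarrow> nat \<Rightarrow> 'k::field bipoly"
  where "y_monomial n s = single (y_exponent n s) 1"

definition y_multiples :: "nat \<Rightarrow> nat \<Rightarrow> 'k::field bipoly set"
  where "y_multiples T k = {p. \<forall>\<alpha>\<in>keys p. \<exists>j<k. T \<le> lookup \<alpha> (Inr j)}"

lemma lookup_y_exponent:
  "lookup (y_exponent n s) (Inl i) = 0"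
  "lookup (y_exponent n s) (Inr j) = (if j < n then s else 0)"
  by (auto simp: y_exponent_def lookup_sum lookup_single when_def)

lemma keys_y_exponent: "keys (y_exponent n s) \<subseteq> Inr ` {..<n}"
proof
  fix v assume "v \<in> keys (y_exponent n s)"
  then show "v \<in> Inr ` {..<n}" by (cases v) (auto simp: in_keys_iff lookup_y_exponent split: if_splits)
qed

lemma y_exponent_add: "y_exponent n (s + t) = y_exponent n s + y_exponent n t"
  by (simp add: y_exponent_def single_add sum.distrib)

lemma y_monomial_mult: "y_monomial n s * y_monomial n t = y_monomial n (s + t)"
  by (simp add: y_monomial_def mult_single y_exponent_add)

lemma y_power_mult: "y_power s j * y_power t j = y_power (s + t) j"
  by (simp add: y_power_def mult_single single_add)

lemma y_multiples_closed:
  "p \<in> y_multiples T k \<Longrightarrow> q \<in> y_multiples T k \<Longrightarrow> p + q \<in> y_multiples T k"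
  "p \<in> y_multiples T k \<Longrightarrow> q \<in> y_multiples T k \<Longrightarrow> p - q \<in> y_multiples T k"
  "p \<in> y_multiples T k \<Longrightarrow> q * p \<in> y_multiples T k"
  "0 \<in> y_multiples T k"
proof -
  show "p + q \<in> y_multiples T k" if "p \<in> y_multiples T k" "q \<in> y_multiples T k"
    using that keys_add[of p q] unfolding y_multiples_def by blast
  show "p - q \<in> y_multiples T k" if "p \<in> y_multiples T k" "q \<in> y_multiples T k"
    using that keys_diff[of p q] unfolding y_multiples_def by blast
  show "q * p \<in> y_multiples T k" if "p \<in> y_multiples T k"
    using that keys_mult[of q p] unfolding y_multiples_def
    by (fastforce simp: lookup_add intro: trans_le_add2)
qed (simp add: y_multiples_def)

definition xy_vars :: "nat \<Rightarrow> nat \<Rightarrow> (nat + nat) set"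
  where "xy_vars m n = Inl ` {..<m} \<union> Inr ` {..<n}"

lemma xy_ring_cring: "cring (xy_ring m n :: 'k::field bipoly ring)"
  by (simp add: xy_ring_def mpoly_ring_cring)

lemma xy_ring_ops [simp]:
  "add (xy_ring m n) = (+)" "mult (xy_ring m n) = (*)"
  "zero (xy_ring m n) = 0" "one (xy_ring m n) = 1"
  by (simp_all add: xy_ring_def)

lemma xy_ring_closed [simp]:
  assumes "p \<in> carrier (xy_ring m n)" "q \<in> carrier (xy_ring m n)"
  shows "p + q \<in> carrier (xy_ring m n)" "p * q \<in> carrier (xy_ring m n)"
    "- p \<in> carrier (xy_ring m n)" "p - q \<in> carrier (xy_ring m n)"
  using assms mpoly_ring_closed unfolding xy_ring_def by auto

lemma xy_ring_0_1 [simp]: "0 \<in> carrier (xy_ring m n)" "1 \<in> carrier (xy_ring m n)"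
  by (simp_all add: xy_ring_def)

lemma xy_ring_minus [simp]:
  assumes "p \<in> carrier (xy_ring m n)" "q \<in> carrier (xy_ring m n)"
  shows "\<ominus>\<^bsub>xy_ring m n\<^esub> p = - p" "q \<ominus>\<^bsub>xy_ring m n\<^esub> p = q - p"
  using assms mpoly_ring_minus unfolding xy_ring_def by auto

lemma mem_xy_ring_iff:
  "p \<in> carrier (xy_ring m n) \<longleftrightarrow> (\<forall>\<alpha>\<in>keys p. keys \<alpha> \<subseteq> xy_vars m n)"
  by (simp add: xy_ring_def mem_mpoly_ring_iff xy_vars_def)

lemma single_mem_xy_ring [simp]:
  "keys \<alpha> \<subseteq> xy_vars m n \<Longrightarrow> single \<alpha> c \<in> carrier (xy_ring m n)"
  by (simp add: mem_xy_ring_iff)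

lemma y_power_mem [simp]: "j < n \<Longrightarrow> y_power T j \<in> carrier (xy_ring m n)"
  unfolding y_power_def by (rule single_mem_xy_ring) (auto simp: xy_vars_def)

lemma y_exponent_vars: "keys (y_exponent n s) \<subseteq> xy_vars m n"
  using keys_y_exponent[of n s] by (auto simp: xy_vars_def)

lemma y_monomial_mem [simp]: "y_monomial n s \<in> carrier (xy_ring m n)"
  unfolding y_monomial_def by (rule single_mem_xy_ring) (rule y_exponent_vars)

lemma y_multiples_ideal: "ideal {p \<in> carrier (xy_ring m n). p \<in> y_multiples T k} (xy_ring m n :: 'k::field bipoly ring)"
proof -
  have "ideal {p :: 'k bipoly. p \<in> carrier (mpoly_ring (xy_vars m n)) \<and> keys p \<subseteq>
      {\<alpha>. \<exists>j<k. T \<le> lookup \<alpha> (Inr j)}} (mpoly_ring (xy_vars m n))"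
    by (rule monomial_ideal) (auto simp: lookup_add intro: trans_le_add1)
  moreover have "(xy_ring m n :: 'k bipoly ring) = mpoly_ring (xy_vars m n)" by (simp add: xy_ring_def xy_vars_def)
  ultimately show ?thesis by (simp add: y_multiples_def subset_eq)
qed

lemma exponent_split:
  fixes \<alpha> :: "nat + nat \<Rightarrow>\<^sub>0 nat"
  assumes "T \<le> lookup \<alpha> v"
  shows "\<alpha> = single v T + (\<alpha> - single v T)"
  by (rule poly_mapping_eqI) (use assms in \<open>auto simp: lookup_add lookup_minus lookup_single when_def\<close>)

lemma keys_exponent_minus:
  fixes \<alpha> :: "'i \<Rightarrow>\<^sub>0 nat" shows "keys (\<alpha> - \<beta>) \<subseteq> keys \<alpha>"
  by (auto simp: in_keys_iff lookup_minus)

text \<open>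
  A monomial ideal consists of the polynomials all of whose monomials it contains, so that membership
  can be read off from the exponents.
\<close>

lemma genideal_y_powers:
  assumes "k \<le> n"
  shows "Idl\<^bsub>xy_ring m n\<^esub> (y_power T ` {..<k}) = {p \<in> carrier (xy_ring m n). p \<in> y_multiples T k}"
    (is "?L = ?R")
proof
  interpret cring "xy_ring m n" by (rule xy_ring_cring)
  have gen: "y_power T ` {..<k} \<subseteq> carrier (xy_ring m n)" using assms by auto
  have "y_power T ` {..<k} \<subseteq> ?R" using assms by (auto simp: y_multiples_def) (auto simp: y_power_def)
  then show "?L \<subseteq> ?R" by (intro genideal_minimal y_multiples_ideal)
  show "?R \<subseteq> ?L"
  proof
    fix p assume p: "p \<in> ?R"
    let ?A = "{\<alpha>. keys \<alpha> \<subseteq> xy_vars m n \<and> (\<exists>j<k. T \<le> lookup \<alpha> (Inr j))}"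
    have J: "ideal ?L (xy_ring m n)" by (rule genideal_ideal[OF gen])
    have "keys p \<subseteq> ?A" using p by (auto simp: mem_xy_ring_iff y_multiples_def)
    then show "p \<in> ?L"
    proof (induction rule: mpoly_induct)
      case zero
      then show ?case using additive_subgroup.zero_closed[OF ideal.axioms(1)[OF J]] by simp
    next
      case (monomial \<alpha> c)
      then obtain j where j: "j < k" "T \<le> lookup \<alpha> (Inr j)" by auto
      have "single (single (Inr j) T) 1 \<in> ?L"
        using genideal_self[OF gen] j(1) by (auto simp: y_power_def)
      then have "single (single (Inr j) T + (\<alpha> - single (Inr j) T)) c \<in> ?L"
        using J monomial keys_exponent_minus[of \<alpha>] unfolding xy_ring_def xy_vars_def[symmetric]
        by (intro single_in_ideal[of _ "xy_vars m n"]) blast+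
      then show ?case using exponent_split[OF j(2)] by simp
    next
      case (add p q)
      then show ?case using additive_subgroup.a_closed[OF ideal.axioms(1)[OF J], of p q] by simp
    qed
  qed
qed

text \<open>
  Multiplying by \<open>y\<^sub>k\<^sup>T\<close> shifts exponents without affecting those of the earlier variables.
\<close>

lemma y_powers_weakly_regular: "weakly_regular (xy_ring m n :: 'k::field bipoly ring) (y_power T) n"
  unfolding weakly_regular_def
proof (intro conjI allI impI ballI)
  fix k and s :: "'k bipoly"
  assume k: "k < n" and s: "s \<in> carrier (xy_ring m n)"
    and sy: "s \<otimes>\<^bsub>xy_ring m n\<^esub> y_power T k \<in> Idl\<^bsub>xy_ring m n\<^esub> (y_power T ` {..<k})"
  have "\<exists>j<k. T \<le> lookup \<alpha> (Inr j)" if "\<alpha> \<in> keys s" for \<alpha>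
  proof -
    have "single (Inr k) T + \<alpha> \<in> keys (y_power T k * s)"
      using that unfolding y_power_def by (simp only: keys_monomial_times) blast
    then obtain j where "j < k" "T \<le> lookup (single (Inr k) T + \<alpha>) (Inr j)"
      using sy k by (auto simp: genideal_y_powers y_multiples_def mult.commute)
    then show ?thesis by (auto simp: lookup_add lookup_single)
  qed
  then show "s \<in> Idl\<^bsub>xy_ring m n\<^esub> (y_power T ` {..<k})"
    using k s by (auto simp: genideal_y_powers y_multiples_def)
qed auto

lemma prod_below_y_power: "prod_below (xy_ring m n) (y_power s) k = y_monomial k s"
  by (induction k) (auto simp: y_monomial_def y_power_def y_exponent_def mult_single add.commute)

lemma y_multiples_Suc:
  assumes "k < n"
  shows "{p \<in> carrier (xy_ring m n). p \<in> y_multiples T (Suc k)} =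
    {y_power T k * c + q | c q. c \<in> carrier (xy_ring m n) \<and> q \<in> carrier (xy_ring m n) \<and> q \<in> y_multiples T k}"
    (is "?L = ?R")
proof
  show "?R \<subseteq> ?L"
  proof safe
    fix c q :: "'a bipoly" assume c: "c \<in> carrier (xy_ring m n)" and q: "q \<in> carrier (xy_ring m n)" "q \<in> y_multiples T k"
    show "y_power T k * c + q \<in> carrier (xy_ring m n)" using c q assms by simp
    have "y_power T k \<in> y_multiples T (Suc k)" by (auto simp: y_multiples_def y_power_def)
    then have "y_power T k * c \<in> y_multiples T (Suc k)" by (subst mult.commute) (rule y_multiples_closed)
    moreover have "q \<in> y_multiples T (Suc k)" using q unfolding y_multiples_def by (auto intro: less_SucI)
    ultimately show "y_power T k * c + q \<in> y_multiples T (Suc k)" by (rule y_multiples_closed)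
  qed
  show "?L \<subseteq> ?R"
  proof
    fix p assume p: "p \<in> ?L"
    let ?A = "{\<alpha>. keys \<alpha> \<subseteq> xy_vars m n \<and> (\<exists>j<Suc k. T \<le> lookup \<alpha> (Inr j))}"
    have "keys p \<subseteq> ?A" using p by (auto simp: mem_xy_ring_iff y_multiples_def)
    then show "p \<in> ?R"
    proof (induction rule: mpoly_induct)
      case zero
      have "0 = y_power T k * 0 + (0 :: 'a bipoly)" by simp
      then show ?case using y_multiples_closed(4) by (intro CollectI exI[of _ 0]) auto
    next
      case (monomial \<alpha> c)
      show ?case
      proof (cases "T \<le> lookup \<alpha> (Inr k)")
        case True
        have "single \<alpha> c = y_power T k * single (\<alpha> - single (Inr k) T) c + 0"
          using exponent_split[OF True] by (simp add: y_power_def mult_single)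
        moreover have "single (\<alpha> - single (Inr k) T) c \<in> carrier (xy_ring m n)"
          using monomial keys_exponent_minus[of \<alpha>] by (intro single_mem_xy_ring) blast
        ultimately show ?thesis using y_multiples_closed(4) xy_ring_0_1(1) by blast
      next
        case False
        then have "single \<alpha> c \<in> y_multiples T k"
          using monomial by (auto simp: y_multiples_def less_Suc_eq)
        moreover have "single \<alpha> c = y_power T k * 0 + single \<alpha> c" by simp
        ultimately show ?thesis using monomial by (intro CollectI exI[of _ 0] exI[of _ "single \<alpha> c"]) auto
      qed
    next
      case (add p q)
      then obtain c1 q1 c2 q2 where "p = y_power T k * c1 + q1" "q = y_power T k * c2 + q2"
        "c1 \<in> carrier (xy_ring m n)" "q1 \<in> carrier (xy_ring m n)" "q1 \<in> y_multiples T k"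
        "c2 \<in> carrier (xy_ring m n)" "q2 \<in> carrier (xy_ring m n)" "q2 \<in> y_multiples T k" by blast
      then show ?case
        by (intro CollectI exI[of _ "c1 + c2"] exI[of _ "q1 + q2"])
          (auto simp: algebra_simps intro: y_multiples_closed)
    qed
  qed
qed

section \<open>Torsion and residues modulo the hypersurface\<close>

lemma quot_ring_module_rules:
  fixes R (structure)
  assumes R: "cring R" and I: "ideal I R"
  shows "carrier (quot_ring_module R I) = (+>) I ` carrier R"
    and "r \<in> carrier R \<Longrightarrow> s \<in> carrier R \<Longrightarrow>
      (I +> r) \<oplus>\<^bsub>quot_ring_module R I\<^esub> (I +> s) = I +> (r \<oplus> s)"
    and "r \<in> carrier R \<Longrightarrow> s \<in> carrier R \<Longrightarrow>
      s \<odot>\<^bsub>quot_ring_module R I\<^esub> (I +> r) = I +> (s \<otimes> r)"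
    and "r \<in> carrier R \<Longrightarrow> I +> r = \<zero>\<^bsub>quot_ring_module R I\<^esub> \<longleftrightarrow> r \<in> I"
proof -
  interpret R: cring R by (rule R)
  interpret I: ideal I R by (rule I)
  note hom = I.rcos_ring_hom
  show "carrier (quot_ring_module R I) = (+>) I ` carrier R"
    by (auto simp: quot_ring_module_def ring.defs FactRing_def A_RCOSETS_def')
  show "r \<in> carrier R \<Longrightarrow> s \<in> carrier R \<Longrightarrow>
      (I +> r) \<oplus>\<^bsub>quot_ring_module R I\<^esub> (I +> s) = I +> (r \<oplus> s)"
    using ring_hom_add[OF hom] by (simp add: quot_ring_module_def ring.defs)
  show "r \<in> carrier R \<Longrightarrow> s \<in> carrier R \<Longrightarrow>
      s \<odot>\<^bsub>quot_ring_module R I\<^esub> (I +> r) = I +> (s \<otimes> r)"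
    using ring_hom_mult[OF hom] by (simp add: quot_ring_module_def ring.defs)
  have "\<zero>\<^bsub>quot_ring_module R I\<^esub> = I +> \<zero>"
    using I.a_subset by (simp add: quot_ring_module_def ring.defs FactRing_def)
  then show "r \<in> carrier R \<Longrightarrow> I +> r = \<zero>\<^bsub>quot_ring_module R I\<^esub> \<longleftrightarrow> r \<in> I"
    using R.quotient_eq_iff_same_a_r_cos[OF I, of r \<zero>] by (simp add: a_minus_def)
qed

lemma y_power_mem_ideal_power:
  assumes "j < n"
  shows "(y_power k j :: 'k::field bipoly) \<in> y_ideal m n [^]\<^bsub>ideals_set (xy_ring m n)\<^esub> (k::nat)"
proof (induction k)
  case 0
  then show ?case by (simp add: nat_pow_def ideals_set_def y_power_def)
next
  case (Suc k)
  interpret cring "xy_ring m n :: 'k bipoly ring" by (rule xy_ring_cring)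
  have "(\<lambda>j. mvar (Inr j)) ` {..<n} \<subseteq> carrier (xy_ring m n :: 'k bipoly ring)"
    using y_power_mem[of _ n 1 m] by (auto simp: mvar_def y_power_def)
  from genideal_self[OF this] have "(mvar (Inr j) :: 'k bipoly) \<in> y_ideal m n" unfolding y_ideal_def using assms by blast
  then have "(y_power 1 j :: 'k bipoly) \<in> y_ideal m n" by (simp add: mvar_def y_power_def)
  then have "(y_power k j :: 'k bipoly) \<otimes>\<^bsub>xy_ring m n\<^esub> y_power 1 j \<in>
      (y_ideal m n [^]\<^bsub>ideals_set (xy_ring m n)\<^esub> k) \<cdot>\<^bsub>xy_ring m n\<^esub> y_ideal m n"
    using Suc by (intro ideal_prod.prod)
  then show ?case by (simp add: nat_pow_def ideals_set_def y_power_mult)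
qed

text \<open>
  Applied with \<open>k = n T + 1\<close>: once the degree in the \<open>y\<close> variables exceeds \<open>n T\<close>, one of them occurs with
  exponent at least \<open>T\<close>.
\<close>

lemma ideal_power_y_degree:
  assumes "p \<in> (y_ideal m n :: 'k::field bipoly set) [^]\<^bsub>ideals_set (xy_ring m n)\<^esub> (k::nat)"
  shows "p \<in> carrier (xy_ring m n) \<and>
    (\<forall>\<alpha>\<in>keys p. k \<le> (\<Sum>j<n. lookup \<alpha> (Inr j)))"
  using assms
proof (induction k arbitrary: p)
  case 0
  then show ?case by (simp add: nat_pow_def ideals_set_def)
next
  case (Suc k)
  interpret cring "xy_ring m n :: 'k bipoly ring" by (rule xy_ring_cring)
  let ?J = "{p :: 'k bipoly. p \<in> carrier (mpoly_ring (xy_vars m n)) \<and>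
    keys p \<subseteq> {\<alpha>. 1 \<le> (\<Sum>j<n. lookup \<alpha> (Inr j))}}"
  have "ideal ?J (mpoly_ring (xy_vars m n))"
    by (rule monomial_ideal) (auto simp: lookup_add sum.distrib)
  moreover have S: "(xy_ring m n :: 'k bipoly ring) = mpoly_ring (xy_vars m n)"
    by (simp add: xy_ring_def xy_vars_def)
  moreover have "mvar (Inr j) \<in> ?J" if "j < n" for j
  proof -
    have "mvar (Inr j) \<in> carrier (mpoly_ring (xy_vars m n))"
      unfolding mvar_def by (rule single_mem_mpoly_ring) (use that in \<open>auto simp: xy_vars_def\<close>)
    moreover have "(\<Sum>i<n. lookup (single (Inr j :: nat + nat) (1::nat)) (Inr i)) = 1"
      using that by (simp add: lookup_single when_def)
    ultimately show ?thesis by (simp add: mvar_def)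
  qed
  ultimately have Q: "(y_ideal m n :: 'k bipoly set) \<subseteq> ?J"
    unfolding y_ideal_def by (intro genideal_minimal) auto
  have "p \<in> (y_ideal m n [^]\<^bsub>ideals_set (xy_ring m n)\<^esub> k) \<cdot>\<^bsub>xy_ring m n\<^esub> y_ideal m n"
    using Suc.prems by (simp add: nat_pow_def ideals_set_def)
  then show ?case
  proof (induction rule: ideal_prod.induct)
    case (prod p q)
    have p: "p \<in> carrier (xy_ring m n)" "\<And>\<alpha>. \<alpha> \<in> keys p \<Longrightarrow> k \<le> (\<Sum>j<n. lookup \<alpha> (Inr j))"
      using Suc.IH[OF prod(1)] by auto
    have q: "q \<in> carrier (xy_ring m n)" "\<And>\<alpha>. \<alpha> \<in> keys q \<Longrightarrow> 1 \<le> (\<Sum>j<n. lookup \<alpha> (Inr j))"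
      using Q prod(2) S by auto
    have "Suc k \<le> (\<Sum>j<n. lookup \<gamma> (Inr j))" if gamma: "\<gamma> \<in> keys (p * q)" for \<gamma>
    proof -
      obtain \<alpha> \<beta> where "\<gamma> = \<alpha> + \<beta>" "\<alpha> \<in> keys p" "\<beta> \<in> keys q"
        using gamma keys_mult[of p q] by blast
      then show ?thesis using p(2)[of \<alpha>] q(2)[of \<beta>] by (simp add: lookup_add sum.distrib)
    qed
    then show ?case using p q by simp
  next
    case (sum p q)
    then show ?case using keys_add[of p q] by auto
  qed
qed

text \<open>
  The powers of \<open>Q\<close> and the ideals \<open>(y\<^sub>1\<^sup>T, \<dots>, y\<^sub>n\<^sup>T)\<close> are cofinal, so they define the same torsion.
\<close>

lemma y_torsion_iff:
  assumes E: "Module.module (xy_ring m n) E" and e: "e \<in> carrier E"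
  shows "(\<exists>k::nat. \<forall>r\<in>y_ideal m n [^]\<^bsub>ideals_set (xy_ring m n)\<^esub> k. r \<odot>\<^bsub>E\<^esub> e = \<zero>\<^bsub>E\<^esub>) \<longleftrightarrow>
    (\<exists>T. \<forall>j<n. y_power T j \<odot>\<^bsub>E\<^esub> e = \<zero>\<^bsub>E\<^esub>)"
proof
  assume "\<exists>k::nat. \<forall>r\<in>y_ideal m n [^]\<^bsub>ideals_set (xy_ring m n)\<^esub> k. r \<odot>\<^bsub>E\<^esub> e = \<zero>\<^bsub>E\<^esub>"
  then show "\<exists>T. \<forall>j<n. y_power T j \<odot>\<^bsub>E\<^esub> e = \<zero>\<^bsub>E\<^esub>"
    using y_power_mem_ideal_power by blast
next
  interpret E: Module.module "xy_ring m n" E by (rule E)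
  assume "\<exists>T. \<forall>j<n. y_power T j \<odot>\<^bsub>E\<^esub> e = \<zero>\<^bsub>E\<^esub>"
  then obtain T where T: "\<And>j. j < n \<Longrightarrow> y_power T j \<odot>\<^bsub>E\<^esub> e = \<zero>\<^bsub>E\<^esub>" by auto
  have ann: "Idl\<^bsub>xy_ring m n\<^esub> (y_power T ` {..<n}) \<subseteq> {r \<in> carrier (xy_ring m n). r \<odot>\<^bsub>E\<^esub> e = \<zero>\<^bsub>E\<^esub>}"
    by (rule E.R.genideal_minimal[OF E.annihilator_ideal[OF e]]) (use T in auto)
  have "r \<odot>\<^bsub>E\<^esub> e = \<zero>\<^bsub>E\<^esub>"
    if "r \<in> y_ideal m n [^]\<^bsub>ideals_set (xy_ring m n)\<^esub> (n * T + 1)" for r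
  proof -
    note r = ideal_power_y_degree[OF that]
    have "\<exists>j<n. T \<le> lookup \<alpha> (Inr j)" if "\<alpha> \<in> keys r" for \<alpha>
    proof (rule ccontr)
      assume "\<not> ?thesis"
      then have "(\<Sum>j<n. lookup \<alpha> (Inr j)) \<le> (\<Sum>j<n. T)"
        by (intro sum_mono) (auto simp: not_le less_imp_le)
      then show False using r that by fastforce
    qed
    then have "r \<in> Idl\<^bsub>xy_ring m n\<^esub> (y_power T ` {..<n})"
      using r by (simp add: genideal_y_powers y_multiples_def)
    then show ?thesis using ann by auto
  qed
  then show "\<exists>k::nat. \<forall>r\<in>y_ideal m n [^]\<^bsub>ideals_set (xy_ring m n)\<^esub> k. r \<odot>\<^bsub>E\<^esub> e = \<zero>\<^bsub>E\<^esub>" by blast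
qed

text \<open>
  The value \<open>\<phi> T r\<close> is the generalised fraction \<open>r / (y\<^sub>1 \<cdots> y\<^sub>n)\<^sup>T\<close>.
\<close>

locale fraction_presentation =
  fixes m n :: nat and f :: "'k::field bipoly" and N :: "('k bipoly, 'c, 'z) module_scheme"
    and \<phi> :: "nat \<Rightarrow> 'k bipoly \<Rightarrow> 'c"
  assumes N_module: "Module.module (xy_ring m n) N"
    and f_mem: "f \<in> carrier (xy_ring m n)"
    and phi_closed: "r \<in> carrier (xy_ring m n) \<Longrightarrow> \<phi> T r \<in> carrier N"
    and phi_add: "r \<in> carrier (xy_ring m n) \<Longrightarrow> s \<in> carrier (xy_ring m n) \<Longrightarrow>
      \<phi> T (r + s) = \<phi> T r \<oplus>\<^bsub>N\<^esub> \<phi> T s"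
    and phi_smult: "r \<in> carrier (xy_ring m n) \<Longrightarrow> s \<in> carrier (xy_ring m n) \<Longrightarrow>
      \<phi> T (s * r) = s \<odot>\<^bsub>N\<^esub> \<phi> T r"
    and phi_shift: "r \<in> carrier (xy_ring m n) \<Longrightarrow> \<phi> (T + t) (y_monomial n t * r) = \<phi> T r"
    and phi_eq_zero_iff: "r \<in> carrier (xy_ring m n) \<Longrightarrow> \<phi> T r = \<zero>\<^bsub>N\<^esub> \<longleftrightarrow>
      (\<exists>t. \<exists>h\<in>carrier (xy_ring m n). y_monomial n t * r - f * h \<in> y_multiples (T + t) n)"
    and phi_surj: "z \<in> carrier N \<Longrightarrow> \<exists>T. \<exists>r\<in>carrier (xy_ring m n). z = \<phi> T r"

locale hypersurface_resolution =
  fixes m n :: nat and f :: "'k::field bipoly"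
    and E :: "nat \<Rightarrow> ('k bipoly, 'e) module" and d :: "nat \<Rightarrow> 'e \<Rightarrow> 'e"
    and \<epsilon> :: "'k bipoly set \<Rightarrow> 'e"
  assumes res: "injective_resolution (xy_ring m n) (hypersurface_module m n f) E d \<epsilon>"
    and f_mem: "f \<in> carrier (xy_ring m n)"
begin

sublocale resolved_module "xy_ring m n" "hypersurface_module m n f" E d \<epsilon>
  by unfold_locales (rule res)

abbreviation M :: "('k bipoly, 'k bipoly set) module" where "M \<equiv> hypersurface_module m n f"

definition residue :: "'k bipoly \<Rightarrow> 'k bipoly set"
  where "residue r = PIdl\<^bsub>xy_ring m n\<^esub> f +>\<^bsub>xy_ring m n\<^esub> r"

lemma
  shows residue_carrier: "carrier M = residue ` carrier (xy_ring m n)"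
    and residue_add: "r \<in> carrier (xy_ring m n) \<Longrightarrow> s \<in> carrier (xy_ring m n) \<Longrightarrow>
      residue (r + s) = residue r \<oplus>\<^bsub>M\<^esub> residue s"
    and residue_smult: "r \<in> carrier (xy_ring m n) \<Longrightarrow> s \<in> carrier (xy_ring m n) \<Longrightarrow>
      residue (s * r) = s \<odot>\<^bsub>M\<^esub> residue r"
    and residue_zero_iff: "r \<in> carrier (xy_ring m n) \<Longrightarrow> residue r = \<zero>\<^bsub>M\<^esub> \<longleftrightarrow>
      (\<exists>h\<in>carrier (xy_ring m n). r = f * h)"
proof -
  have I: "ideal (PIdl\<^bsub>xy_ring m n\<^esub> f) (xy_ring m n)"
    by (rule cring.cgenideal_ideal[OF xy_ring_cring f_mem])
  note rules = quot_ring_module_rules[OF xy_ring_cring I]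
  show "carrier M = residue ` carrier (xy_ring m n)"
    unfolding hypersurface_module_def residue_def[abs_def] by (rule rules(1))
  show "r \<in> carrier (xy_ring m n) \<Longrightarrow> s \<in> carrier (xy_ring m n) \<Longrightarrow>
      residue (r + s) = residue r \<oplus>\<^bsub>M\<^esub> residue s"
    unfolding hypersurface_module_def residue_def using rules(2)[of r s] by simp
  show "r \<in> carrier (xy_ring m n) \<Longrightarrow> s \<in> carrier (xy_ring m n) \<Longrightarrow>
      residue (s * r) = s \<odot>\<^bsub>M\<^esub> residue r"
    unfolding hypersurface_module_def residue_def using rules(3)[of r s] by simp
  have "x \<in> PIdl\<^bsub>xy_ring m n\<^esub> f \<longleftrightarrow> (\<exists>h\<in>carrier (xy_ring m n). x = f * h)" for x
    by (auto simp: cgenideal_def mult.commute[of f])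
  then show "r \<in> carrier (xy_ring m n) \<Longrightarrow> residue r = \<zero>\<^bsub>M\<^esub> \<longleftrightarrow>
      (\<exists>h\<in>carrier (xy_ring m n). r = f * h)"
    unfolding hypersurface_module_def residue_def using rules(4)[of r] by simp
qed

text \<open>
  Membership in \<open>(y\<^sub>1\<^sup>T, \<dots>, y\<^sub>k\<^sup>T) M\<close> for \<open>M = S/fS\<close>, lifted to the polynomial ring.
\<close>

lemma residue_seq_multiples_iff:
  assumes "k \<le> n" "r \<in> carrier (xy_ring m n)"
  shows "residue r \<in> seq_multiples M (y_power T) k \<longleftrightarrow>
    (\<exists>h\<in>carrier (xy_ring m n). r - f * h \<in> y_multiples T k)"
  using assms
proof (induction k arbitrary: r)
  case 0
  have "p \<in> y_multiples T 0 \<longleftrightarrow> p = 0" for p :: "'k bipoly" by (simp add: y_multiples_def ball_empty)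
  then show ?case using 0 residue_zero_iff by simp
next
  case (Suc k)
  have y: "(y_power T k :: 'k bipoly) \<in> carrier (xy_ring m n)" using Suc.prems by simp
  have k: "k < n" using Suc.prems by simp
  show ?case
  proof
    assume "residue r \<in> seq_multiples M (y_power T) (Suc k)"
    then obtain C \<rho> where C: "C \<in> carrier M"
      and rho: "\<rho> \<in> seq_multiples M (y_power T) k"
      and eq: "residue r = y_power T k \<odot>\<^bsub>M\<^esub> C \<oplus>\<^bsub>M\<^esub> \<rho>"
      by auto
    have "\<rho> \<in> carrier M"
      using rho M.seq_multiples_closed[of k "y_power T"] k by (auto simp: subset_iff)
    then obtain c r' where c: "c \<in> carrier (xy_ring m n)" "C = residue c"
      and r': "r' \<in> carrier (xy_ring m n)" "\<rho> = residue r'"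
      using C residue_carrier by auto
    obtain h where h: "h \<in> carrier (xy_ring m n)" "r' - f * h \<in> y_multiples T k"
      using Suc.IH[of r'] rho r' k by auto
    define p where "p = y_power T k * c + r'"
    have yc: "y_power T k * c \<in> carrier (xy_ring m n)" using y c by simp
    have p: "p \<in> carrier (xy_ring m n)" unfolding p_def using yc r' by simp
    have rp: "r - p \<in> carrier (xy_ring m n)" using p Suc.prems by simp
    have "residue r = residue p"
      unfolding p_def residue_add[OF yc r'(1)] residue_smult[OF c(1) y] using eq c r' by metis
    moreover have "residue r = residue p \<oplus>\<^bsub>M\<^esub> residue (r - p)"
      using residue_add[OF p rp] by simp
    moreover have "residue p \<in> carrier M"
      "residue (r - p) \<in> carrier M" using p rp residue_carrier by auto
    ultimately have "residue (r - p) = \<zero>\<^bsub>M\<^esub>"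
      using M.add.l_cancel_one[of "residue p" "residue (r - p)"] by simp
    then obtain h' where h': "h' \<in> carrier (xy_ring m n)" "r - p = f * h'"
      using residue_zero_iff[OF rp] by auto
    have "r - f * (h + h') = y_power T k * c + (r' - f * h)"
      using h'(2) by (simp add: p_def algebra_simps)
    also have "\<dots> \<in> {p \<in> carrier (xy_ring m n). p \<in> y_multiples T (Suc k)}"
      unfolding y_multiples_Suc[OF k] using c(1) h r'(1) f_mem
      by (intro CollectI exI[of _ c] exI[of _ "r' - f * h"]) simp
    finally show "\<exists>h\<in>carrier (xy_ring m n). r - f * h \<in> y_multiples T (Suc k)"
      using h(1) h'(1) by (intro bexI[of _ "h + h'"]) auto
  next
    assume "\<exists>h\<in>carrier (xy_ring m n). r - f * h \<in> y_multiples T (Suc k)"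
    then obtain h where h: "h \<in> carrier (xy_ring m n)" "r - f * h \<in> y_multiples T (Suc k)" by auto
    then have "r - f * h \<in> {p \<in> carrier (xy_ring m n). p \<in> y_multiples T (Suc k)}"
      using Suc.prems f_mem by simp
    then obtain c q where c: "c \<in> carrier (xy_ring m n)"
      and q: "q \<in> carrier (xy_ring m n)" "q \<in> y_multiples T k" and eq: "r - f * h = y_power T k * c + q"
      unfolding y_multiples_Suc[OF k] by auto
    have "residue (f * h) = \<zero>\<^bsub>M\<^esub>" using residue_zero_iff[of "f * h"] h f_mem by auto
    moreover have "r = f * h + (y_power T k * c + q)" using eq by (simp add: algebra_simps)
    moreover have "y_power T k * c \<in> carrier (xy_ring m n)" "f * h \<in> carrier (xy_ring m n)"
      "y_power T k * c + q \<in> carrier (xy_ring m n)" using h f_mem y c q by simp_all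
    moreover have "residue (y_power T k * c + q) \<in> carrier M"
      using calculation(5) residue_carrier by auto
    ultimately have "residue r = y_power T k \<odot>\<^bsub>M\<^esub> residue c \<oplus>\<^bsub>M\<^esub> residue q"
      using residue_add[of "f * h" "y_power T k * c + q"] residue_add[of "y_power T k * c" q]
        residue_smult[OF c y] q(1) by simp
    moreover have "residue q \<in> seq_multiples M (y_power T) k"
      using Suc.IH[of q] q k by (auto intro!: bexI[of _ 0])
    ultimately show "residue r \<in> seq_multiples M (y_power T) (Suc k)"
      using c residue_carrier by auto
  qed
qed

end

section \<open>Top local cohomology as generalised fractions\<close>

lemma (in Module.module) submodule_minus:
  assumes H: "submodule H R M" and x: "x \<in> H" and y: "y \<in> H"
  shows "x \<ominus>\<^bsub>M\<lparr>carrier := H\<rparr>\<^esub> y = x \<ominus>\<^bsub>M\<^esub> y"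
proof -
  interpret N: Module.module R "M\<lparr>carrier := H\<rparr>" by (rule subset_module[OF H])
  have Hc: "H \<subseteq> carrier M" using submoduleE(1)[OF H] .
  have "\<ominus>\<^bsub>M\<lparr>carrier := H\<rparr>\<^esub> y = \<ominus>\<^bsub>M\<^esub> y"
    using N.minus_equality[of "\<ominus>\<^bsub>M\<^esub> y" y] y submoduleE(3)[OF H y] Hc by (simp add: M.l_neg subset_iff)
  then show ?thesis by (simp add: a_minus_def)
qed

context hypersurface_resolution
begin

definition y_torsion :: "nat \<Rightarrow> 'e set"
  where "y_torsion i = {e \<in> carrier (E i). \<exists>T. e \<in> killed (y_power T) n i}"

definition cocycles :: "'e set"
  where "cocycles = {w \<in> y_torsion n. d n w = \<zero>\<^bsub>E (Suc n)\<^esub>}"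

text \<open>
  A coboundary of the torsion complex is the image of an element killed by some power of the
  variables, hence a boundary of the subcomplex for that power.
\<close>

definition coboundaries :: "'e set"
  where "coboundaries = (\<Union>T. boundaries (y_power T) n)"

lemma y_torsion_eq: "carrier (torsion_submodule (xy_ring m n) (y_ideal m n) (E i)) = y_torsion i"
proof -
  have "e \<in> carrier (torsion_submodule (xy_ring m n) (y_ideal m n) (E i)) \<longleftrightarrow> e \<in> y_torsion i" for e
    using y_torsion_iff[OF E_module[of i], of e]
    by (cases "e \<in> carrier (E i)") (simp_all add: torsion_submodule_def y_torsion_def killed_def)
  then show ?thesis by blast
qed

lemma y_powers_closed: "j < n \<Longrightarrow> (y_power T j :: 'k bipoly) \<in> carrier (xy_ring m n)"
  by simp

lemma killed_mono: "killed (y_power T) n i \<subseteq> killed (y_power (T + t)) n i"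
proof
  fix e assume e: "e \<in> killed (y_power T) n i"
  note ec = killed_carrier[OF e]
  have "y_power (T + t) j \<odot>\<^bsub>E i\<^esub> e = \<zero>\<^bsub>E i\<^esub>" if j: "j < n" for j
  proof -
    have "y_power (T + t) j \<odot>\<^bsub>E i\<^esub> e = y_power t j \<odot>\<^bsub>E i\<^esub> (y_power T j \<odot>\<^bsub>E i\<^esub> e)"
      using E.smult_assoc1[OF y_powers_closed[OF j, of t] y_powers_closed[OF j, of T] ec]
      by (simp add: y_power_mult add.commute)
    then show ?thesis using e j y_powers_closed[OF j, of t] by (simp add: killed_def)
  qed
  then show "e \<in> killed (y_power (T + t)) n i" using ec by (simp add: killed_def)
qed

lemma common_killed:
  assumes "x \<in> y_torsion i" "y \<in> y_torsion i"
  obtains T where "x \<in> killed (y_power T) n i" "y \<in> killed (y_power T) n i"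
proof -
  obtain T T' where "x \<in> killed (y_power T) n i" "y \<in> killed (y_power T') n i"
    using assms by (auto simp: y_torsion_def)
  then show thesis using that[of "T + T'"] killed_mono[of T i T'] killed_mono[of T' i T]
    by (auto simp: add.commute)
qed

lemma killed_torsion: "x \<in> killed (y_power T) n i \<Longrightarrow> x \<in> y_torsion i"
  using killed_carrier by (auto simp: y_torsion_def)

lemma y_torsion_submodule: "submodule (y_torsion i) (xy_ring m n) (E i)"
proof (rule E.submoduleI)
  show "\<zero>\<^bsub>E i\<^esub> \<in> y_torsion i"
    using killed_torsion[of "\<zero>\<^bsub>E i\<^esub>" 0] y_powers_closed by (simp add: killed_def)
  fix x assume x: "x \<in> y_torsion i"
  then obtain T where T: "x \<in> killed (y_power T) n i" by (auto simp: y_torsion_def)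
  note sub = killed_submodule[of n "y_power T" i, OF y_powers_closed]
  show "\<ominus>\<^bsub>E i\<^esub> x \<in> y_torsion i"
    using E.submoduleE(3)[OF sub T] by (rule killed_torsion)
  show "r \<odot>\<^bsub>E i\<^esub> x \<in> y_torsion i" if "r \<in> carrier (xy_ring m n)" for r
    using E.submoduleE(4)[OF sub that T] by (rule killed_torsion)
next
  fix x y assume "x \<in> y_torsion i" "y \<in> y_torsion i"
  then obtain T where T: "x \<in> killed (y_power T) n i" "y \<in> killed (y_power T) n i"
    by (rule common_killed)
  show "x \<oplus>\<^bsub>E i\<^esub> y \<in> y_torsion i"
    by (rule killed_torsion[OF killed_add[OF y_powers_closed T]])
qed (auto simp: y_torsion_def)

lemma cocycles_submodule: "submodule cocycles (xy_ring m n) (E n)"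
proof (rule E.submoduleI)
  note sub = E.submoduleE[OF y_torsion_submodule[of n]]
  have c: "x \<in> carrier (E n)" if "x \<in> y_torsion n" for x using that sub(1) by auto
  show "cocycles \<subseteq> carrier (E n)" using sub(1) by (auto simp: cocycles_def)
  have "\<zero>\<^bsub>E n\<^esub> \<in> y_torsion n" using subgroup.one_closed[OF submodule.axioms(1)[OF y_torsion_submodule]] by simp
  then show "\<zero>\<^bsub>E n\<^esub> \<in> cocycles" by (auto simp: cocycles_def d_simps(4))
  show "\<ominus>\<^bsub>E n\<^esub> x \<in> cocycles" if "x \<in> cocycles" for x
  proof -
    have x: "x \<in> carrier (E n)" "x \<in> y_torsion n" "d n x = \<zero>\<^bsub>E (Suc n)\<^esub>" using that c by (auto simp: cocycles_def)
    have "d n (\<zero>\<^bsub>E n\<^esub> \<ominus>\<^bsub>E n\<^esub> x) = \<zero>\<^bsub>E (Suc n)\<^esub>"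
      using x(3) d_simps(5)[OF E.zero_closed[of n] x(1)] by (simp add: d_simps(4) E.minus_eq)
    then show ?thesis using x sub(3)[OF x(2)] by (simp add: cocycles_def a_minus_def)
  qed
  show "x \<oplus>\<^bsub>E n\<^esub> y \<in> cocycles" if "x \<in> cocycles" "y \<in> cocycles" for x y
    using that c sub(5)[of x y] by (auto simp: cocycles_def d_simps(2))
  show "r \<odot>\<^bsub>E n\<^esub> x \<in> cocycles" if "r \<in> carrier (xy_ring m n)" "x \<in> cocycles" for r x
    using that c sub(4)[of r x] by (auto simp: cocycles_def d_simps(3))
qed

lemma coboundaries_eq: "coboundaries = (case n of 0 \<Rightarrow> {\<zero>\<^bsub>E 0\<^esub>} | Suc j \<Rightarrow> d j ` y_torsion j)"
proof (cases n)
  case 0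
  then show ?thesis unfolding coboundaries_def boundaries_def by simp
next
  case (Suc j)
  then show ?thesis using killed_carrier
    unfolding coboundaries_def boundaries_def y_torsion_def by auto
qed

lemma boundaries_mono: "boundaries (y_power T) n \<subseteq> boundaries (y_power (T + t)) n"
proof (cases n)
  case 0
  then show ?thesis by (simp add: boundaries_def)
next
  case (Suc j)
  then show ?thesis using killed_mono[of T j t] unfolding boundaries_def by auto
qed

abbreviation cocycle_module :: "('k bipoly, 'e) module"
  where "cocycle_module \<equiv> (E n)\<lparr>carrier := cocycles\<rparr>"

lemma represents_cocycle:
  assumes "represents (y_power T) n r w" shows "w \<in> cocycles"
  using represents_closed[OF y_powers_weakly_regular le_refl assms] killed_torsion
  by (auto simp: cocycles_def)

lemma cocycle_represents:
  assumes "w \<in> cocycles"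
  shows "\<exists>T. \<exists>r\<in>carrier (xy_ring m n). represents (y_power T) n (residue r) w"
proof -
  obtain T where T: "w \<in> killed (y_power T) n n" "d n w = \<zero>\<^bsub>E (Suc n)\<^esub>"
    using assms by (auto simp: cocycles_def y_torsion_def)
  obtain C where C: "represents (y_power T) n C w"
    using represents_surj[OF y_powers_weakly_regular le_refl T] by auto
  then have "C \<in> carrier M" by (rule represents_carrier)
  then show ?thesis using C residue_carrier by auto
qed

lemma represents_shift:
  assumes "represents (y_power T) n (residue r) w" and r: "r \<in> carrier (xy_ring m n)"
  shows "represents (y_power (T + t)) n (residue (y_monomial n t * r)) w"
proof -
  have eq: "(\<lambda>j. y_power T j \<otimes>\<^bsub>xy_ring m n\<^esub> y_power t j) = (y_power (T + t) :: nat \<Rightarrow> 'k bipoly)"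
    by (simp add: y_power_mult fun_eq_iff)
  have "represents (\<lambda>j. y_power T j \<otimes>\<^bsub>xy_ring m n\<^esub> y_power t j) n
      (prod_below (xy_ring m n) (y_power t) n \<odot>\<^bsub>M\<^esub> residue r) w"
  proof (rule represents_scale[where n = n])
    show "weakly_regular (xy_ring m n) (\<lambda>j. y_power T j \<otimes>\<^bsub>xy_ring m n\<^esub> y_power t j :: 'k bipoly) n"
      unfolding eq by (rule y_powers_weakly_regular)
  qed (use assms in simp_all)
  then show ?thesis unfolding eq prod_below_y_power residue_smult[OF r y_monomial_mem] .
qed

text \<open>
  A cocycle may become a boundary only in the subcomplex for a larger power; this is where the factor
  \<open>(y\<^sub>1 \<cdots> y\<^sub>n)\<^sup>t\<close> in the vanishing criterion comes from.
\<close>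

lemma represents_coboundary_iff:
  assumes "represents (y_power T) n (residue r) w" and r: "r \<in> carrier (xy_ring m n)"
  shows "w \<in> coboundaries \<longleftrightarrow>
    (\<exists>t. \<exists>h\<in>carrier (xy_ring m n). y_monomial n t * r - f * h \<in> y_multiples (T + t) n)"
proof -
  have yr: "y_monomial n t * r \<in> carrier (xy_ring m n)" for t using r by simp
  have "w \<in> boundaries (y_power (T + t)) n \<longleftrightarrow>
      (\<exists>h\<in>carrier (xy_ring m n). y_monomial n t * r - f * h \<in> y_multiples (T + t) n)" for t
    using boundary_iff_seq_multiples[OF y_powers_weakly_regular le_refl represents_shift[OF assms]]
      residue_seq_multiples_iff[OF le_refl yr] by blast
  moreover have "w \<in> coboundaries \<longleftrightarrow> (\<exists>t. w \<in> boundaries (y_power (T + t)) n)"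
    using boundaries_mono by (auto simp: coboundaries_def add.commute[of T])
  ultimately show ?thesis by simp
qed

lemma residue_represented: "r \<in> carrier (xy_ring m n) \<Longrightarrow> \<exists>w. represents (y_power T) n (residue r) w"
  using represents_total[OF y_powers_weakly_regular le_refl] residue_carrier by auto

lemma coboundaries_subset: "coboundaries \<subseteq> cocycles"
proof
  fix w assume "w \<in> coboundaries"
  then consider "n = 0" "w = \<zero>\<^bsub>E n\<^esub>" | j u where "n = Suc j" "u \<in> y_torsion j" "w = d j u"
    by (auto simp: coboundaries_eq split: nat.splits)
  then show "w \<in> cocycles"
  proof cases
    case 1
    then show ?thesis using subgroup.one_closed[OF submodule.axioms(1)[OF cocycles_submodule]] by simp
  next
    case 2
    obtain T where u: "u \<in> killed (y_power T) n j" using 2(2) unfolding y_torsion_def by blast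
    have "w \<in> y_torsion n"
      using killed_torsion[OF killed_d[OF y_powers_closed u]] 2 by auto
    moreover have "d n w = \<zero>\<^bsub>E (Suc n)\<^esub>" using d_exact(2)[OF killed_carrier[OF u]] 2 by auto
    ultimately show ?thesis by (simp add: cocycles_def)
  qed
qed

lemma cocycle_module: "Module.module (xy_ring m n) cocycle_module"
  by (rule E.subset_module[OF cocycles_submodule])

lemma coboundaries_submodule: "submodule coboundaries (xy_ring m n) cocycle_module"
proof -
  interpret Z: Module.module "xy_ring m n" cocycle_module by (rule cocycle_module)
  have sub: "subgroup coboundaries (add_monoid (E n)) \<and>
    (\<forall>r\<in>carrier (xy_ring m n). \<forall>w\<in>coboundaries. r \<odot>\<^bsub>E n\<^esub> w \<in> coboundaries)"
  proof (cases n)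
    case 0
    then have "coboundaries = {\<zero>\<^bsub>E n\<^esub>}" unfolding coboundaries_eq by simp
    then show ?thesis using E.add.triv_subgroup by auto
  next
    case (Suc j)
    then have eq: "coboundaries = d j ` y_torsion j" unfolding coboundaries_eq by simp
    note tors = E.submoduleE[OF y_torsion_submodule[of j]]
    have "submodule (d j ` y_torsion j) (xy_ring m n) (E (Suc j))"
    proof (rule E.submoduleI)
      have z: "\<zero>\<^bsub>E j\<^esub> \<in> y_torsion j" using subgroup.one_closed[OF submodule.axioms(1)[OF y_torsion_submodule]] by simp
      then show "\<zero>\<^bsub>E (Suc j)\<^esub> \<in> d j ` y_torsion j" using d_simps(4)[of j] by (metis imageI)
      show "d j ` y_torsion j \<subseteq> carrier (E (Suc j))" using tors(1) d_simps(1) by auto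
      fix x assume "x \<in> d j ` y_torsion j"
      then obtain u where u: "u \<in> y_torsion j" "x = d j u" by auto
      then have uc: "u \<in> carrier (E j)" using tors(1) by auto
      have neg: "(\<ominus>\<^bsub>xy_ring m n\<^esub> \<one>\<^bsub>xy_ring m n\<^esub>) \<odot>\<^bsub>E j\<^esub> u \<in> y_torsion j"
        using u by (intro tors(4)) auto
      have "\<ominus>\<^bsub>E (Suc j)\<^esub> x = (\<ominus>\<^bsub>xy_ring m n\<^esub> \<one>\<^bsub>xy_ring m n\<^esub>) \<odot>\<^bsub>E (Suc j)\<^esub> x"
        using u uc d_simps(1) by (simp only: E.smult_l_minus E.R.one_closed E.smult_one)
      also have "\<dots> = d j ((\<ominus>\<^bsub>xy_ring m n\<^esub> \<one>\<^bsub>xy_ring m n\<^esub>) \<odot>\<^bsub>E j\<^esub> u)"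
        unfolding u(2) by (rule d_simps(3)[symmetric]) (use uc in auto)
      finally show "\<ominus>\<^bsub>E (Suc j)\<^esub> x \<in> d j ` y_torsion j" using neg by auto
      show "r \<odot>\<^bsub>E (Suc j)\<^esub> x \<in> d j ` y_torsion j" if r: "r \<in> carrier (xy_ring m n)" for r
        using tors(4)[OF r u(1)] d_simps(3)[OF r uc] u(2) by (metis imageI)
    next
      fix x y assume "x \<in> d j ` y_torsion j" "y \<in> d j ` y_torsion j"
      then obtain u v where u: "u \<in> y_torsion j" "x = d j u" and v: "v \<in> y_torsion j" "y = d j v" by auto
      then show "x \<oplus>\<^bsub>E (Suc j)\<^esub> y \<in> d j ` y_torsion j"
        using tors(1) tors(5)[OF u(1) v(1)] d_simps(2)[of u j v] by (metis imageI subsetD)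
    qed
    then have "submodule coboundaries (xy_ring m n) (E n)" unfolding eq Suc[symmetric] .
    then show ?thesis by (intro conjI ballI submodule.axioms(1) submodule.smult_closed)
  qed
  have "subgroup coboundaries (add_monoid cocycle_module)"
    using E.add.subgroup_incl[OF conjunct1[OF sub] submodule.axioms(1)[OF cocycles_submodule]
      coboundaries_subset] by simp
  then show ?thesis using sub by (simp add: submodule_def submodule_axioms_def)
qed

lemma local_cohomology_eq:
  "local_cohomology (xy_ring m n) (y_ideal m n) E d n = quotient_module (xy_ring m n) cocycle_module coboundaries"
proof -
  have "a_kernel (torsion_submodule (xy_ring m n) (y_ideal m n) (E n))
      (torsion_submodule (xy_ring m n) (y_ideal m n) (E (Suc n))) (d n) = cocycles"
    by (auto simp: mem_kernel_iff y_torsion_eq cocycles_def) (simp_all add: torsion_submodule_def)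
  moreover have "(torsion_submodule (xy_ring m n) (y_ideal m n) (E n))\<lparr>carrier := cocycles\<rparr> = cocycle_module"
    by (simp add: torsion_submodule_def)
  moreover have "(case n of 0 \<Rightarrow> {\<zero>\<^bsub>torsion_submodule (xy_ring m n) (y_ideal m n) (E 0)\<^esub>}
      | Suc j \<Rightarrow> d j ` carrier (torsion_submodule (xy_ring m n) (y_ideal m n) (E j))) = coboundaries"
    unfolding coboundaries_eq y_torsion_eq by (simp add: torsion_submodule_def split: nat.split)
  ultimately show ?thesis unfolding local_cohomology_def cohomology_module_def by simp
qed

definition fraction :: "nat \<Rightarrow> 'k bipoly \<Rightarrow> 'e set"
  where "fraction T r =
    coboundaries +>\<^bsub>cocycle_module\<^esub> (SOME w. represents (y_power T) n (residue r) w)"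

text \<open>
  Two cocycles representing the same numerator differ by one that represents \<open>0\<close>, which is a coboundary.
\<close>

lemma fraction_eq:
  assumes w: "represents (y_power T) n (residue r) w" and r: "r \<in> carrier (xy_ring m n)"
  shows "fraction T r = coboundaries +>\<^bsub>cocycle_module\<^esub> w"
proof -
  interpret Z: Module.module "xy_ring m n" cocycle_module by (rule cocycle_module)
  define w' where "w' = (SOME w. represents (y_power T) n (residue r) w)"
  have w': "represents (y_power T) n (residue r) w'" unfolding w'_def using w by (rule someI)
  have c: "w' \<in> cocycles" "w \<in> cocycles" using represents_cocycle w w' by auto
  have rc: "residue r \<in> carrier M" using r residue_carrier by auto
  have "represents (y_power T) n (residue r \<ominus>\<^bsub>M\<^esub> residue r) (w' \<ominus>\<^bsub>E n\<^esub> w)"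
    by (rule represents_minus[OF y_powers_weakly_regular le_refl w' w])
  moreover have "residue r \<ominus>\<^bsub>M\<^esub> residue r = residue 0"
    using rc residue_zero_iff[of 0] f_mem by (auto simp: a_minus_def M.r_neg intro!: bexI[of _ 0])
  ultimately have "represents (y_power T) n (residue 0) (w' \<ominus>\<^bsub>E n\<^esub> w)" by simp
  moreover have "\<exists>t. \<exists>h\<in>carrier (xy_ring m n). y_monomial n t * 0 - f * h \<in> y_multiples (T + t) n"
    by (intro exI[of _ 0] bexI[of _ 0]) (simp_all add: y_multiples_closed)
  ultimately have "w' \<ominus>\<^bsub>E n\<^esub> w \<in> coboundaries"
    using represents_coboundary_iff[of T 0 "w' \<ominus>\<^bsub>E n\<^esub> w"] by simp
  then have "w' \<ominus>\<^bsub>cocycle_module\<^esub> w \<in> coboundaries"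
    using E.submodule_minus[OF cocycles_submodule c] by simp
  then show ?thesis
    using Z.coset_eq_iff[OF coboundaries_submodule, of w' w] c by (simp add: fraction_def w'_def)
qed

theorem local_cohomology_presentation:
  "fraction_presentation m n f (local_cohomology (xy_ring m n) (y_ideal m n) E d n) fraction"
proof -
  interpret Z: Module.module "xy_ring m n" cocycle_module by (rule cocycle_module)
  let ?H = "local_cohomology (xy_ring m n) (y_ideal m n) E d n"
  note Q = Z.quotient_add[OF coboundaries_submodule, folded local_cohomology_eq]
    Z.quotient_smult[OF coboundaries_submodule, folded local_cohomology_eq]
    Z.quotient_zero[OF coboundaries_submodule, folded local_cohomology_eq]
    Z.quotient_carrier[OF coboundaries_submodule, folded local_cohomology_eq]
    Z.quotient_module_is_module[OF coboundaries_submodule, folded local_cohomology_eq]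
  note reg = y_powers_weakly_regular
  show ?thesis
  proof (rule fraction_presentation.intro)
    show "Module.module (xy_ring m n) ?H" by (rule Q(5))
    show "f \<in> carrier (xy_ring m n)" by (rule f_mem)
  next
    fix r :: "'k bipoly" and T assume r: "r \<in> carrier (xy_ring m n)"
    from residue_represented[OF r] obtain w where w: "represents (y_power T) n (residue r) w" ..
    have wc: "w \<in> cocycles" by (rule represents_cocycle[OF w])
    note frac = fraction_eq[OF w r]
    show "fraction T r \<in> carrier ?H" unfolding frac Q(4) using wc by simp
    show "fraction (T + t) (y_monomial n t * r) = fraction T r" for t
    proof -
      have "represents (y_power (T + t)) n (residue (y_monomial n t * r)) w" by (rule represents_shift[OF w r])
      then show ?thesis using fraction_eq[of "T + t" "y_monomial n t * r" w] r by (simp add: frac)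
    qed
    have "coboundaries +>\<^bsub>cocycle_module\<^esub> w = coboundaries \<longleftrightarrow> w \<in> coboundaries"
      using Z.M.a_coset_join1[of coboundaries w] Z.M.a_coset_join2[of w coboundaries] wc
        submodule.axioms(1)[OF coboundaries_submodule] by auto
    then show "fraction T r = \<zero>\<^bsub>?H\<^esub> \<longleftrightarrow>
        (\<exists>t. \<exists>h\<in>carrier (xy_ring m n). y_monomial n t * r - f * h \<in> y_multiples (T + t) n)"
      unfolding frac Q(3) using represents_coboundary_iff[OF w r] by simp
    fix s :: "'k bipoly" assume s: "s \<in> carrier (xy_ring m n)"
    have "represents (y_power T) n (residue (s * r)) (s \<odot>\<^bsub>E n\<^esub> w)"
      using represents_smult[OF reg le_refl s w] residue_smult[OF r s] by simp
    then show "fraction T (s * r) = s \<odot>\<^bsub>?H\<^esub> fraction T r"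
      using fraction_eq[of T "s * r"] r s Q(2)[OF s, of w] wc by (simp add: frac)
    from residue_represented[OF s] obtain v where v: "represents (y_power T) n (residue s) v" ..
    have "represents (y_power T) n (residue (r + s)) (w \<oplus>\<^bsub>E n\<^esub> v)"
      using represents_add[OF reg le_refl w v] residue_add[OF r s] by simp
    then show "fraction T (r + s) = fraction T r \<oplus>\<^bsub>?H\<^esub> fraction T s"
      using fraction_eq[of T "r + s"] fraction_eq[OF v s] r s Q(1)[of w v] wc represents_cocycle[OF v]
      by (simp add: frac)
  next
    fix z assume "z \<in> carrier ?H"
    then obtain w where w: "w \<in> cocycles" "z = coboundaries +>\<^bsub>cocycle_module\<^esub> w" unfolding Q(4) by auto
    then show "\<exists>T. \<exists>r\<in>carrier (xy_ring m n). z = fraction T r"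
      using cocycle_represents[OF w(1)] fraction_eq by metis
  qed
qed

end

section \<open>Lexicographic order and Dickson's lemma\<close>

text \<open>
  The lexicographic order, with the variables ranked by their position in the list. It is a monomial
  order: a well-order compatible with addition of exponents.
\<close>

definition exp_less :: "'v list \<Rightarrow> ('v \<Rightarrow>\<^sub>0 nat) \<Rightarrow> ('v \<Rightarrow>\<^sub>0 nat) \<Rightarrow> bool"
  where "exp_less vs \<alpha> \<beta> \<longleftrightarrow> (\<exists>i<length vs.
    lookup \<alpha> (vs ! i) < lookup \<beta> (vs ! i) \<and>
    (\<forall>j<i. lookup \<alpha> (vs ! j) = lookup \<beta> (vs ! j)))"

lemma wf_exp_less: "wf {(\<alpha>, \<beta>). exp_less vs \<alpha> \<beta>}"
proof (rule wf_subset)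
  let ?l = "\<lambda>\<alpha>. map (lookup \<alpha>) vs"
  show "wf (inv_image (lex less_than) ?l)" by (intro wf_inv_image wf_lex wf_less_than)
  show "{(\<alpha>, \<beta>). exp_less vs \<alpha> \<beta>} \<subseteq> inv_image (lex less_than) ?l"
  proof safe
    fix \<alpha> \<beta> assume "exp_less vs \<alpha> \<beta>"
    then obtain i where i: "i < length vs" "?l \<alpha> ! i < ?l \<beta> ! i" "\<forall>j<i. ?l \<alpha> ! j = ?l \<beta> ! j"
      by (auto simp: exp_less_def)
    have "take i (?l \<alpha>) = take i (?l \<beta>)" by (rule nth_take_lemma) (use i in auto)
    moreover have "?l \<alpha> = take i (?l \<alpha>) @ ?l \<alpha> ! i # drop (Suc i) (?l \<alpha>)"
      "?l \<beta> = take i (?l \<beta>) @ ?l \<beta> ! i # drop (Suc i) (?l \<beta>)"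
      using id_take_nth_drop[of i "?l \<alpha>"] id_take_nth_drop[of i "?l \<beta>"] i(1) by simp_all
    ultimately show "(\<alpha>, \<beta>) \<in> inv_image (lex less_than) ?l"
      using i(2) unfolding in_inv_image lex_conv by (metis (mono_tags, lifting) case_prodI length_map less_than_iff mem_Collect_eq)
  qed
qed

lemma exp_less_add: "exp_less vs (\<alpha> + \<gamma>) (\<beta> + \<gamma>) \<longleftrightarrow> exp_less vs \<alpha> \<beta>"
  by (simp add: exp_less_def lookup_add)

lemma exp_less_trans: "exp_less vs \<alpha> \<beta> \<Longrightarrow> exp_less vs \<beta> \<gamma> \<Longrightarrow> exp_less vs \<alpha> \<gamma>"
  unfolding exp_less_def
proof (elim exE conjE)
  fix i j
  assume a: "i < length vs" "j < length vs"
    "lookup \<alpha> (vs ! i) < lookup \<beta> (vs ! i)"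
    "\<forall>k<i. lookup \<alpha> (vs ! k) = lookup \<beta> (vs ! k)"
    "lookup \<beta> (vs ! j) < lookup \<gamma> (vs ! j)"
    "\<forall>k<j. lookup \<beta> (vs ! k) = lookup \<gamma> (vs ! k)"
  have "min i j < length vs" using a(1) by simp
  moreover have "lookup \<alpha> (vs ! min i j) < lookup \<gamma> (vs ! min i j)"
    using a by (cases i j rule: linorder_cases) (simp_all add: min_def)
  moreover have "lookup \<alpha> (vs ! k) = lookup \<gamma> (vs ! k)" if "k < min i j" for k
  proof -
    have "k < i" "k < j" using that by simp_all
    then show ?thesis using a(4)[rule_format, of k] a(6)[rule_format, of k] by metis
  qed
  ultimately show "\<exists>i<length vs. lookup \<alpha> (vs ! i) < lookup \<gamma> (vs ! i) \<and>
      (\<forall>j<i. lookup \<alpha> (vs ! j) = lookup \<gamma> (vs ! j))" by blast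
qed

lemma exp_less_total:
  assumes "keys \<alpha> \<subseteq> set vs" "keys \<beta> \<subseteq> set vs" "\<alpha> \<noteq> \<beta>"
  shows "exp_less vs \<alpha> \<beta> \<or> exp_less vs \<beta> \<alpha>"
proof -
  let ?P = "\<lambda>i. i < length vs \<and> lookup \<alpha> (vs ! i) \<noteq> lookup \<beta> (vs ! i)"
  have "\<exists>i. ?P i"
  proof (rule ccontr)
    assume "\<nexists>i. ?P i"
    then have "lookup \<alpha> v = lookup \<beta> v" if "v \<in> set vs" for v
      using that by (metis in_set_conv_nth)
    moreover have "lookup \<alpha> v = lookup \<beta> v" if "v \<notin> set vs" for v
      using that assms(1,2) by (metis in_keys_iff subsetD)
    ultimately show False using assms(3) by (metis poly_mapping_eqI)
  qed
  then obtain i where i: "?P i" "\<And>j. j < i \<Longrightarrow> \<not> ?P j" using exists_least_iff[of ?P] by blast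
  have "lookup \<alpha> (vs ! j) = lookup \<beta> (vs ! j)" if "j < i" for j
    using i(2)[OF that] i(1) that by simp
  then show ?thesis using i(1) unfolding exp_less_def by (metis nat_neq_iff)
qed

lemma nat_sequence_monotone_subsequence:
  fixes s :: "nat \<Rightarrow> nat" shows "\<exists>g :: nat \<Rightarrow> nat. strict_mono g \<and> mono (s \<circ> g)"
proof -
  obtain g :: "nat \<Rightarrow> nat" where g: "strict_mono g" "monoseq (\<lambda>n. s (g n))"
    using seq_monosub[of s] by auto
  show ?thesis
  proof (cases "incseq (\<lambda>n. s (g n))")
    case True
    then show ?thesis using g(1) by (intro exI[of _ g]) (simp add: o_def)
  next
    case False
    then have dec: "decseq (\<lambda>n. s (g n))" using g(2) by (simp add: monoseq_iff)
    obtain k where k: "\<And>i. s (g k) \<le> s (g i)"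
      using ex_has_least_nat[of "\<lambda>_. True" 0 "\<lambda>n. s (g n)"] by auto
    have "s (g (k + i)) = s (g k)" for i
      using k[of "k + i"] decseqD[OF dec, of k "k + i"] by simp
    then have "mono (s \<circ> (\<lambda>i. g (k + i)))" by (simp add: mono_def)
    moreover have "strict_mono (\<lambda>i. g (k + i))" using g(1) by (simp add: strict_mono_def)
    ultimately show ?thesis by blast
  qed
qed

text \<open>
  Dickson's lemma in the form of a subsequence that is monotone in each of finitely many coordinates.
\<close>

lemma dickson_subsequence:
  fixes s :: "nat \<Rightarrow> 'v \<Rightarrow> nat"
  assumes "finite V"
  shows "\<exists>g :: nat \<Rightarrow> nat. strict_mono g \<and> (\<forall>v\<in>V. mono (\<lambda>i. s (g i) v))"
  using assms
proof (induction V)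
  case empty
  show ?case by (intro exI[of _ id]) (simp add: strict_mono_def)
next
  case (insert v V)
  then obtain g :: "nat \<Rightarrow> nat" where g: "strict_mono g" "\<And>v. v \<in> V \<Longrightarrow> mono (\<lambda>i. s (g i) v)" by blast
  obtain h :: "nat \<Rightarrow> nat" where h: "strict_mono h" "mono ((\<lambda>i. s (g i) v) \<circ> h)"
    using nat_sequence_monotone_subsequence by blast
  have "mono (\<lambda>i. s ((g \<circ> h) i) u)" if "u \<in> insert v V" for u
    using that h(2) monoD[OF g(2)[of u]] strict_mono_less_eq[OF h(1)]
    by (auto simp: mono_def)
  then show ?case using strict_mono_o[OF g(1) h(1)] by blast
qed

text \<open>
  If the chain dropped infinitely often, pick at each drop an exponent that is lost there. By Dickson's
  lemma an earlier one lies below a later one, which belongs to a set where the earlier one is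
  already missing; this contradicts that the sets are down-closed.
\<close>

lemma downsets_descending_chain:
  fixes L :: "nat \<Rightarrow> ('v \<Rightarrow>\<^sub>0 nat) set"
  assumes V: "finite V" and keys: "\<And>i \<alpha>. \<alpha> \<in> L i \<Longrightarrow> keys \<alpha> \<subseteq> V"
    and dec: "\<And>i. L (Suc i) \<subseteq> L i"
    and down: "\<And>i \<alpha> \<gamma>. \<alpha> + \<gamma> \<in> L i \<Longrightarrow> \<alpha> \<in> L i"
  shows "\<exists>k. \<forall>i\<ge>k. L i = L k"
proof (rule ccontr)
  assume "\<not> ?thesis"
  then have *: "\<exists>i \<alpha>. k \<le> i \<and> \<alpha> \<in> L k \<and> \<alpha> \<notin> L i" for k
    using lift_Suc_antimono_le[of L, OF dec] by (metis subsetI subset_antisym)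
  then obtain I \<alpha> where I: "\<And>k. k \<le> I k" "\<And>k. \<alpha> k \<in> L k" "\<And>k. \<alpha> k \<notin> L (I k)" by metis
  define K where "K = rec_nat 0 (\<lambda>_. I)"
  have K: "K (Suc j) = I (K j)" for j by (simp add: K_def)
  then have Kmono: "i \<le> j \<Longrightarrow> K i \<le> K j" for i j
    using lift_Suc_mono_le[of K] I(1) by metis
  obtain g :: "nat \<Rightarrow> nat" where g: "strict_mono g" "\<And>v. v \<in> V \<Longrightarrow> mono (\<lambda>i. lookup (\<alpha> (K (g i))) v)"
    using dickson_subsequence[OF V, of "\<lambda>i. lookup (\<alpha> (K i))"] by auto
  let ?\<beta> = "\<alpha> (K (g 0))" and ?\<beta>' = "\<alpha> (K (g 1))"
  have "lookup ?\<beta> v \<le> lookup ?\<beta>' v" for v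
  proof (cases "v \<in> V")
    case True
    then show ?thesis using monoD[OF g(2)[OF True], of 0 1] by simp
  next
    case False
    then have "v \<notin> keys ?\<beta>" using keys I(2) by blast
    then show ?thesis by (simp add: in_keys_iff)
  qed
  then have "?\<beta>' = ?\<beta> + (?\<beta>' - ?\<beta>)"
    by (intro poly_mapping_eqI) (simp add: lookup_add lookup_minus)
  moreover have "Suc (g 0) \<le> g 1" using strict_monoD[OF g(1), of 0 1] by simp
  then have "K (Suc (g 0)) \<le> K (g 1)" by (rule Kmono)
  then have "?\<beta>' \<in> L (I (K (g 0)))"
    using I(2)[of "K (g 1)"] lift_Suc_antimono_le[of L, OF dec] K by (metis subsetD)
  ultimately have "?\<beta> \<in> L (I (K (g 0)))" using down by metis
  then show False using I(3) by blast
qed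

section \<open>Modules spanned by inverse monomials\<close>

definition var_list :: "nat \<Rightarrow> nat \<Rightarrow> (nat + nat) list"
  where "var_list m n = map Inl [0..<m] @ map Inr [0..<n]"

lemma set_var_list: "set (var_list m n) = xy_vars m n"
  by (auto simp: var_list_def xy_vars_def)

abbreviation xy_less :: "nat \<Rightarrow> nat \<Rightarrow> (nat + nat \<Rightarrow>\<^sub>0 nat) \<Rightarrow> (nat + nat \<Rightarrow>\<^sub>0 nat) \<Rightarrow> bool"
  where "xy_less m n \<equiv> exp_less (var_list m n)"

text \<open>
  Here \<open>e \<beta>\<close> plays the role of the inverse monomial with exponent \<open>- \<beta>\<close>. The family is not required to be
  linearly independent, so that quotients of modules of inverse polynomials are covered.
\<close>

locale inverse_monomials =
  fixes m n :: nat and N :: "('k::field bipoly, 'c, 'z) module_scheme"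
    and D :: "(nat + nat \<Rightarrow>\<^sub>0 nat) set" and e :: "(nat + nat \<Rightarrow>\<^sub>0 nat) \<Rightarrow> 'c"
  assumes N_module: "Module.module (xy_ring m n) N"
    and D_keys: "\<beta> \<in> D \<Longrightarrow> keys \<beta> \<subseteq> xy_vars m n"
    and D_down: "\<beta> \<in> D \<Longrightarrow> \<beta> - \<gamma> \<in> D"
    and e_closed: "\<beta> \<in> D \<Longrightarrow> e \<beta> \<in> carrier N"
    and contraction: "\<beta> \<in> D \<Longrightarrow> v \<in> xy_vars m n \<Longrightarrow> mvar v \<odot>\<^bsub>N\<^esub> e \<beta> =
      (if lookup \<beta> v = 0 then \<zero>\<^bsub>N\<^esub> else e (\<beta> - single v 1))"
begin

sublocale N: Module.module "xy_ring m n" N by (rule N_module)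

abbreviation const :: "'k \<Rightarrow> 'k bipoly" where "const c \<equiv> single 0 c"

lemma const_mem [simp]: "const c \<in> carrier (xy_ring m n)"
  by (rule single_mem_xy_ring) simp

lemma mvar_mem [simp]: "v \<in> xy_vars m n \<Longrightarrow> (mvar v :: 'k bipoly) \<in> carrier (xy_ring m n)"
  unfolding mvar_def by (rule single_mem_xy_ring) simp

text \<open>
  The \<open>K\<close>-linear span. Being inductive it gives statements about spans by adding one term at a time,
  without finite sums in the module.
\<close>

inductive_set e_span :: "(nat + nat \<Rightarrow>\<^sub>0 nat) set \<Rightarrow> 'c set" for A where
  zero: "\<zero>\<^bsub>N\<^esub> \<in> e_span A"
| step: "\<beta> \<in> A \<Longrightarrow> z \<in> e_span A \<Longrightarrow> const c \<odot>\<^bsub>N\<^esub> e \<beta> \<oplus>\<^bsub>N\<^esub> z \<in> e_span A"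

lemma e_span_closed: "z \<in> e_span A \<Longrightarrow> A \<subseteq> D \<Longrightarrow> z \<in> carrier N"
proof (induction rule: e_span.induct)
  case (step \<beta> z c)
  then have "e \<beta> \<in> carrier N" "z \<in> carrier N" by (auto intro: e_closed)
  then show ?case by simp
qed simp

lemma e_span_mono: "z \<in> e_span A \<Longrightarrow> A \<subseteq> B \<Longrightarrow> z \<in> e_span B"
  by (induction rule: e_span.induct) (auto intro: e_span.intros)

lemma e_span_add:
  assumes "z \<in> e_span A" "z' \<in> e_span A" "A \<subseteq> D"
  shows "z \<oplus>\<^bsub>N\<^esub> z' \<in> e_span A"
  using assms(1)
proof (induction rule: e_span.induct)
  case zero
  then show ?case using assms e_span_closed by simp
next
  case (step \<beta> z c)
  have "const c \<odot>\<^bsub>N\<^esub> e \<beta> \<oplus>\<^bsub>N\<^esub> z \<oplus>\<^bsub>N\<^esub> z' = const c \<odot>\<^bsub>N\<^esub> e \<beta> \<oplus>\<^bsub>N\<^esub> (z \<oplus>\<^bsub>N\<^esub> z')"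
    using assms step e_span_closed e_closed by (intro N.M.a_assoc) auto
  then show ?case using step by (simp add: e_span.step)
qed

lemma e_span_const:
  assumes "z \<in> e_span A" "A \<subseteq> D"
  shows "const c' \<odot>\<^bsub>N\<^esub> z \<in> e_span A"
  using assms(1)
proof (induction rule: e_span.induct)
  case zero
  then show ?case by (simp add: e_span.zero)
next
  case (step \<beta> z c)
  have "const c' \<odot>\<^bsub>N\<^esub> (const c \<odot>\<^bsub>N\<^esub> e \<beta> \<oplus>\<^bsub>N\<^esub> z) = const (c' * c) \<odot>\<^bsub>N\<^esub> e \<beta> \<oplus>\<^bsub>N\<^esub> const c' \<odot>\<^bsub>N\<^esub> z"
    using assms step e_span_closed[OF step(2)] e_closed[of \<beta>]
      N.smult_assoc1[of "const c'" "const c" "e \<beta>"]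
    by (auto simp: N.smult_r_distr mult_single)
  then show ?case using step by (simp add: e_span.step)
qed

lemma e_span_mvar:
  assumes "z \<in> e_span A" "A \<subseteq> D" and v: "v \<in> xy_vars m n"
  shows "mvar v \<odot>\<^bsub>N\<^esub> z \<in> e_span {\<beta> - single v 1 | \<beta>. \<beta> \<in> A \<and> lookup \<beta> v \<noteq> 0}"
    (is "_ \<in> e_span ?A")
  using assms(1)
proof (induction rule: e_span.induct)
  case zero
  then show ?case using v by (simp add: e_span.zero)
next
  case (step \<beta> z c)
  have b: "\<beta> \<in> D" "e \<beta> \<in> carrier N" "z \<in> carrier N"
    using step assms(2) e_closed e_span_closed by auto
  have "mvar v \<odot>\<^bsub>N\<^esub> (const c \<odot>\<^bsub>N\<^esub> e \<beta>) = const c \<odot>\<^bsub>N\<^esub> (mvar v \<odot>\<^bsub>N\<^esub> e \<beta>)"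
    using b v N.smult_assoc1[of "mvar v" "const c" "e \<beta>"] N.smult_assoc1[of "const c" "mvar v" "e \<beta>"]
    by (simp add: mult.commute)
  then have eq: "mvar v \<odot>\<^bsub>N\<^esub> (const c \<odot>\<^bsub>N\<^esub> e \<beta> \<oplus>\<^bsub>N\<^esub> z) =
      const c \<odot>\<^bsub>N\<^esub> (mvar v \<odot>\<^bsub>N\<^esub> e \<beta>) \<oplus>\<^bsub>N\<^esub> mvar v \<odot>\<^bsub>N\<^esub> z"
    using b v by (simp add: N.smult_r_distr)
  have vz: "mvar v \<odot>\<^bsub>N\<^esub> z \<in> carrier N" using b v by simp
  show ?case
  proof (cases "lookup \<beta> v = 0")
    case True
    then show ?thesis using eq contraction[OF b(1) v] step.IH vz by simp
  next
    case False
    then have "\<beta> - single v 1 \<in> ?A" using step(1) by blast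
    then show ?thesis unfolding eq contraction[OF b(1) v] using False step.IH by (simp add: e_span.step)
  qed
qed

lemma e_span_insert:
  assumes "z \<in> e_span (insert \<alpha> A)" "insert \<alpha> A \<subseteq> D"
  shows "\<exists>c s. s \<in> e_span A \<and> z = const c \<odot>\<^bsub>N\<^esub> e \<alpha> \<oplus>\<^bsub>N\<^esub> s"
  using assms(1)
proof (induction rule: e_span.induct)
  case zero
  have "\<zero>\<^bsub>N\<^esub> = const 0 \<odot>\<^bsub>N\<^esub> e \<alpha> \<oplus>\<^bsub>N\<^esub> \<zero>\<^bsub>N\<^esub>"
    using e_closed[of \<alpha>] assms(2) N.smult_l_null[of "e \<alpha>"] by simp
  then show ?case using e_span.zero by blast
next
  case (step \<beta> z c)
  then obtain c' s where s: "s \<in> e_span A" "z = const c' \<odot>\<^bsub>N\<^esub> e \<alpha> \<oplus>\<^bsub>N\<^esub> s" by blast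
  have cl: "s \<in> carrier N" "e \<alpha> \<in> carrier N" "e \<beta> \<in> carrier N"
    using s e_span_closed assms(2) e_closed step by auto
  show ?case
  proof (cases "\<beta> = \<alpha>")
    case True
    have "const c \<odot>\<^bsub>N\<^esub> e \<beta> \<oplus>\<^bsub>N\<^esub> z = (const c \<odot>\<^bsub>N\<^esub> e \<alpha> \<oplus>\<^bsub>N\<^esub> const c' \<odot>\<^bsub>N\<^esub> e \<alpha>) \<oplus>\<^bsub>N\<^esub> s"
      using cl True unfolding s(2) by (simp add: N.M.a_assoc)
    also have "\<dots> = const (c + c') \<odot>\<^bsub>N\<^esub> e \<alpha> \<oplus>\<^bsub>N\<^esub> s"
      using cl N.smult_l_distr[of "const c" "const c'" "e \<alpha>"] by (simp add: single_add)
    finally show ?thesis using s(1) by blast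
  next
    case False
    then have "\<beta> \<in> A" using step by auto
    then have "const c \<odot>\<^bsub>N\<^esub> e \<beta> \<oplus>\<^bsub>N\<^esub> s \<in> e_span A" using s(1) by (rule e_span.step)
    moreover have "const c \<odot>\<^bsub>N\<^esub> e \<beta> \<oplus>\<^bsub>N\<^esub> z = const c' \<odot>\<^bsub>N\<^esub> e \<alpha> \<oplus>\<^bsub>N\<^esub> (const c \<odot>\<^bsub>N\<^esub> e \<beta> \<oplus>\<^bsub>N\<^esub> s)"
      using cl unfolding s(2) by (simp add: N.M.a_lcomm)
    ultimately show ?thesis by blast
  qed
qed

abbreviation below :: "(nat + nat \<Rightarrow>\<^sub>0 nat) \<Rightarrow> (nat + nat \<Rightarrow>\<^sub>0 nat) set"
  where "below \<alpha> \<equiv> {\<beta> \<in> D. xy_less m n \<beta> \<alpha>}"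

lemma e_span_bounded:
  assumes "z \<in> e_span A" "A \<subseteq> D"
  shows "z = \<zero>\<^bsub>N\<^esub> \<or> (\<exists>\<alpha>\<in>A. z \<in> e_span (insert \<alpha> (below \<alpha>)))"
  using assms(1)
proof (induction rule: e_span.induct)
  case (step \<beta> z c)
  have b: "\<beta> \<in> D" using step assms(2) by auto
  consider "z = \<zero>\<^bsub>N\<^esub>" | \<alpha> where "\<alpha> \<in> A" "z \<in> e_span (insert \<alpha> (below \<alpha>))" using step.IH by blast
  then show ?case
  proof cases
    case 1
    have "const c \<odot>\<^bsub>N\<^esub> e \<beta> \<oplus>\<^bsub>N\<^esub> z \<in> e_span (insert \<beta> (below \<beta>))"
      unfolding 1 by (intro e_span.step e_span.zero) simp
    then show ?thesis using step by blast
  next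
    case 2
    have a: "\<alpha> \<in> D" using 2 assms(2) by auto
    have "\<exists>\<gamma>\<in>{\<alpha>, \<beta>}. insert \<alpha> (below \<alpha>) \<subseteq> insert \<gamma> (below \<gamma>) \<and> \<beta> \<in> insert \<gamma> (below \<gamma>)"
    proof (cases "\<alpha> = \<beta> \<or> xy_less m n \<beta> \<alpha>")
      case True
      then show ?thesis using b by auto
    next
      case False
      then have "xy_less m n \<alpha> \<beta>"
        using exp_less_total[of \<alpha> "var_list m n" \<beta>] a b D_keys by (auto simp: set_var_list)
      then have "insert \<alpha> (below \<alpha>) \<subseteq> insert \<beta> (below \<beta>)"
        using a exp_less_trans[of "var_list m n" _ \<alpha> \<beta>] by auto
      then show ?thesis by blast
    qed
    then obtain \<gamma> where g: "\<gamma> \<in> {\<alpha>, \<beta>}" "insert \<alpha> (below \<alpha>) \<subseteq> insert \<gamma> (below \<gamma>)"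
      "\<beta> \<in> insert \<gamma> (below \<gamma>)" by blast
    have "const c \<odot>\<^bsub>N\<^esub> e \<beta> \<oplus>\<^bsub>N\<^esub> z \<in> e_span (insert \<gamma> (below \<gamma>))"
      by (rule e_span.step[OF g(3) e_span_mono[OF 2(2) g(2)]])
    then show ?thesis using g(1) 2(1) step(1) by blast
  qed
qed simp

text \<open>
  As the \<open>e \<beta>\<close> may be dependent, an element can have several leading exponents.
\<close>

definition leading :: "'c set \<Rightarrow> (nat + nat \<Rightarrow>\<^sub>0 nat) set"
  where "leading H = {\<alpha> \<in> D. \<exists>s\<in>e_span (below \<alpha>). e \<alpha> \<oplus>\<^bsub>N\<^esub> s \<in> H}"

lemma leading_mono: "H \<subseteq> H' \<Longrightarrow> leading H \<subseteq> leading H'"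
  by (auto simp: leading_def)

text \<open>
  The order is compatible with addition, so lowering the exponent of one variable keeps the leading term
  leading, provided that the variable does not kill it.
\<close>

lemma leading_minus_var:
  assumes H: "submodule H (xy_ring m n) N" and a: "\<alpha> \<in> leading H"
    and v: "v \<in> xy_vars m n" "lookup \<alpha> v \<noteq> 0"
  shows "\<alpha> - single v 1 \<in> leading H"
proof -
  let ?a = "\<alpha> - single v 1"
  obtain s where s: "\<alpha> \<in> D" "s \<in> e_span (below \<alpha>)" "e \<alpha> \<oplus>\<^bsub>N\<^esub> s \<in> H"
    using a by (auto simp: leading_def)
  have sc: "s \<in> carrier N" "e \<alpha> \<in> carrier N" using e_span_closed[OF s(2)] e_closed s by auto
  have "mvar v \<odot>\<^bsub>N\<^esub> (e \<alpha> \<oplus>\<^bsub>N\<^esub> s) \<in> H" using N.submoduleE(4)[OF H _ s(3)] v by simp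
  then have "e ?a \<oplus>\<^bsub>N\<^esub> mvar v \<odot>\<^bsub>N\<^esub> s \<in> H"
    using sc v contraction[OF s(1) v(1)] by (simp add: N.smult_r_distr)
  moreover have "mvar v \<odot>\<^bsub>N\<^esub> s \<in> e_span (below ?a)"
  proof (rule e_span_mono[OF e_span_mvar[OF s(2) _ v(1)]])
    show "{\<beta> - single v 1 |\<beta>. \<beta> \<in> below \<alpha> \<and> lookup \<beta> v \<noteq> 0} \<subseteq> below ?a"
    proof
      fix \<delta> assume "\<delta> \<in> {\<beta> - single v 1 |\<beta>. \<beta> \<in> below \<alpha> \<and> lookup \<beta> v \<noteq> 0}"
      then obtain \<beta> where b: "\<beta> \<in> D" "xy_less m n \<beta> \<alpha>" "lookup \<beta> v \<noteq> 0"
        "\<delta> = \<beta> - single v 1" by blast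
      have split: "\<gamma> = (\<gamma> - single v 1) + single v 1"
        if "lookup \<gamma> v \<noteq> 0" for \<gamma> :: "nat + nat \<Rightarrow>\<^sub>0 nat"
        using exponent_split[of 1 \<gamma> v] that by (simp add: add.commute)
      have "xy_less m n (\<delta> + single v 1) (?a + single v 1)"
        unfolding b(4) using b(2) split[OF b(3)] split[OF v(2)] by argo
      then have "xy_less m n \<delta> ?a" by (simp only: exp_less_add)
      then show "\<delta> \<in> below ?a" using D_down[OF b(1)] b(4) by blast
    qed
  qed auto
  ultimately show ?thesis using D_down[OF s(1)] by (auto simp: leading_def)
qed

lemma leading_down:
  assumes H: "submodule H (xy_ring m n) N" and "\<alpha> + \<gamma> \<in> leading H"
  shows "\<alpha> \<in> leading H"
  using assms(2)
proof (induction "\<Sum>v\<in>xy_vars m n. lookup \<gamma> v" arbitrary: \<gamma> rule: less_induct)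
  case less
  show ?case
  proof (cases "\<gamma> = 0")
    case True
    then show ?thesis using less by simp
  next
    case False
    then obtain v where v: "v \<in> keys \<gamma>" by (metis ex_in_conv keys_eq_empty)
    then have lv: "lookup \<gamma> v \<noteq> 0" by (simp add: in_keys_iff)
    have "\<alpha> + \<gamma> \<in> D" using less by (simp add: leading_def)
    then have vV: "v \<in> xy_vars m n" using D_keys[of "\<alpha> + \<gamma>"] v by (auto simp: keys_add_exponents)
    let ?g = "\<gamma> - single v 1"
    have "\<alpha> + \<gamma> - single v 1 = \<alpha> + ?g"
      by (rule poly_mapping_eqI) (use lv in \<open>auto simp: lookup_add lookup_minus lookup_single when_def\<close>)
    then have "\<alpha> + ?g \<in> leading H" using leading_minus_var[OF H less(2) vV] lv by (simp add: lookup_add)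
    moreover have "(\<Sum>u\<in>xy_vars m n. lookup ?g u) < (\<Sum>u\<in>xy_vars m n. lookup \<gamma> u)"
    proof (rule sum_strict_mono_ex1)
      show "\<exists>u\<in>xy_vars m n. lookup ?g u < lookup \<gamma> u"
        using vV lv by (intro bexI[of _ v]) (auto simp: lookup_minus)
    qed (auto simp: lookup_minus xy_vars_def)
    ultimately show ?thesis using less.hyps by blast
  qed
qed

text \<open>
  Reduction with respect to the well-order: subtract from an element of the larger submodule an element
  of the smaller one with the same leading term. The difference has a smaller leading exponent.
\<close>

lemma submodule_eq_if_leading_eq:
  assumes H: "submodule H (xy_ring m n) N" and H': "submodule H' (xy_ring m n) N"
    and sub: "H \<subseteq> H'" and lead: "leading H' \<subseteq> leading H" and span: "carrier N = e_span D"
  shows "H' \<subseteq> H"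
proof -
  have zero: "\<zero>\<^bsub>N\<^esub> \<in> H" using subgroup.one_closed[OF submodule.axioms(1)[OF H]] by simp
  note HE = N.submoduleE[OF H] and H'E = N.submoduleE[OF H']
  have main: "\<forall>z. z \<in> H' \<longrightarrow> \<alpha> \<in> D \<longrightarrow> z \<in> e_span (insert \<alpha> (below \<alpha>)) \<longrightarrow> z \<in> H" for \<alpha>
  proof (induction \<alpha> rule: wf_induct_rule[OF wf_exp_less[of "var_list m n"]])
    case (1 \<alpha>)
    have low: "s \<in> H" if s: "s \<in> H'" "s \<in> e_span (below \<alpha>)" for s
    proof -
      have "s = \<zero>\<^bsub>N\<^esub> \<or> (\<exists>\<beta>\<in>below \<alpha>. s \<in> e_span (insert \<beta> (below \<beta>)))"
        by (rule e_span_bounded[OF s(2)]) simp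
      then show ?thesis
      proof
        assume "\<exists>\<beta>\<in>below \<alpha>. s \<in> e_span (insert \<beta> (below \<beta>))"
        then obtain \<beta> where b: "\<beta> \<in> below \<alpha>" "s \<in> e_span (insert \<beta> (below \<beta>))" ..
        then have "(\<beta>, \<alpha>) \<in> {(\<alpha>, \<beta>). xy_less m n \<alpha> \<beta>}" by simp
        from 1[OF this] show ?thesis using s(1) b by simp
      qed (simp add: zero)
    qed
    show ?case
    proof (intro allI impI)
      fix z assume z: "z \<in> H'" "\<alpha> \<in> D" "z \<in> e_span (insert \<alpha> (below \<alpha>))"
      obtain c s where s: "s \<in> e_span (below \<alpha>)" "z = const c \<odot>\<^bsub>N\<^esub> e \<alpha> \<oplus>\<^bsub>N\<^esub> s"
        using e_span_insert[OF z(3)] z(2) by auto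
      have cl: "s \<in> carrier N" "e \<alpha> \<in> carrier N" using e_span_closed[OF s(1)] e_closed z by auto
      show "z \<in> H"
      proof (cases "c = 0")
        case True
        then have "z = s" using s cl N.smult_l_null[of "e \<alpha>"] by simp
        then show ?thesis using low z(1) s(1) by simp
      next
        case False
        have scale: "const d \<odot>\<^bsub>N\<^esub> (const c \<odot>\<^bsub>N\<^esub> e \<alpha>) = const (d * c) \<odot>\<^bsub>N\<^esub> e \<alpha>" for c d
          using cl N.smult_assoc1[of "const d" "const c" "e \<alpha>"] by (simp add: mult_single)
        have "const (inverse c) \<odot>\<^bsub>N\<^esub> z \<in> H'" using H'E(4) z(1) by simp
        moreover have "const (inverse c) \<odot>\<^bsub>N\<^esub> z = e \<alpha> \<oplus>\<^bsub>N\<^esub> const (inverse c) \<odot>\<^bsub>N\<^esub> s"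
          unfolding s(2) using cl False by (simp add: N.smult_r_distr scale N.smult_one[simplified])
        ultimately have "\<alpha> \<in> leading H'" using e_span_const[OF s(1)] z(2) by (auto simp: leading_def)
        then obtain t where t: "t \<in> e_span (below \<alpha>)" "e \<alpha> \<oplus>\<^bsub>N\<^esub> t \<in> H"
          using lead by (auto simp: leading_def)
        have tc: "t \<in> carrier N" using e_span_closed[OF t(1)] by auto
        let ?h = "const c \<odot>\<^bsub>N\<^esub> (e \<alpha> \<oplus>\<^bsub>N\<^esub> t)"
        have h: "?h \<in> H" using HE(4) t(2) by simp
        have hc: "?h \<in> carrier N" using h HE(1) by auto
        have mt: "const (- c) \<odot>\<^bsub>N\<^esub> t = \<ominus>\<^bsub>N\<^esub> (const c \<odot>\<^bsub>N\<^esub> t)"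
          using N.smult_l_minus[of "const c" t] tc const_mem[of c] by (simp add: single_uminus)
        have "s \<oplus>\<^bsub>N\<^esub> const (- c) \<odot>\<^bsub>N\<^esub> t \<in> e_span (below \<alpha>)"
          using s(1) t(1) by (intro e_span_add e_span_const) auto
        moreover have eq: "z \<oplus>\<^bsub>N\<^esub> \<ominus>\<^bsub>N\<^esub> ?h = s \<oplus>\<^bsub>N\<^esub> const (- c) \<odot>\<^bsub>N\<^esub> t"
          unfolding s(2) mt using cl tc
          by (simp add: N.smult_r_distr N.M.minus_add N.M.a_ac N.M.r_neg1 N.M.r_neg2 N.M.r_neg)
        moreover have "z \<oplus>\<^bsub>N\<^esub> \<ominus>\<^bsub>N\<^esub> ?h \<in> H'" using z(1) h sub H'E(3,5) by auto
        ultimately have "z \<oplus>\<^bsub>N\<^esub> \<ominus>\<^bsub>N\<^esub> ?h \<in> H" using low by simp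
        then have "z \<oplus>\<^bsub>N\<^esub> \<ominus>\<^bsub>N\<^esub> ?h \<oplus>\<^bsub>N\<^esub> ?h \<in> H" using h HE(5) by simp
        moreover have "z \<in> carrier N" using z(1) H'E(1) by auto
        ultimately show ?thesis using hc by (simp add: N.M.a_assoc N.M.l_neg)
      qed
    qed
  qed
  show ?thesis
  proof
    fix z assume z: "z \<in> H'"
    then have "z \<in> e_span D" using span H'E(1) by auto
    then have "z = \<zero>\<^bsub>N\<^esub> \<or> (\<exists>\<alpha>\<in>D. z \<in> e_span (insert \<alpha> (below \<alpha>)))"
      by (rule e_span_bounded) simp
    then show "z \<in> H"
    proof
      assume "\<exists>\<alpha>\<in>D. z \<in> e_span (insert \<alpha> (below \<alpha>))"
      then obtain \<alpha> where "\<alpha> \<in> D" "z \<in> e_span (insert \<alpha> (below \<alpha>))" ..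
      then show ?thesis using main z by simp
    qed (simp add: zero)
  qed
qed

theorem artinian_if_spanned:
  assumes span: "carrier N = e_span D"
  shows "artinian_module (xy_ring m n) N"
  unfolding artinian_module_def
proof (intro conjI allI impI N_module)
  fix H assume H: "(\<forall>i. submodule (H i) (xy_ring m n) N) \<and> (\<forall>i. H (Suc i) \<subseteq> H i)"
  have anti: "k \<le> i \<Longrightarrow> H i \<subseteq> H k" for i k using lift_Suc_antimono_le[of H] H by blast
  have "\<exists>k. \<forall>i\<ge>k. leading (H i) = leading (H k)"
  proof (rule downsets_descending_chain)
    show "finite (xy_vars m n)" by (simp add: xy_vars_def)
    show "keys \<alpha> \<subseteq> xy_vars m n" if "\<alpha> \<in> leading (H i)" for i \<alpha>
      using that D_keys by (auto simp: leading_def)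
    show "leading (H (Suc i)) \<subseteq> leading (H i)" for i using H leading_mono by blast
    show "\<alpha> \<in> leading (H i)" if "\<alpha> + \<gamma> \<in> leading (H i)" for i \<alpha> \<gamma> using leading_down H that by blast
  qed
  then obtain k where k: "\<And>i. i \<ge> k \<Longrightarrow> leading (H i) = leading (H k)" by blast
  have "H i = H k" if "i \<ge> k" for i
    using submodule_eq_if_leading_eq[of "H i" "H k"] H anti[OF that] k[OF that] span by blast
  then show "\<exists>k. \<forall>i\<ge>k. H i = H k" by blast
qed

end

section \<open>At most one x variable\<close>

context fraction_presentation
begin

interpretation N: Module.module "xy_ring m n" N by (rule N_module)

lemma phi_zero: "\<phi> T 0 = \<zero>\<^bsub>N\<^esub>"
proof -
  have "y_monomial n 0 * 0 - f * 0 \<in> y_multiples (T + 0) n" by (simp add: y_multiples_closed)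
  then show ?thesis using phi_eq_zero_iff[of 0 T] xy_ring_0_1(1) by blast
qed

lemma y_monomial_0: "y_monomial n 0 = (1 :: 'k bipoly)"
  by (simp add: y_monomial_def y_exponent_def)

lemma phi_y_multiples:
  assumes "p \<in> carrier (xy_ring m n)" "p \<in> y_multiples T n" shows "\<phi> T p = \<zero>\<^bsub>N\<^esub>"
proof -
  have "y_monomial n 0 * p - f * 0 \<in> y_multiples (T + 0) n" using assms by (simp add: y_monomial_0)
  then show ?thesis using phi_eq_zero_iff[OF assms(1), of T] xy_ring_0_1(1) by blast
qed

lemma phi_f_multiple:
  assumes "h \<in> carrier (xy_ring m n)" shows "\<phi> T (f * h) = \<zero>\<^bsub>N\<^esub>"
proof -
  have "y_monomial n 0 * (f * h) - f * h \<in> y_multiples (T + 0) n"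
    by (simp add: y_monomial_0 y_multiples_closed)
  then show ?thesis using phi_eq_zero_iff[of "f * h" T] assms f_mem xy_ring_closed(2) by blast
qed

lemma phi_shift_monomial:
  assumes "keys \<gamma> \<subseteq> xy_vars m n"
  shows "\<phi> (T + t) (single (y_exponent n t + \<gamma>) c) = \<phi> T (single \<gamma> c)"
  using phi_shift[of "single \<gamma> c" T t] assms by (simp add: y_monomial_def mult_single)

lemma phi_y_monomial_zero:
  assumes "keys \<gamma> \<subseteq> xy_vars m n" "j < n" "T \<le> lookup \<gamma> (Inr j)"
  shows "\<phi> T (single \<gamma> c) = \<zero>\<^bsub>N\<^esub>"
  using assms by (intro phi_y_multiples) (auto simp: y_multiples_def)

end

locale principal_fractions = fraction_presentation m n f N \<phi>
  for m n :: nat and f :: "'k::field bipoly" and N :: "('k bipoly, 'c, 'z) module_scheme"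
    and \<phi> :: "nat \<Rightarrow> 'k bipoly \<Rightarrow> 'c" +
  fixes a :: nat
  assumes m_le_1: "m \<le> 1" and f_nonzero: "f \<noteq> 0"
    and x_degree: "\<alpha> \<in> keys f \<Longrightarrow> lookup \<alpha> (Inl 0) = a"
begin

interpretation N: Module.module "xy_ring m n" N by (rule N_module)

lemma xy_vars_cases:
  assumes "v \<in> xy_vars m n"
  obtains "v = Inl 0" "m = 1" | j where "j < n" "v = Inr j"
  using assms m_le_1 by (auto simp: xy_vars_def)

lemma exponent_eqI:
  fixes \<alpha> \<beta> :: "nat + nat \<Rightarrow>\<^sub>0 nat"
  assumes "keys \<alpha> \<subseteq> xy_vars m n" "keys \<beta> \<subseteq> xy_vars m n"
    and "lookup \<alpha> (Inl 0) = lookup \<beta> (Inl 0)"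
    and "\<And>j. j < n \<Longrightarrow> lookup \<alpha> (Inr j) = lookup \<beta> (Inr j)"
  shows "\<alpha> = \<beta>"
proof (rule poly_mapping_eqI)
  fix v show "lookup \<alpha> v = lookup \<beta> v"
  proof (cases "v \<in> xy_vars m n")
    case True
    then show ?thesis using assms(3,4) by (cases rule: xy_vars_cases) auto
  next
    case False
    then have "v \<notin> keys \<alpha>" "v \<notin> keys \<beta>" using assms(1,2) by auto
    then show ?thesis by (simp add: in_keys_iff)
  qed
qed

lemma keys_f: "\<alpha> \<in> keys f \<Longrightarrow> keys \<alpha> \<subseteq> xy_vars m n"
  using f_mem by (simp add: mem_xy_ring_iff)

text \<open>
  In effect, the cofactor \<open>g\<close> in \<open>f = x\<^sup>a g\<close> acts surjectively on inverse polynomials. Let \<open>\<delta>\<^sub>0\<close> be the smallest exponent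
  of \<open>f\<close>. A suitable monomial multiple of \<open>f\<close> contains a multiple of the given monomial as the term of
  \<open>\<delta>\<^sub>0\<close>; its other terms have larger exponents, that is smaller poles, and vanish by induction over
  the pole exponents \<open>\<beta>\<close>.
\<close>

lemma x_power_kills:
  assumes "keys \<gamma> \<subseteq> xy_vars m n" "a \<le> lookup \<gamma> (Inl 0)"
  shows "\<phi> T (single \<gamma> c) = \<zero>\<^bsub>N\<^esub>"
proof -
  have ne: "keys f \<noteq> {}" using f_nonzero by simp
  obtain \<delta>0 where d0: "\<delta>0 \<in> keys f" "\<And>\<delta>. xy_less m n \<delta> \<delta>0 \<Longrightarrow> \<delta> \<notin> keys f"
    using wfE_min[OF wf_exp_less[of "var_list m n"], of _ "keys f"] ne by (metis (mono_tags, lifting) case_prodI ex_in_conv mem_Collect_eq)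
  define c0 where "c0 = lookup f \<delta>0"
  have c0: "c0 \<noteq> 0" using d0(1) by (simp add: c0_def in_keys_iff)
  define f' where "f' = f - single \<delta>0 c0"
  have keys_f': "keys f' = keys f - {\<delta>0}"
    by (auto simp: f'_def c0_def in_keys_iff lookup_minus lookup_single when_def split: if_splits)
  \<comment> \<open>Shifting the fraction by \<open>s\<close> makes the numerator divisible by the monomial of \<open>\<delta>\<^sub>0\<close>.\<close>
  define s where "s = (\<Sum>j<n. lookup \<delta>0 (Inr j))"
  have s: "lookup \<delta>0 (Inr j) \<le> s" if "j < n" for j
    unfolding s_def using that by (intro member_le_sum) auto
  have main: "\<forall>T \<gamma> c. keys \<gamma> \<subseteq> xy_vars m n \<longrightarrow> a \<le> lookup \<gamma> (Inl 0) \<longrightarrow>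
      (\<forall>j<n. lookup \<gamma> (Inr j) \<le> T) \<longrightarrow> \<beta> = y_exponent n T - \<gamma> \<longrightarrow>
      \<phi> (Suc T) (single \<gamma> c) = \<zero>\<^bsub>N\<^esub>" for \<beta>
  proof (induction \<beta> rule: wf_induct_rule[OF wf_exp_less[of "var_list m n"]])
    case (1 \<beta>)
    note IH = 1
    show ?case
    proof (intro allI impI)
      fix T \<gamma> and c :: 'k
      assume g: "keys \<gamma> \<subseteq> xy_vars m n" "a \<le> lookup \<gamma> (Inl 0)"
        and gT: "\<forall>j<n. lookup \<gamma> (Inr j) \<le> T" and b: "\<beta> = y_exponent n T - \<gamma>"
      define \<mu> where "\<mu> = y_exponent n s + \<gamma> - \<delta>0"
      have mu_keys: "keys \<mu> \<subseteq> xy_vars m n"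
      proof (rule subset_trans)
        show "keys \<mu> \<subseteq> keys (y_exponent n s + \<gamma>)"
          unfolding \<mu>_def by (rule keys_exponent_minus)
        show "keys (y_exponent n s + \<gamma>) \<subseteq> xy_vars m n"
          using y_exponent_vars[of n s m] g(1) by (simp add: keys_add_exponents)
      qed
      have mu: "\<delta>0 + \<mu> = y_exponent n s + \<gamma>"
      proof (rule exponent_eqI)
        show "lookup (\<delta>0 + \<mu>) (Inl 0) = lookup (y_exponent n s + \<gamma>) (Inl 0)"
          using x_degree[OF d0(1)] g(2) by (simp add: \<mu>_def lookup_add lookup_minus lookup_y_exponent)
        show "lookup (\<delta>0 + \<mu>) (Inr j) = lookup (y_exponent n s + \<gamma>) (Inr j)"
          if "j < n" for j
          using s[OF that] that by (simp add: \<mu>_def lookup_add lookup_minus lookup_y_exponent)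
      qed (use keys_f[OF d0(1)] mu_keys g(1) y_exponent_vars[of n s m] in \<open>simp_all add: keys_add_exponents\<close>)
      have other: "\<phi> (Suc (T + s)) (single (\<delta> + \<mu>) c') = \<zero>\<^bsub>N\<^esub>"
        if d: "\<delta> \<in> keys f'" for \<delta> c'
      proof -
        have dk: "keys (\<delta> + \<mu>) \<subseteq> xy_vars m n"
          using d keys_f[of \<delta>] mu_keys by (auto simp: keys_add_exponents keys_f')
        have dx: "lookup \<delta> (Inl 0) = a" using x_degree[of \<delta>] d by (simp add: keys_f')
        show ?thesis
        proof (cases "\<forall>j<n. lookup (\<delta> + \<mu>) (Inr j) \<le> T + s")
          case False
          then obtain j where "j < n" "Suc (T + s) \<le> lookup (\<delta> + \<mu>) (Inr j)" by (auto simp: not_le)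
          then show ?thesis using dk by (intro phi_y_monomial_zero)
        next
          case True
          define \<beta>' where "\<beta>' = y_exponent n (T + s) - (\<delta> + \<mu>)"
          \<comment> \<open>This relation turns \<open>\<delta>\<^sub>0 < \<delta>\<close> into \<open>\<beta>' < \<beta>\<close>.\<close>
          have eq: "\<beta>' + \<delta> = \<beta> + \<delta>0"
          proof (rule exponent_eqI)
            show "keys (\<beta>' + \<delta>) \<subseteq> xy_vars m n" "keys (\<beta> + \<delta>0) \<subseteq> xy_vars m n"
              using keys_f[OF d0(1)] keys_f[of \<delta>] d y_exponent_vars[of n _ m]
                keys_exponent_minus[of "y_exponent n (T + s)" "\<delta> + \<mu>"] keys_exponent_minus[of "y_exponent n T" \<gamma>]
              unfolding keys_add_exponents keys_f' \<beta>'_def b by blast+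
            show "lookup (\<beta>' + \<delta>) (Inl 0) = lookup (\<beta> + \<delta>0) (Inl 0)"
              using x_degree[OF d0(1)] dx by (simp add: \<beta>'_def b lookup_add lookup_minus lookup_y_exponent)
            fix j assume j: "j < n"
            have "lookup (\<delta>0 + \<mu>) (Inr j) = lookup (y_exponent n s + \<gamma>) (Inr j)" using mu by simp
            then show "lookup (\<beta>' + \<delta>) (Inr j) = lookup (\<beta> + \<delta>0) (Inr j)"
              using j True[rule_format, OF j] gT[rule_format, OF j] s[OF j]
              by (simp add: \<beta>'_def b lookup_add lookup_minus lookup_y_exponent)
          qed
          have "xy_less m n \<delta>0 \<delta>"
            using exp_less_total[of \<delta>0 "var_list m n" \<delta>] keys_f[of \<delta>] keys_f[OF d0(1)] d d0(2)[of \<delta>]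
            by (auto simp: set_var_list keys_f')
          then have "xy_less m n (\<delta>0 + \<beta>') (\<delta> + \<beta>')" by (simp only: exp_less_add)
          then have "xy_less m n (\<beta>' + \<delta>0) (\<beta> + \<delta>0)" using eq by (simp add: add.commute)
          then have "xy_less m n \<beta>' \<beta>" by (simp only: exp_less_add)
          then have "(\<beta>', \<beta>) \<in> {(\<alpha>, \<beta>). xy_less m n \<alpha> \<beta>}" by simp
          from IH[OF this] dk True dx show ?thesis by (simp add: \<beta>'_def lookup_add)
        qed
      qed
      have rest: "\<phi> (Suc (T + s)) (p * single \<mu> c') = \<zero>\<^bsub>N\<^esub>"
        if "keys p \<subseteq> keys f'" for p c'
        using that
      proof (induction rule: mpoly_induct)
        case (add p q)
        have "p \<in> carrier (xy_ring m n)" "q \<in> carrier (xy_ring m n)"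
          using add(1,2) keys_f by (auto simp: mem_xy_ring_iff keys_f' subset_iff)
        then have "p * single \<mu> c' \<in> carrier (xy_ring m n)" "q * single \<mu> c' \<in> carrier (xy_ring m n)"
          using mu_keys by simp_all
        then show ?case using add by (simp add: distrib_right phi_add)
      qed (auto simp: phi_zero mult_single other)
      let ?c = "c / c0"
      have mem: "f' * single \<mu> ?c \<in> carrier (xy_ring m n)"
        "single (\<delta>0 + \<mu>) c \<in> carrier (xy_ring m n)"
        using mu_keys f_mem keys_f[OF d0(1)] by (simp_all add: f'_def keys_add_exponents)
      have "(single \<delta>0 c0 + f') * single \<mu> ?c =
          single (\<delta>0 + \<mu>) c + f' * single \<mu> ?c"
        using c0 by (simp add: distrib_right mult_single)
      then have "f * single \<mu> ?c = single (\<delta>0 + \<mu>) c + f' * single \<mu> ?c"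
        by (simp add: f'_def)
      then have "\<phi> (Suc (T + s)) (single (\<delta>0 + \<mu>) c) = \<zero>\<^bsub>N\<^esub>"
        using phi_f_multiple[of "single \<mu> ?c" "Suc (T + s)"] mu_keys mem rest[of f' ?c]
          phi_add[OF mem(2,1), of "Suc (T + s)"] phi_closed[OF mem(2)] by simp
      then show "\<phi> (Suc T) (single \<gamma> c) = \<zero>\<^bsub>N\<^esub>"
        using phi_shift_monomial[OF g(1), of "Suc T" s c] mu by simp
    qed
  qed
  let ?g = "y_exponent n 1 + \<gamma>"
  have g: "keys ?g \<subseteq> xy_vars m n"
    using assms(1) y_exponent_vars[of n 1 m] by (simp add: keys_add_exponents)
  have "\<phi> (Suc T) (single ?g c) = \<zero>\<^bsub>N\<^esub>"
  proof (cases "\<forall>j<n. lookup ?g (Inr j) \<le> T")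
    case True
    then show ?thesis using main[rule_format, OF g _ _ refl] assms(2) by (simp add: lookup_add)
  next
    case False
    then obtain j where "j < n" "Suc T \<le> lookup ?g (Inr j)" by (auto simp: not_le)
    then show ?thesis by (rule phi_y_monomial_zero[OF g])
  qed
  then show ?thesis using phi_shift_monomial[OF assms(1), of T 1 c] by simp
qed

text \<open>
  The exponent from which \<open>\<beta>\<close> is subtracted to turn the inverse monomial with exponent \<open>- \<beta>\<close> into a
  numerator over \<open>(y\<^sub>1 \<cdots> y\<^sub>n)\<^sup>T\<^sup>+\<^sup>1\<close>. Counting the exponent of \<open>x\<close> downwards from \<open>a\<close>, where \<open>x\<^sup>a\<close> is already zero,
  makes \<open>x\<close> behave like the other variables.
\<close>

definition top_exponent :: "nat \<Rightarrow> (nat + nat \<Rightarrow>\<^sub>0 nat)"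
  where "top_exponent T = single (Inl 0) a + y_exponent n T"

lemma lookup_top_exponent:
  "lookup (top_exponent T) (Inl 0) = a"
  "j < n \<Longrightarrow> lookup (top_exponent T) (Inr j) = T"
  by (simp_all add: top_exponent_def lookup_add lookup_y_exponent lookup_single)

lemma x_degree_zero_if_no_x: "m = 0 \<Longrightarrow> a = 0"
proof -
  assume m: "m = 0"
  obtain \<alpha> where a: "\<alpha> \<in> keys f" using f_nonzero by (metis ex_in_conv keys_eq_empty)
  then have "Inl 0 \<notin> keys \<alpha>" using keys_f[OF a] m by (auto simp: xy_vars_def)
  then show "a = 0" using x_degree[OF a] by (simp add: in_keys_iff)
qed

lemma keys_top_exponent: "keys (top_exponent T) \<subseteq> xy_vars m n"
proof (cases "m = 0")
  case True
  then show ?thesis unfolding top_exponent_def using x_degree_zero_if_no_x y_exponent_vars[of n T m] by simp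
next
  case False
  then show ?thesis using y_exponent_vars[of n T m]
    by (auto simp: top_exponent_def keys_add_exponents xy_vars_def split: if_splits)
qed

lemma keys_top_minus: "keys (top_exponent T - \<beta>) \<subseteq> xy_vars m n"
  by (rule subset_trans[OF keys_exponent_minus keys_top_exponent])

definition box :: "(nat + nat \<Rightarrow>\<^sub>0 nat) set"
  where "box = {\<beta>. keys \<beta> \<subseteq> xy_vars m n \<and> lookup \<beta> (Inl 0) \<le> a}"

definition y_size :: "(nat + nat \<Rightarrow>\<^sub>0 nat) \<Rightarrow> nat"
  where "y_size \<beta> = (\<Sum>j<n. lookup \<beta> (Inr j))"

definition inv_monomial :: "(nat + nat \<Rightarrow>\<^sub>0 nat) \<Rightarrow> 'c"
  where "inv_monomial \<beta> = \<phi> (Suc (y_size \<beta>)) (single (top_exponent (y_size \<beta>) - \<beta>) 1)"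

lemma lookup_le_y_size: "j < n \<Longrightarrow> lookup \<beta> (Inr j) \<le> y_size \<beta>"
  unfolding y_size_def by (rule member_le_sum) auto

text \<open>
  The denominator in the definition is only a convenient choice; any sufficiently large one may be used.
\<close>

lemma inv_monomial_eq:
  assumes b: "\<beta> \<in> box" and T: "\<And>j. j < n \<Longrightarrow> lookup \<beta> (Inr j) \<le> T"
  shows "inv_monomial \<beta> = \<phi> (Suc T) (single (top_exponent T - \<beta>) 1)"
proof -
  have shift: "\<phi> (Suc T) (single (top_exponent T - \<beta>) 1) =
      \<phi> (Suc (T + t)) (single (top_exponent (T + t) - \<beta>) 1)"
    if "\<And>j. j < n \<Longrightarrow> lookup \<beta> (Inr j) \<le> T" for T t
  proof -
    have "y_exponent n t + (top_exponent T - \<beta>) = top_exponent (T + t) - \<beta>"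
    proof (rule exponent_eqI)
      show "keys (y_exponent n t + (top_exponent T - \<beta>)) \<subseteq> xy_vars m n"
        using keys_top_minus[of T \<beta>] y_exponent_vars[of n t m] by (simp add: keys_add_exponents)
      show "keys (top_exponent (T + t) - \<beta>) \<subseteq> xy_vars m n" by (rule keys_top_minus)
      fix j assume j: "j < n"
      show "lookup (y_exponent n t + (top_exponent T - \<beta>)) (Inr j) =
          lookup (top_exponent (T + t) - \<beta>) (Inr j)"
        using that[OF j] j by (simp add: lookup_add lookup_minus lookup_top_exponent lookup_y_exponent)
    qed (simp add: lookup_add lookup_minus lookup_top_exponent lookup_y_exponent)
    then show ?thesis using phi_shift_monomial[OF keys_top_minus[of T \<beta>], of "Suc T" t 1] by simp
  qed
  show ?thesis
    using shift[OF T, of "y_size \<beta>"] shift[OF lookup_le_y_size, of T]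
    by (simp add: inv_monomial_def add.commute)
qed

sublocale inverse_monomials m n N box inv_monomial
proof
  show "keys \<beta> \<subseteq> xy_vars m n" if "\<beta> \<in> box" for \<beta> using that by (simp add: box_def)
  show "\<beta> - \<gamma> \<in> box" if "\<beta> \<in> box" for \<beta> \<gamma>
    using that keys_exponent_minus[of \<beta> \<gamma>] by (auto simp: box_def lookup_minus)
  show "inv_monomial \<beta> \<in> carrier N" for \<beta>
    unfolding inv_monomial_def by (intro phi_closed single_mem_xy_ring keys_top_minus)
  fix \<beta> v assume b: "\<beta> \<in> box" and v: "v \<in> xy_vars m n"
  let ?T = "y_size \<beta>"
  have vm: "(mvar v :: 'k bipoly) \<in> carrier (xy_ring m n)"
    unfolding mvar_def by (rule single_mem_xy_ring) (use v in simp)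
  have keys: "keys (single v 1 + (top_exponent ?T - \<beta>)) \<subseteq> xy_vars m n"
    using keys_top_minus[of ?T \<beta>] v by (simp add: keys_add_exponents)
  have eq: "mvar v \<odot>\<^bsub>N\<^esub> inv_monomial \<beta> =
      \<phi> (Suc ?T) (single (single v 1 + (top_exponent ?T - \<beta>)) 1)"
    using phi_smult[OF _ vm, of "single (top_exponent ?T - \<beta>) 1" "Suc ?T"] keys_top_minus
    by (simp add: inv_monomial_def mvar_def mult_single)
  show "mvar v \<odot>\<^bsub>N\<^esub> inv_monomial \<beta> =
      (if lookup \<beta> v = 0 then \<zero>\<^bsub>N\<^esub> else inv_monomial (\<beta> - single v 1))"
  proof (cases "lookup \<beta> v = 0")
    case True
    from v have "\<phi> (Suc ?T) (single (single v 1 + (top_exponent ?T - \<beta>)) 1) = \<zero>\<^bsub>N\<^esub>"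
    proof (cases rule: xy_vars_cases)
      case 1
      then show ?thesis using True keys
        by (intro x_power_kills) (simp_all add: lookup_add lookup_minus lookup_top_exponent)
    next
      case (2 j)
      then show ?thesis using True keys
        by (intro phi_y_monomial_zero[of _ j]) (simp_all add: lookup_add lookup_minus lookup_top_exponent)
    qed
    then show ?thesis using True eq by simp
  next
    case False
    have "single v 1 + (top_exponent ?T - \<beta>) = top_exponent ?T - (\<beta> - single v 1)"
    proof (rule exponent_eqI[OF keys keys_top_minus])
      show "lookup (single v 1 + (top_exponent ?T - \<beta>)) (Inl 0) =
          lookup (top_exponent ?T - (\<beta> - single v 1)) (Inl 0)"
        using False b by (auto simp: lookup_add lookup_minus lookup_top_exponent lookup_single when_def box_def)
      fix j assume j: "j < n"
      show "lookup (single v 1 + (top_exponent ?T - \<beta>)) (Inr j) =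
          lookup (top_exponent ?T - (\<beta> - single v 1)) (Inr j)"
        using False j lookup_le_y_size[OF j, of \<beta>]
        by (auto simp: lookup_add lookup_minus lookup_top_exponent lookup_single when_def)
    qed
    moreover have "\<beta> - single v 1 \<in> box"
      using b keys_exponent_minus[of \<beta> "single v 1"] by (auto simp: box_def lookup_minus)
    moreover have "lookup (\<beta> - single v 1) (Inr j) \<le> ?T" if "j < n" for j
      using lookup_le_y_size[OF that, of \<beta>] by (simp add: lookup_minus)
    ultimately show ?thesis using eq False inv_monomial_eq[of "\<beta> - single v 1" ?T] by simp
  qed
qed

text \<open>
  Monomials with too large an exponent represent zero; every other monomial is one of the inverse monomials.
\<close>

lemma carrier_eq_span: "carrier N = e_span box"
proof
  show "e_span box \<subseteq> carrier N" using e_span_closed by auto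
  show "carrier N \<subseteq> e_span box"
  proof
    fix z assume "z \<in> carrier N"
    then obtain T r where r: "r \<in> carrier (xy_ring m n)" "z = \<phi> T r" using phi_surj by blast
    let ?r = "y_monomial n 1 * r"
    have z: "z = \<phi> (Suc T) ?r" using phi_shift[OF r(1), of T 1] r(2) by simp
    have "?r \<in> carrier (xy_ring m n)" using r(1) by simp
    then have "keys ?r \<subseteq> {\<gamma>. keys \<gamma> \<subseteq> xy_vars m n}" by (auto simp: mem_xy_ring_iff)
    then have "\<phi> (Suc T) ?r \<in> e_span box"
    proof (induction rule: mpoly_induct)
      case zero
      then show ?case by (simp add: phi_zero e_span.zero)
    next
      case (monomial \<gamma> c)
      then have g: "keys \<gamma> \<subseteq> xy_vars m n" by simp
      consider "a \<le> lookup \<gamma> (Inl 0)" | j where "j < n" "Suc T \<le> lookup \<gamma> (Inr j)"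
        | "lookup \<gamma> (Inl 0) < a" "\<And>j. j < n \<Longrightarrow> lookup \<gamma> (Inr j) \<le> T"
        by (metis not_less_eq_eq not_le)
      then show ?case
      proof cases
        case 1
        then show ?thesis using x_power_kills[OF g] by (simp add: e_span.zero)
      next
        case 2
        then show ?thesis using phi_y_monomial_zero[OF g 2] by (simp add: e_span.zero)
      next
        case 3
        let ?b = "top_exponent T - \<gamma>"
        have b: "?b \<in> box" using keys_top_minus by (simp add: box_def lookup_minus lookup_top_exponent)
        have "top_exponent T - ?b = \<gamma>"
          by (rule exponent_eqI[OF keys_top_minus g]) (use 3 in \<open>simp_all add: lookup_minus lookup_top_exponent\<close>)
        moreover have "lookup ?b (Inr j) \<le> T" if "j < n" for j
          using that by (simp add: lookup_minus lookup_top_exponent)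
        ultimately have "inv_monomial ?b = \<phi> (Suc T) (single \<gamma> 1)"
          using inv_monomial_eq[OF b, of T] by simp
        moreover have "\<phi> (Suc T) (const c * single \<gamma> 1) = const c \<odot>\<^bsub>N\<^esub> \<phi> (Suc T) (single \<gamma> 1)"
          using g by (intro phi_smult) simp_all
        ultimately have "\<phi> (Suc T) (single \<gamma> c) = const c \<odot>\<^bsub>N\<^esub> inv_monomial ?b \<oplus>\<^bsub>N\<^esub> \<zero>\<^bsub>N\<^esub>"
          using e_closed[OF b] by (simp add: mult_single)
        then show ?thesis using e_span.step[OF b e_span.zero] by simp
      qed
    next
      case (add p q)
      then have "p \<in> carrier (xy_ring m n)" "q \<in> carrier (xy_ring m n)" by (auto simp: mem_xy_ring_iff)
      then show ?case using e_span_add[OF add(3,4)] by (simp add: phi_add)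
    qed
    then show "z \<in> e_span box" using z by simp
  qed
qed

theorem artinian: "artinian_module (xy_ring m n) N"
  by (rule artinian_if_spanned[OF carrier_eq_span])

end

section \<open>At least two x variables\<close>

text \<open>
  A linear recurrence with leading coefficient \<open>F a\<close> is solved without division: to extend a solution by one
  term, multiply the terms found so far by \<open>F a\<close>.
\<close>

lemma recurrence_solution:
  fixes F :: "nat \<Rightarrow> 'a::idom"
  assumes "1 \<le> a" "F a \<noteq> 0"
  shows "\<exists>u :: nat \<Rightarrow> 'a. u (a - 1) \<noteq> 0 \<and> (\<forall>l<K. (\<Sum>j\<le>a. F j * u (j + l)) = 0)"
proof (induction K)
  case 0
  show ?case by (rule exI[of _ "\<lambda>_. 1"]) simp
next
  case (Suc K)
  then obtain u where u: "u (a - 1) \<noteq> 0" "\<And>l. l < K \<Longrightarrow> (\<Sum>j\<le>a. F j * u (j + l)) = 0" by blast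
  define u' where "u' i = (if i < a + K then F a * u i else - (\<Sum>j<a. F j * u (j + K)))" for i
  have "(\<Sum>j\<le>a. F j * u' (j + l)) = 0" if "l < Suc K" for l
  proof (cases "l < K")
    case True
    then have "(\<Sum>j\<le>a. F j * u' (j + l)) = F a * (\<Sum>j\<le>a. F j * u (j + l))"
      unfolding sum_distrib_left by (intro sum.cong) (auto simp: u'_def mult_ac)
    then show ?thesis using u(2)[OF True] by simp
  next
    case False
    then have l: "l = K" using that by simp
    have "{..a} = insert a {..<a}" by auto
    then have "(\<Sum>j\<le>a. F j * u' (j + l)) = F a * u' (a + K) + (\<Sum>j<a. F j * u' (j + K))"
      unfolding l by simp
    also have "(\<Sum>j<a. F j * u' (j + K)) = F a * (\<Sum>j<a. F j * u (j + K))"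
      unfolding sum_distrib_left by (intro sum.cong) (auto simp: u'_def mult_ac)
    finally show ?thesis by (simp add: u'_def)
  qed
  moreover have "u' (a - 1) \<noteq> 0" using u(1) assms by (simp add: u'_def)
  ultimately show ?case by blast
qed

text \<open>
  The weights define a functional on polynomials of degree at most \<open>k\<close> that kills all multiples of
  the polynomial with coefficients \<open>F\<close> by polynomials of degree at most \<open>k - a\<close>. If \<open>F a = 0\<close>, such products have degree
  less than \<open>k\<close> and the coefficient of degree \<open>k\<close> is a functional of this kind; otherwise the weights solve a recurrence.
\<close>

lemma annihilating_weights:
  fixes F :: "nat \<Rightarrow> 'a::idom"
  assumes a: "1 \<le> a" "a \<le> k"
  shows "\<exists>(u :: nat \<Rightarrow> 'a) i. i \<le> k \<and> u i \<noteq> 0 \<and> (\<forall>l\<le>k - a. (\<Sum>j\<le>a. F j * u (j + l)) = 0)"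
proof (cases "F a = 0")
  case True
  let ?u = "\<lambda>i. if i = k then 1 else (0 :: 'a)"
  have "(\<Sum>j\<le>a. F j * ?u (j + l)) = 0" if "l \<le> k - a" for l
  proof (intro sum.neutral ballI)
    fix j assume "j \<in> {..a}"
    then show "F j * ?u (j + l) = 0" using that a True by (cases "j = a") auto
  qed
  then show ?thesis by (intro exI[of _ ?u] exI[of _ k]) simp
next
  case False
  obtain u where u: "u (a - 1) \<noteq> 0" "\<forall>l<Suc (k - a). (\<Sum>j\<le>a. F j * u (j + l)) = 0"
    using recurrence_solution[of a F "Suc (k - a)"] a(1) False by blast
  have "a - 1 \<le> k" using a by simp
  then show ?thesis using u by (intro exI[of _ u] exI[of _ "a - 1"]) (simp add: less_Suc_eq_le)
qed

text \<open>
  Indexing the \<open>y\<close> variables by natural numbers makes the exponents linearly ordered and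
  the coefficients an integral domain.
\<close>

type_synonym 'k ypoly = "(nat \<Rightarrow>\<^sub>0 nat) \<Rightarrow>\<^sub>0 'k"

definition y_part :: "(nat + nat \<Rightarrow>\<^sub>0 nat) \<Rightarrow> (nat \<Rightarrow>\<^sub>0 nat)"
  where "y_part \<alpha> = Poly_Mapping.map_key Inr \<alpha>"

lemma lookup_y_part: "lookup (y_part \<alpha>) j = lookup \<alpha> (Inr j)"
  by (simp add: y_part_def map_key.rep_eq)

lemma y_part_add: "y_part (\<alpha> + \<beta>) = y_part \<alpha> + y_part \<beta>"
  by (rule poly_mapping_eqI) (simp add: lookup_y_part lookup_add)

definition x_degree_of :: "nat \<Rightarrow> (nat + nat \<Rightarrow>\<^sub>0 nat) \<Rightarrow> nat"
  where "x_degree_of m \<alpha> = (\<Sum>i<m. lookup \<alpha> (Inl i))"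

lemma x_degree_of_add: "x_degree_of m (\<alpha> + \<beta>) = x_degree_of m \<alpha> + x_degree_of m \<beta>"
  by (simp add: x_degree_of_def lookup_add sum.distrib)

lemma two_variables_le:
  assumes "2 \<le> m"
  shows "lookup \<alpha> (Inl 0) + lookup \<alpha> (Inl 1) \<le> x_degree_of m \<alpha>"
proof -
  have "(\<Sum>i\<in>{0, 1}. lookup \<alpha> (Inl i)) \<le> (\<Sum>i<m. lookup \<alpha> (Inl i))"
    using assms by (intro sum_mono2) auto
  then show ?thesis by (simp add: x_degree_of_def)
qed

text \<open>
  The component of \<open>x\<close>-degree \<open>l\<close>, restricted to the first two \<open>x\<close> variables and dehomogenised with respect to the
  second: the remaining \<open>x\<close> variables become \<open>0\<close>, \<open>x\<^sub>2\<close> becomes \<open>1\<close>, and \<open>x\<^sub>1\<close> becomes the variable of the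
  univariate polynomial. A monomial of \<open>x\<close>-degree \<open>l\<close> involves no further \<open>x\<close> variable if and only if its
  exponents of \<open>x\<^sub>1\<close> and \<open>x\<^sub>2\<close> sum to \<open>l\<close>.
\<close>

definition binary_monomial :: "nat \<Rightarrow> nat \<Rightarrow> (nat + nat \<Rightarrow>\<^sub>0 nat) \<Rightarrow> 'k::field \<Rightarrow> 'k ypoly poly"
  where "binary_monomial m l \<alpha> c =
    (if lookup \<alpha> (Inl 0) + lookup \<alpha> (Inl 1) = l \<and> x_degree_of m \<alpha> = l
     then monom (single (y_part \<alpha>) c) (lookup \<alpha> (Inl 0)) else 0)"

definition binary_part :: "nat \<Rightarrow> nat \<Rightarrow> 'k::field bipoly \<Rightarrow> 'k ypoly poly"
  where "binary_part m l p = (\<Sum>\<alpha>\<in>keys p. binary_monomial m l \<alpha> (lookup p \<alpha>))"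

lemma binary_part_single [simp]: "binary_part m l (single \<alpha> c) = binary_monomial m l \<alpha> c"
  by (simp add: binary_part_def binary_monomial_def)

lemma binary_part_add: "binary_part m l (p + q) = binary_part m l p + binary_part m l q"
  unfolding binary_part_def
  by (rule setsum_keys_plus_distrib) (simp_all add: binary_monomial_def single_add add_monom)

lemma binary_part_zero [simp]: "binary_part m l 0 = 0"
  by (simp add: binary_part_def)

lemma binary_part_minus: "binary_part m l (p - q) = binary_part m l p - binary_part m l q"
  using binary_part_add[of m l "p - q" q] by (simp add: algebra_simps)

text \<open>
  By bilinearity it suffices to consider monomials.
\<close>

lemma binary_part_mult:
  assumes m: "2 \<le> m" and p: "\<And>\<alpha>. \<alpha> \<in> keys p \<Longrightarrow> x_degree_of m \<alpha> = a" and k: "a \<le> k"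
  shows "binary_part m k (p * q) = binary_part m a p * binary_part m (k - a) q"
proof -
  have "keys p \<subseteq> {\<alpha>. x_degree_of m \<alpha> = a}" using p by blast
  then show ?thesis
  proof (induction rule: mpoly_induct)
    case (monomial \<alpha> c)
    have "keys q \<subseteq> UNIV" by simp
    then show ?case
    proof (induction rule: mpoly_induct)
      case inner: (monomial \<beta> d)
      have "(lookup (\<alpha> + \<beta>) (Inl 0) + lookup (\<alpha> + \<beta>) (Inl 1) = k \<and> x_degree_of m (\<alpha> + \<beta>) = k) \<longleftrightarrow>
          (lookup \<alpha> (Inl 0) + lookup \<alpha> (Inl 1) = a \<and> x_degree_of m \<alpha> = a) \<and>
          (lookup \<beta> (Inl 0) + lookup \<beta> (Inl 1) = k - a \<and> x_degree_of m \<beta> = k - a)"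
        using two_variables_le[OF m, of \<alpha>] two_variables_le[OF m, of \<beta>] monomial k
        unfolding x_degree_of_add lookup_add by auto
      then have "binary_monomial m k (\<alpha> + \<beta>) (c * d) = binary_monomial m a \<alpha> c * binary_monomial m (k - a) \<beta> d"
        unfolding binary_monomial_def by (simp add: mult_monom mult_single y_part_add lookup_add)
      then show ?case by (simp add: mult_single)
    qed (simp_all add: binary_part_add distrib_left)
  qed (simp_all add: binary_part_add distrib_right)
qed

lemma degree_binary_part: "degree (binary_part m l p) \<le> l"
  unfolding binary_part_def
proof (rule degree_sum_le)
  fix \<alpha> assume "\<alpha> \<in> keys p"
  show "degree (binary_monomial m l \<alpha> (lookup p \<alpha>)) \<le> l"
    by (auto simp: binary_monomial_def intro: order_trans[OF degree_monom_le])
qed simp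

definition ypoly_multiples :: "nat \<Rightarrow> nat \<Rightarrow> 'k::field ypoly set"
  where "ypoly_multiples n T = {p. \<forall>\<kappa>\<in>keys p. \<exists>j<n. T \<le> lookup \<kappa> j}"

lemma ypoly_multiples_closed:
  "0 \<in> ypoly_multiples n T"
  "p \<in> ypoly_multiples n T \<Longrightarrow> q \<in> ypoly_multiples n T \<Longrightarrow> p + q \<in> ypoly_multiples n T"
  "p \<in> ypoly_multiples n T \<Longrightarrow> p * q \<in> ypoly_multiples n T"
proof -
  show "p + q \<in> ypoly_multiples n T" if "p \<in> ypoly_multiples n T" "q \<in> ypoly_multiples n T"
    using that keys_add[of p q] unfolding ypoly_multiples_def by blast
  show "p * q \<in> ypoly_multiples n T" if "p \<in> ypoly_multiples n T"
    using that keys_mult[of p q] unfolding ypoly_multiples_def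
    by (fastforce simp: lookup_add intro: trans_le_add1)
qed (simp add: ypoly_multiples_def)

lemma ypoly_multiples_sum:
  "(\<And>i. i \<in> A \<Longrightarrow> g i \<in> ypoly_multiples n T) \<Longrightarrow> sum g A \<in> ypoly_multiples n T"
  by (induction A rule: infinite_finite_induct) (auto intro: ypoly_multiples_closed)

lemma coeff_binary_part_multiples:
  assumes "p \<in> y_multiples T n"
  shows "coeff (binary_part m l p) i \<in> ypoly_multiples n T"
  unfolding binary_part_def coeff_sum
proof (rule ypoly_multiples_sum)
  fix \<alpha> assume "\<alpha> \<in> keys p"
  then obtain j where "j < n" "T \<le> lookup \<alpha> (Inr j)" using assms by (auto simp: y_multiples_def)
  then show "coeff (binary_monomial m l \<alpha> (lookup p \<alpha>)) i \<in> ypoly_multiples n T"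
    by (auto simp: binary_monomial_def ypoly_multiples_def lookup_y_part)
qed

definition weighted_sum :: "(nat \<Rightarrow> 'a::comm_ring_1) \<Rightarrow> nat \<Rightarrow> 'a poly \<Rightarrow> 'a"
  where "weighted_sum u k P = (\<Sum>i\<le>k. coeff P i * u i)"

lemma weighted_sum_diff: "weighted_sum u k (P - Q) = weighted_sum u k P - weighted_sum u k Q"
  by (simp add: weighted_sum_def left_diff_distrib sum_subtractf)

lemma weighted_sum_monom: "i \<le> k \<Longrightarrow> weighted_sum u k (monom c i) = c * u i"
proof -
  assume i: "i \<le> k"
  have "weighted_sum u k (monom c i) = (\<Sum>i'\<le>k. if i' = i then c * u i else 0)"
    unfolding weighted_sum_def by (intro sum.cong) auto
  then show ?thesis using i by simp
qed

lemma weighted_sum_mult_zero: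
  fixes F G :: "'a::comm_ring_1 poly"
  assumes F: "degree F \<le> a" and G: "degree G \<le> k - a" and a: "a \<le> k"
    and u: "\<And>l. l \<le> k - a \<Longrightarrow> (\<Sum>j\<le>a. coeff F j * u (j + l)) = 0"
  shows "weighted_sum u k (F * G) = 0"
proof -
  have mono: "weighted_sum u k (monom g l * F) = 0" if l: "l \<le> k - a" for g l
  proof -
    have coeff: "coeff (monom g l * F) i = (if l \<le> i then g * coeff F (i - l) else 0)" for i
      by (simp add: coeff_monom_mult not_less)
    have "weighted_sum u k (monom g l * F) = (\<Sum>i\<in>{l..a + l}. g * (coeff F (i - l) * u i))"
      unfolding weighted_sum_def coeff
    proof (rule sum.mono_neutral_cong_right)
      show "\<forall>i\<in>{..k} - {l..a + l}. (if l \<le> i then g * coeff F (i - l) else 0) * u i = 0"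
      proof
        fix i assume "i \<in> {..k} - {l..a + l}"
        then have "l \<le> i \<Longrightarrow> coeff F (i - l) = 0" using F by (intro coeff_eq_0) auto
        then show "(if l \<le> i then g * coeff F (i - l) else 0) * u i = 0" by simp
      qed
    qed (use l a in \<open>auto simp: mult.assoc\<close>)
    also have "\<dots> = (\<Sum>j\<le>a. g * (coeff F j * u (j + l)))"
      by (rule sum.reindex_bij_witness[of _ "\<lambda>j. j + l" "\<lambda>i. i - l"]) auto
    finally show ?thesis using u[OF l] by (simp flip: sum_distrib_left)
  qed
  have G': "G = (\<Sum>l\<le>k - a. monom (coeff G l) l)" using poly_as_sum_of_monoms'[OF G] by simp
  have "F * G = (\<Sum>l\<le>k - a. monom (coeff G l) l * F)"
    by (subst G') (simp add: sum_distrib_left mult.commute)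
  moreover have "weighted_sum u k (sum h A) = (\<Sum>l\<in>A. weighted_sum u k (h l))" if "finite A" for h and A :: "nat set"
    using that by (induction A) (simp_all add: weighted_sum_def distrib_right sum.distrib)
  ultimately show ?thesis using mono by simp
qed

context fraction_presentation
begin

interpretation N: Module.module "xy_ring m n" N by (rule N_module)

definition x_order :: "nat \<Rightarrow> 'k bipoly set"
  where "x_order k = {r \<in> carrier (xy_ring m n). \<forall>\<alpha>\<in>keys r. k \<le> x_degree_of m \<alpha>}"

lemma x_order_closed:
  "0 \<in> x_order k"
  "r \<in> x_order k \<Longrightarrow> s \<in> x_order k \<Longrightarrow> r + s \<in> x_order k"
  "r \<in> x_order k \<Longrightarrow> s \<in> carrier (xy_ring m n) \<Longrightarrow> s * r \<in> x_order k"
proof -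
  show "0 \<in> x_order k" by (simp add: x_order_def)
  show "r + s \<in> x_order k" if "r \<in> x_order k" "s \<in> x_order k"
    using that keys_add[of r s] by (auto simp: x_order_def)
  show "s * r \<in> x_order k" if "r \<in> x_order k" "s \<in> carrier (xy_ring m n)"
    using that keys_mult[of s r] by (fastforce simp: x_order_def x_degree_of_add intro: trans_le_add2)
qed

text \<open>
  The fractions whose numerators have \<open>x\<close>-degree at least \<open>k\<close>, that is \<open>P\<^sub>0\<^sup>k H\<close>.
\<close>

definition x_filtration :: "nat \<Rightarrow> 'c set"
  where "x_filtration k = {\<phi> T r | T r. r \<in> x_order k}"

lemma x_filtration_submodule: "submodule (x_filtration k) (xy_ring m n) N"
proof (rule N.submoduleI)
  have carr: "r \<in> carrier (xy_ring m n)" if "r \<in> x_order k" for r using that by (simp add: x_order_def)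
  show "x_filtration k \<subseteq> carrier N" using carr by (auto simp: x_filtration_def intro: phi_closed)
  show "\<zero>\<^bsub>N\<^esub> \<in> x_filtration k"
    using phi_zero[of 0] x_order_closed(1) unfolding x_filtration_def by (metis (mono_tags, lifting) mem_Collect_eq)
  have smult: "s \<odot>\<^bsub>N\<^esub> z \<in> x_filtration k" if s: "s \<in> carrier (xy_ring m n)" and z: "z \<in> x_filtration k" for s z
  proof -
    obtain T r where r: "z = \<phi> T r" "r \<in> x_order k" using z by (auto simp: x_filtration_def)
    then have "s \<odot>\<^bsub>N\<^esub> z = \<phi> T (s * r)" using phi_smult[OF carr s] by simp
    then show ?thesis using x_order_closed(3)[OF r(2) s] by (auto simp: x_filtration_def)
  qed
  then show "s \<odot>\<^bsub>N\<^esub> z \<in> x_filtration k" if "s \<in> carrier (xy_ring m n)" "z \<in> x_filtration k" for s z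
    using that by blast
  show "\<ominus>\<^bsub>N\<^esub> z \<in> x_filtration k" if z: "z \<in> x_filtration k" for z
  proof -
    have "z \<in> carrier N" using z carr by (auto simp: x_filtration_def intro: phi_closed)
    then have "\<ominus>\<^bsub>N\<^esub> z = (\<ominus>\<^bsub>xy_ring m n\<^esub> \<one>\<^bsub>xy_ring m n\<^esub>) \<odot>\<^bsub>N\<^esub> z"
      using N.smult_l_minus[OF N.R.one_closed, of z] N.smult_one[of z] by simp
    then show ?thesis using smult[OF _ z, of "\<ominus>\<^bsub>xy_ring m n\<^esub> \<one>\<^bsub>xy_ring m n\<^esub>"] N.R.a_inv_closed[OF N.R.one_closed]
      by simp
  qed
  show "z \<oplus>\<^bsub>N\<^esub> z' \<in> x_filtration k" if zz': "z \<in> x_filtration k" "z' \<in> x_filtration k" for z z'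
  proof -
    obtain T r T' r' where r: "z = \<phi> T r" "r \<in> x_order k" "z' = \<phi> T' r'" "r' \<in> x_order k"
      using zz' by (auto simp: x_filtration_def)
    have "z = \<phi> (T + T') (y_monomial n T' * r)" "z' = \<phi> (T + T') (y_monomial n T * r')"
      using phi_shift[OF carr[OF r(2)], of T T'] phi_shift[OF carr[OF r(4)], of T' T] r by (simp_all add: add.commute)
    then have "z \<oplus>\<^bsub>N\<^esub> z' = \<phi> (T + T') (y_monomial n T' * r + y_monomial n T * r')"
      using carr[OF r(2)] carr[OF r(4)] by (simp add: phi_add)
    moreover have "y_monomial n T' * r + y_monomial n T * r' \<in> x_order k"
      using r by (intro x_order_closed) auto
    ultimately show ?thesis by (auto simp: x_filtration_def)
  qed
qed

text \<open>
  If the chain became stationary, then for some \<open>k \<ge> a\<close> the fraction \<open>x\<^sub>1\<^sup>i x\<^sub>2\<^sup>k\<^sup>-\<^sup>i / (y\<^sub>1 \<cdots> y\<^sub>n)\<^sup>T\<close> would have a numerator of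
  \<open>x\<close>-degree greater than \<open>k\<close>. In the component of degree \<open>k\<close> this says that \<open>(y\<^sub>1 \<cdots> y\<^sub>n)\<^sup>s x\<^sub>1\<^sup>i x\<^sub>2\<^sup>k\<^sup>-\<^sup>i\<close> is a multiple of \<open>f\<close> up to
  elements of \<open>(y\<^sub>1\<^sup>T\<^sup>+\<^sup>s, \<dots>, y\<^sub>n\<^sup>T\<^sup>+\<^sup>s)\<close>. Applying the functional given by the weights \<open>u\<close> yields
  \<open>u i \<in> (y\<^sub>1\<^sup>T, \<dots>, y\<^sub>n\<^sup>T)\<close>, which is false for large \<open>T\<close> since \<open>u i \<noteq> 0\<close>.
\<close>

theorem not_artinian:
  assumes m: "2 \<le> m" and a: "1 \<le> a"
    and f: "\<And>\<alpha>. \<alpha> \<in> keys f \<Longrightarrow> x_degree_of m \<alpha> = a"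
  shows "\<not> artinian_module (xy_ring m n) N"
proof
  assume "artinian_module (xy_ring m n) N"
  moreover have "x_filtration (Suc i) \<subseteq> x_filtration i" for i
    by (fastforce simp: x_filtration_def x_order_def)
  ultimately obtain k0 where k0: "\<And>i. i \<ge> k0 \<Longrightarrow> x_filtration i = x_filtration k0"
    using x_filtration_submodule unfolding artinian_module_def by blast
  define k where "k = max k0 a"
  have k: "a \<le> k" and step: "x_filtration k = x_filtration (Suc k)"
    using k0[of k] k0[of "Suc k"] by (simp_all add: k_def)
  define F where "F = binary_part m a f"
  obtain u :: "nat \<Rightarrow> 'k ypoly" and i where i: "i \<le> k" "u i \<noteq> 0"
    and u: "\<And>l. l \<le> k - a \<Longrightarrow> (\<Sum>j\<le>a. coeff F j * u (j + l)) = 0"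
    using annihilating_weights[OF a k, of "coeff F"] by blast
  have "keys (u i) \<noteq> {}" using i(2) by simp
  then obtain \<kappa> where \<kappa>: "\<kappa> \<in> keys (u i)" by blast
  \<comment> \<open>Large enough that the monomial \<open>\<kappa>\<close> of \<open>u i\<close> lies outside \<open>(y\<^sub>1\<^sup>T, \<dots>, y\<^sub>n\<^sup>T)\<close>.\<close>
  define T where "T = Suc (\<Sum>j<n. lookup \<kappa> j)"
  define \<rho> where "\<rho> = single (Inl 0 :: nat + nat) i + single (Inl 1) (k - i)"
  define r :: "'k bipoly" where "r = single \<rho> 1"
  have \<rho>_lookup: "lookup \<rho> (Inl 0) = i" "lookup \<rho> (Inl 1) = k - i"
    "lookup \<rho> (Inl (Suc (Suc j))) = 0" "lookup \<rho> (Inr j) = 0" for j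
    by (simp_all add: \<rho>_def lookup_add lookup_single)
  have "x_degree_of m \<rho> = (\<Sum>j\<in>{0, 1}. lookup \<rho> (Inl j))"
    unfolding x_degree_of_def
  proof (rule sum.mono_neutral_right)
    show "\<forall>j\<in>{..<m} - {0, 1}. lookup \<rho> (Inl j) = 0"
    proof
      fix j assume "j \<in> {..<m} - {0, 1}"
      then have "j = Suc (Suc (j - 2))" by auto
      then show "lookup \<rho> (Inl j) = 0" using \<rho>_lookup(3)[of "j - 2"] by simp
    qed
  qed (use m in auto)
  then have \<rho>_deg: "x_degree_of m \<rho> = k" using \<rho>_lookup i(1) by simp
  have \<rho>_keys: "keys \<rho> \<subseteq> xy_vars m n"
    using m unfolding \<rho>_def keys_add_exponents xy_vars_def by auto
  have r_mem: "r \<in> carrier (xy_ring m n)" unfolding r_def using \<rho>_keys by simp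
  have "r \<in> x_order k" using r_mem \<rho>_deg by (simp add: x_order_def r_def)
  then have "\<phi> T r \<in> x_filtration k" by (auto simp: x_filtration_def)
  then have "\<phi> T r \<in> x_filtration (Suc k)" using step by simp
  then obtain T' r' where r': "\<phi> T r = \<phi> T' r'" "r' \<in> x_order (Suc k)" by (auto simp: x_filtration_def)
  have r'_mem: "r' \<in> carrier (xy_ring m n)" using r'(2) by (simp add: x_order_def)
  let ?p = "y_monomial n T' * r - y_monomial n T * r'"
  have mem: "y_monomial n T' * r \<in> carrier (xy_ring m n)" "y_monomial n T * r' \<in> carrier (xy_ring m n)"
    "?p \<in> carrier (xy_ring m n)" using r_mem r'_mem by simp_all
  have eq: "\<phi> (T + T') (y_monomial n T' * r) = \<phi> (T + T') (y_monomial n T * r')"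
    using phi_shift[OF r_mem, of T T'] phi_shift[OF r'_mem, of T' T] r'(1) by (simp add: add.commute)
  have "\<phi> (T + T') ?p \<oplus>\<^bsub>N\<^esub> \<phi> (T + T') (y_monomial n T * r') = \<phi> (T + T') (y_monomial n T' * r)"
    using phi_add[OF mem(3,2), of "T + T'"] by simp
  then have "\<phi> (T + T') ?p = \<zero>\<^bsub>N\<^esub>"
    using eq phi_closed[OF mem(3), of "T + T'"] phi_closed[OF mem(2), of "T + T'"] by simp
  then obtain t h where h: "h \<in> carrier (xy_ring m n)"
    "y_monomial n t * ?p - f * h \<in> y_multiples (T + T' + t) n"
    using phi_eq_zero_iff[OF mem(3)] by blast
  define q where "q = y_monomial n t * ?p - f * h"
  have "q = y_monomial n (t + T') * r - y_monomial n (t + T) * r' - f * h"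
    unfolding q_def by (simp add: algebra_simps flip: y_monomial_mult)
  then have Pq: "binary_part m k q = binary_part m k (y_monomial n (t + T') * r) -
      binary_part m k (y_monomial n (t + T) * r') - binary_part m k (f * h)"
    by (simp add: binary_part_minus)
  define \<eta> where "\<eta> = y_part (y_exponent n (t + T'))"
  have "x_degree_of m (y_exponent n (t + T')) = 0" by (simp add: x_degree_of_def lookup_y_exponent)
  moreover have "y_part \<rho> = 0" by (rule poly_mapping_eqI) (simp add: lookup_y_part \<rho>_lookup)
  ultimately have P1: "binary_part m k (y_monomial n (t + T') * r) = monom (single \<eta> 1) i"
    using i(1) by (simp add: y_monomial_def r_def mult_single binary_monomial_def x_degree_of_add \<rho>_deg
        lookup_add lookup_y_exponent \<rho>_lookup \<rho>_lookup(2)[unfolded One_nat_def] y_part_add \<eta>_def)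
  have "y_monomial n (t + T) * r' \<in> x_order (Suc k)" using r'(2) by (intro x_order_closed) auto
  then have P2: "binary_part m k (y_monomial n (t + T) * r') = 0"
    unfolding binary_part_def by (intro sum.neutral) (auto simp: x_order_def binary_monomial_def)
  have P3: "binary_part m k (f * h) = F * binary_part m (k - a) h"
    unfolding F_def by (rule binary_part_mult[OF m f k])
  have "weighted_sum u k (binary_part m k q) = single \<eta> 1 * u i"
    unfolding Pq P1 P2 P3 weighted_sum_diff weighted_sum_monom[OF i(1)]
    using weighted_sum_mult_zero[OF _ degree_binary_part k u] degree_binary_part[of m a f]
    by (simp add: F_def weighted_sum_def)
  moreover have "weighted_sum u k (binary_part m k q) \<in> ypoly_multiples n (T + T' + t)"
    unfolding weighted_sum_def using h(2)
    by (intro ypoly_multiples_sum ypoly_multiples_closed coeff_binary_part_multiples) (simp add: q_def)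
  moreover have "\<eta> + \<kappa> \<in> keys (single \<eta> 1 * u i)"
    using \<kappa> by (simp add: keys_monomial_times)
  ultimately obtain j where j: "j < n" "T + T' + t \<le> lookup (\<eta> + \<kappa>) j"
    by (auto simp: ypoly_multiples_def)
  then have "T \<le> lookup \<kappa> j" by (simp add: \<eta>_def lookup_add lookup_y_part lookup_y_exponent)
  moreover have "lookup \<kappa> j \<le> (\<Sum>j<n. lookup \<kappa> j)"
    using j(1) by (intro member_le_sum) auto
  ultimately show False by (simp add: T_def)
qed

end

section \<open>The hypersurface theorem\<close>

theorem proposition3p2:
  fixes f :: "'k::field bipoly"
    and m n a b :: nat
    and E :: "nat \<Rightarrow> ('k bipoly, 'e) module"
    and d :: "nat \<Rightarrow> 'e \<Rightarrow> 'e"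
    and \<epsilon> :: "'k bipoly set \<Rightarrow> 'e"
  assumes "bihomogeneous m n a b f" and "f \<noteq> 0"
    and "injective_resolution (xy_ring m n) (hypersurface_module m n f) E d \<epsilon>"
  shows "(m \<le> 1 \<longrightarrow>
            artinian_module (xy_ring m n)
              (local_cohomology (xy_ring m n) (y_ideal m n) E d n))
       \<and> (2 \<le> m \<and> 1 \<le> a \<longrightarrow>
            artinian_module (xy_ring m n)
              (local_cohomology (xy_ring m n) (y_ideal m n) E d n) \<longrightarrow>
            primary_to (x_ring m) (x_ideal m) (content_ideal m f)
            \<and> \<not> forms_system_of_parameters (x_ring m) (x_ideal m) (content_ideal m f))"
proof -
  have f_mem: "f \<in> carrier (xy_ring m n)"
    and deg: "\<And>\<alpha>. \<alpha> \<in> keys f \<Longrightarrow> (\<Sum>i<m. lookup \<alpha> (Inl i)) = a"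
    using assms(1) by (auto simp: bihomogeneous_def)
  interpret hypersurface_resolution m n f E d \<epsilon>
    by unfold_locales (rule assms(3), rule f_mem)
  interpret H: fraction_presentation m n f "local_cohomology (xy_ring m n) (y_ideal m n) E d n" fraction
    by (rule local_cohomology_presentation)
  have "artinian_module (xy_ring m n) (local_cohomology (xy_ring m n) (y_ideal m n) E d n)" if m: "m \<le> 1"
  proof -
    have "lookup \<alpha> (Inl 0) = a" if "\<alpha> \<in> keys f" for \<alpha>
    proof (cases "m = 0")
      case True
      have "keys \<alpha> \<subseteq> xy_vars m n" using f_mem that by (simp add: mem_xy_ring_iff)
      then have "Inl 0 \<notin> keys \<alpha>" using True by (auto simp: xy_vars_def)
      then show ?thesis using deg[OF that] True by (simp add: in_keys_iff)
    next
      case False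
      then have "m = 1" using m by simp
      then show ?thesis using deg[OF that] by simp
    qed
    then interpret principal_fractions m n f "local_cohomology (xy_ring m n) (y_ideal m n) E d n" fraction a
      using m assms(2) by unfold_locales
    show ?thesis by (rule artinian)
  qed
  moreover have "\<not> artinian_module (xy_ring m n) (local_cohomology (xy_ring m n) (y_ideal m n) E d n)"
    if "2 \<le> m" "1 \<le> a"
    using H.not_artinian[OF that] deg by (simp add: x_degree_of_def)
  ultimately show ?thesis by blast
qed

end
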